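(* Let $A$ be an ordered set, and $R$ a commutative unital ring. Consider the Hochschild cohomology $H^* := H^*(\mathbf{Pl}_A; R, \varepsilon_0)$ of the plactic monoid on $A$ with coefficients in $(R, \varepsilon_0)$. (1) $H^*$ is non-zero in every degree, unless $|A| \le 2$. (2) There is an $R$-linear isomorphism $H^1 \simeq A^*=\operatorname{Map}(A,R)$. (3) There is an $R$-linear isomorphism $H^2 \simeq (\mathbf{C}_A^{\wedge})^*=\operatorname{Map}(\mathbf{C}_A^{\wedge},R)$, where $\mathbf{C}_A^{\wedge}$ is the collection of couples of $A$-columns $(a, bd)$, with $a$ a one-letter column and $bd$ a two-letter column ($b>d$, $b$ on top), such that $a \le b$. (4) The cup product vanishes on $H^1$. (5) For the two-letter alphabet $A=\{1,2\}$ with $1<2$: $H^1$ has basis $f_{1}, f_{2}$; $H^2$ has basis $f_{1,21}, f_{2,21}$; $H^3$ has basis $f_{2,1,21}$; the cohomology vanishes in degrees $\ge 4$. The only non-zero cup products among these generators are $f_{2} \smile f_{1,21} = - f_{2,21} \smile f_{1} = f_{2,1,21}$.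
   Context: $\mathbf{Pl}_A$ is the plactic monoid, the quotient of $A^*$ by the Knuth relations $xzy \sim zxy$ ($x \le y < z$) and $yxz \sim yzx$ ($x < y \le z$). An $A$-column is a strictly decreasing word in $A$, written as a column read from top to bottom (so $21$ denotes the column with $2$ on top of $1$); $\boldsymbol{e}_C$ is the empty column. The column braiding $\sigma_C$ on columns is defined via the Schensted product $\ast$ of one-column tableaux: $\sigma_C(c_1,c_2)=(c_3,c_4)$ if $c_1\ast c_2$ has two non-empty columns $c_3,c_4$ (left to right), and $\sigma_C(c_1,c_2)=(c_1c_2,\boldsymbol{e}_C)$ if $c_1\ast c_2$ is a single column. $\varepsilon_0$ is the character of $\mathbf{Pl}_A$ equal to $1_R$ on the empty word and $0$ on all non-empty words; Hochschild cohomology has both actions on $R$ given by $\varepsilon_0$. A $k$-tuple $(c_1,\dots,c_k)$ of non-empty columns is critical if $\sigma_C(c_i,c_{i+1})\neq(c_i,c_{i+1})$ for all $i$; for such a tuple, $f_{c_1,\dots,c_k}$ is the cochain $\mathbf{Col}_A^{\times k}\to R$ equal to $1_R$ on $(c_1,\dots,c_k)$ and $0$ elsewhere. A cocycle $f$ of the braided (critical cochain) complex of $(\mathbf{Col}_A,\sigma_C,\boldsymbol{e}_C)$ with coefficients $(R,\varepsilon_0)$ denotes also the Hochschild class corresponding to it under the quantum symmetrizer isomorphism between this braided cohomology and $H^*(\mathbf{Pl}_A;R,\varepsilon_0)$ (an isomorphism of graded algebras). *)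

theory Defs
  imports "HOL-Algebra.Module" "HOL-Combinatorics.Permutations"
begin

section \<open>Plactic monoid\<close>

inductive knuth_step :: "'a::linorder set \<Rightarrow> 'a list \<Rightarrow> 'a list \<Rightarrow> bool" for A where
  "set (u @ [x, y, z] @ v) \<subseteq> A \<Longrightarrow> x \<le> y \<Longrightarrow> y < z \<Longrightarrow>
     knuth_step A (u @ [x, z, y] @ v) (u @ [z, x, y] @ v)"
| "set (u @ [x, y, z] @ v) \<subseteq> A \<Longrightarrow> x < y \<Longrightarrow> y \<le> z \<Longrightarrow>
     knuth_step A (u @ [y, x, z] @ v) (u @ [y, z, x] @ v)"

definition knuth_cong :: "'a::linorder set \<Rightarrow> ('a list \<times> 'a list) set" where
  "knuth_cong A = {(u, v). u \<in> lists A \<and> v \<in> lists A \<and> equivclp (knuth_step A) u v}"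

definition plactic_class :: "'a::linorder set \<Rightarrow> 'a list \<Rightarrow> 'a list set" where
  "plactic_class A u = knuth_cong A `` {u}"

definition plactic :: "'a::linorder set \<Rightarrow> 'a list set monoid" where
  "plactic A = \<lparr>carrier = lists A // knuth_cong A,
                monoid.mult = (\<lambda>X Y. \<Union>u\<in>X. \<Union>v\<in>Y. plactic_class A (u @ v)),
                one = plactic_class A []\<rparr>"

definition eps0 :: "'a list set \<Rightarrow> 'r::comm_ring_1" where
  "eps0 X = (if [] \<in> X then 1 else 0)"


section \<open>Columns and the column braiding\<close>

definition Col :: "'a::linorder set \<Rightarrow> 'a list set" where
  "Col A = {c. set c \<subseteq> A \<and> sorted_wrt (>) c}"

text \<open>A tableau is the list of its rows, the bottom row first (French notation): rows
  increase weakly from left to right, columns increase strictly from bottom to top.\<close>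

fun row_insert :: "'a::linorder \<Rightarrow> 'a list \<Rightarrow> 'a list \<times> 'a option" where
  "row_insert x [] = ([x], None)"
| "row_insert x (y # ys) =
     (if x < y then (x # ys, Some y)
      else let (zs, b) = row_insert x ys in (y # zs, b))"

fun tableau_insert :: "'a::linorder \<Rightarrow> 'a list list \<Rightarrow> 'a list list" where
  "tableau_insert x [] = [[x]]"
| "tableau_insert x (r # rs) =
     (case row_insert x r of
        (r', None) \<Rightarrow> r' # rs
      | (r', Some y) \<Rightarrow> r' # tableau_insert y rs)"

definition schensted_product :: "'a::linorder list list \<Rightarrow> 'a list list \<Rightarrow> 'a list list" where
  "schensted_product T U = fold tableau_insert (concat (rev U)) T"

definition column_tableau :: "'a list \<Rightarrow> 'a list list" where
  "column_tableau c = map (\<lambda>x. [x]) (rev c)"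

definition tableau_columns :: "'a list list \<Rightarrow> 'a list list" where
  "tableau_columns T = map rev (List.transpose T)"

definition sigma_C :: "'a::linorder list \<times> 'a list \<Rightarrow> 'a list \<times> 'a list" where
  "sigma_C = (\<lambda>(c1, c2).
     case tableau_columns (schensted_product (column_tableau c1) (column_tableau c2)) of
       [c3, c4] \<Rightarrow> (c3, c4)
     | _ \<Rightarrow> (c1 @ c2, []))"


section \<open>Cohomology of a cochain complex\<close>

text \<open>\<open>k\<close>-tuples are lists of length \<open>k\<close>. A \<open>k\<close>-cochain with values in the ring \<open>'r\<close> is a
  function on lists which vanishes off the \<open>k\<close>-tuples, so that equality of cochains is equality
  of functions. The fields \<open>mult\<close> and \<open>one\<close> which the record type of modules inherits from
  rings play no role.\<close>

definition tuples :: "'x set \<Rightarrow> nat \<Rightarrow> 'x list set" where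
  "tuples X k = {xs. length xs = k \<and> set xs \<subseteq> X}"

definition cocycles ::
  "(nat \<Rightarrow> ('x \<Rightarrow> 'r::comm_ring_1) set) \<Rightarrow> (nat \<Rightarrow> ('x \<Rightarrow> 'r) \<Rightarrow> 'x \<Rightarrow> 'r) \<Rightarrow> nat \<Rightarrow> ('x \<Rightarrow> 'r) set" where
  "cocycles C d k = {f \<in> C k. d k f = (\<lambda>_. 0)}"

definition coboundaries ::
  "(nat \<Rightarrow> ('x \<Rightarrow> 'r::comm_ring_1) set) \<Rightarrow> (nat \<Rightarrow> ('x \<Rightarrow> 'r) \<Rightarrow> 'x \<Rightarrow> 'r) \<Rightarrow> nat \<Rightarrow> ('x \<Rightarrow> 'r) set" where
  "coboundaries C d k = (case k of 0 \<Rightarrow> {\<lambda>_. 0} | Suc j \<Rightarrow> d j ` C j)"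

definition cohomologous ::
  "(nat \<Rightarrow> ('x \<Rightarrow> 'r::comm_ring_1) set) \<Rightarrow> (nat \<Rightarrow> ('x \<Rightarrow> 'r) \<Rightarrow> 'x \<Rightarrow> 'r) \<Rightarrow> nat
     \<Rightarrow> (('x \<Rightarrow> 'r) \<times> ('x \<Rightarrow> 'r)) set" where
  "cohomologous C d k =
     {(f, g). f \<in> cocycles C d k \<and> g \<in> cocycles C d k \<and> (\<lambda>x. f x - g x) \<in> coboundaries C d k}"

definition cohomology ::
  "(nat \<Rightarrow> ('x \<Rightarrow> 'r::comm_ring_1) set) \<Rightarrow> (nat \<Rightarrow> ('x \<Rightarrow> 'r) \<Rightarrow> 'x \<Rightarrow> 'r) \<Rightarrow> nat
     \<Rightarrow> ('r, ('x \<Rightarrow> 'r) set) module" where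
  "cohomology C d k =
     \<lparr>carrier = cocycles C d k // cohomologous C d k,
      monoid.mult = undefined, one = undefined,
      zero = cohomologous C d k `` {\<lambda>_. 0},
      add = (\<lambda>X Y. \<Union>f\<in>X. \<Union>g\<in>Y. cohomologous C d k `` {\<lambda>x. f x + g x}),
      smult = (\<lambda>r X. \<Union>f\<in>X. cohomologous C d k `` {\<lambda>x. r * f x})\<rparr>"


section \<open>Hochschild cohomology of a monoid, both actions on the ring given by a character\<close>

definition hoch_cochains :: "('m, 'b) monoid_scheme \<Rightarrow> nat \<Rightarrow> ('m list \<Rightarrow> 'r::comm_ring_1) set" where
  "hoch_cochains M k = {f. \<forall>xs. xs \<notin> tuples (carrier M) k \<longrightarrow> f xs = 0}"

definition hoch_diff ::
  "('m, 'b) monoid_scheme \<Rightarrow> ('m \<Rightarrow> 'r::comm_ring_1) \<Rightarrow> nat \<Rightarrow> ('m list \<Rightarrow> 'r) \<Rightarrow> 'm list \<Rightarrow> 'r" where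
  "hoch_diff M chi k f = (\<lambda>xs.
     if xs \<in> tuples (carrier M) (Suc k) then
       chi (hd xs) * f (tl xs)
       + (\<Sum>i<k. (- 1) ^ Suc i *
            f (take i xs @ [xs ! i \<otimes>\<^bsub>M\<^esub> xs ! Suc i] @ drop (Suc (Suc i)) xs))
       + (- 1) ^ Suc k * (f (butlast xs) * chi (last xs))
     else 0)"

definition plactic_cohomology ::
  "'a::linorder set \<Rightarrow> nat \<Rightarrow> ('r::comm_ring_1, ('a list set list \<Rightarrow> 'r) set) module" where
  "plactic_cohomology A k = cohomology (hoch_cochains (plactic A)) (hoch_diff (plactic A) eps0) k"

definition plactic_cup ::
  "'a::linorder set \<Rightarrow> nat \<Rightarrow> nat \<Rightarrow> ('a list set list \<Rightarrow> 'r::comm_ring_1) set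
     \<Rightarrow> ('a list set list \<Rightarrow> 'r) set \<Rightarrow> ('a list set list \<Rightarrow> 'r) set" where
  "plactic_cup A p q X Y =
     (\<Union>f\<in>X. \<Union>g\<in>Y.
        cohomologous (hoch_cochains (plactic A)) (hoch_diff (plactic A) eps0) (p + q)
          `` {\<lambda>xs. f (take p xs) * g (drop p xs)})"


section \<open>Critical braided cohomology\<close>

definition braid_at :: "('x \<times> 'x \<Rightarrow> 'x \<times> 'x) \<Rightarrow> nat \<Rightarrow> 'x list \<Rightarrow> 'x list" where
  "braid_at \<sigma> i xs = (let (a, b) = \<sigma> (xs ! i, xs ! Suc i) in xs[i := a, Suc i := b])"

text \<open>The last index of the word acts first.\<close>

definition braid_word :: "('x \<times> 'x \<Rightarrow> 'x \<times> 'x) \<Rightarrow> nat list \<Rightarrow> 'x list \<Rightarrow> 'x list" where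
  "braid_word \<sigma> w xs = foldr (braid_at \<sigma>) w xs"

definition critical_tuples :: "'x set \<Rightarrow> ('x \<times> 'x \<Rightarrow> 'x \<times> 'x) \<Rightarrow> 'x \<Rightarrow> nat \<Rightarrow> 'x list set" where
  "critical_tuples X \<sigma> e k =
     {xs \<in> tuples X k. e \<notin> set xs \<and>
        (\<forall>i. Suc i < k \<longrightarrow> \<sigma> (xs ! i, xs ! Suc i) \<noteq> (xs ! i, xs ! Suc i))}"

definition crit_cochains ::
  "'x set \<Rightarrow> ('x \<times> 'x \<Rightarrow> 'x \<times> 'x) \<Rightarrow> 'x \<Rightarrow> nat \<Rightarrow> ('x list \<Rightarrow> 'r::comm_ring_1) set" where
  "crit_cochains X \<sigma> e k = {f. \<forall>xs. xs \<notin> critical_tuples X \<sigma> e k \<longrightarrow> f xs = 0}"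

text \<open>In the summand of index \<open>i\<close>, the entry in position \<open>i\<close> (counted from 0) is braided past all
  entries on its left and then acts on the left, respectively is braided past all entries on its
  right and then acts on the right.\<close>

definition braided_diff ::
  "'x set \<Rightarrow> ('x \<times> 'x \<Rightarrow> 'x \<times> 'x) \<Rightarrow> ('x \<Rightarrow> 'r::comm_ring_1) \<Rightarrow> nat \<Rightarrow> ('x list \<Rightarrow> 'r) \<Rightarrow> 'x list \<Rightarrow> 'r" where
  "braided_diff X \<sigma> chi k f = (\<lambda>xs.
     if xs \<in> tuples X (Suc k) then
       (\<Sum>i<Suc k. (- 1) ^ i *
          (let l = braid_word \<sigma> [0..<i] xs; r = braid_word \<sigma> (rev [i..<k]) xs
           in chi (hd l) * f (tl l) - f (butlast r) * chi (last r)))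
     else 0)"

definition column_cochains :: "'a::linorder set \<Rightarrow> nat \<Rightarrow> ('a list list \<Rightarrow> 'r::comm_ring_1) set" where
  "column_cochains A = crit_cochains (Col A) sigma_C []"

definition column_diff ::
  "'a::linorder set \<Rightarrow> nat \<Rightarrow> ('a list list \<Rightarrow> 'r::comm_ring_1) \<Rightarrow> 'a list list \<Rightarrow> 'r" where
  "column_diff A = braided_diff (Col A) sigma_C (\<lambda>c. eps0 (plactic_class A c))"


section \<open>Quantum symmetrizer\<close>

definition reduced_word :: "nat \<Rightarrow> (nat \<Rightarrow> nat) \<Rightarrow> nat list" where
  "reduced_word k s =
     (ARG_MIN length w. (\<forall>i\<in>set w. Suc i < k) \<and>
        foldr (\<lambda>i p. Transposition.transpose i (Suc i) \<circ> p) w id = s)"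

definition quantum_symmetrizer ::
  "'x set \<Rightarrow> ('x \<times> 'x \<Rightarrow> 'x \<times> 'x) \<Rightarrow> ('x \<Rightarrow> 'm) \<Rightarrow> nat \<Rightarrow> ('m list \<Rightarrow> 'r::comm_ring_1) \<Rightarrow> 'x list \<Rightarrow> 'r" where
  "quantum_symmetrizer X \<sigma> \<iota> k f = (\<lambda>xs.
     if xs \<in> tuples X k then
       (\<Sum>s | s permutes {..<k}. of_int (sign s) * f (map \<iota> (braid_word \<sigma> (reduced_word k s) xs)))
     else 0)"

definition normalized_cochains :: "('m, 'b) monoid_scheme \<Rightarrow> nat \<Rightarrow> ('m list \<Rightarrow> 'r::comm_ring_1) set" where
  "normalized_cochains M k = {f \<in> hoch_cochains M k. \<forall>xs. \<one>\<^bsub>M\<^esub> \<in> set xs \<longrightarrow> f xs = 0}"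

text \<open>The quantum symmetrizer maps the normalized Hochschild complex to the critical complex
  (critical tuples avoid the empty column, but their braidings do not), and every Hochschild class
  has normalized representatives. Hence the map on cohomology is computed on these.\<close>

definition column_symmetrizer ::
  "'a::linorder set \<Rightarrow> nat \<Rightarrow> ('a list set list \<Rightarrow> 'r::comm_ring_1) set \<Rightarrow> ('a list list \<Rightarrow> 'r) set" where
  "column_symmetrizer A k X =
     (\<Union>f \<in> X \<inter> normalized_cochains (plactic A) k.
        cohomologous (column_cochains A) (column_diff A) k
          `` {quantum_symmetrizer (Col A) sigma_C (plactic_class A) k f})"

definition hoch_class_of ::
  "'a::linorder set \<Rightarrow> nat \<Rightarrow> ('a list list \<Rightarrow> 'r::comm_ring_1) \<Rightarrow> ('a list set list \<Rightarrow> 'r) set" where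
  "hoch_class_of A k f =
     the_inv_into (carrier (plactic_cohomology A k)) (column_symmetrizer A k)
       (cohomologous (column_cochains A) (column_diff A) k `` {f})"

text \<open>The class of the cochain \<open>f\<^bsub>c\<^sub>1,\<dots>,c\<^sub>k\<^esub>\<close>, where \<open>cs\<close> is the list of the columns \<open>c\<^sub>i\<close>.\<close>

definition column_class ::
  "'a::linorder set \<Rightarrow> 'a list list \<Rightarrow> ('a list set list \<Rightarrow> 'r::comm_ring_1) set" where
  "column_class A cs = hoch_class_of A (length cs) (\<lambda>xs. if xs = cs then 1 else 0)"


section \<open>Linear isomorphisms, modules of maps, bases\<close>

definition map_module :: "'s set \<Rightarrow> ('r::comm_ring_1, 's \<Rightarrow> 'r) module" where
  "map_module S =
     \<lparr>carrier = S \<rightarrow>\<^sub>E UNIV,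
      monoid.mult = undefined, one = undefined,
      zero = (\<lambda>s\<in>S. 0),
      add = (\<lambda>f g. \<lambda>s\<in>S. f s + g s),
      smult = (\<lambda>r f. \<lambda>s\<in>S. r * f s)\<rparr>"

definition linearly_isomorphic :: "('r, 'm) module \<Rightarrow> ('r, 'n) module \<Rightarrow> bool" where
  "linearly_isomorphic M N \<longleftrightarrow>
     (\<exists>\<phi>. bij_betw \<phi> (carrier M) (carrier N) \<and>
        (\<forall>x\<in>carrier M. \<forall>y\<in>carrier M. \<phi> (x \<oplus>\<^bsub>M\<^esub> y) = \<phi> x \<oplus>\<^bsub>N\<^esub> \<phi> y) \<and>
        (\<forall>r. \<forall>x\<in>carrier M. \<phi> (r \<odot>\<^bsub>M\<^esub> x) = r \<odot>\<^bsub>N\<^esub> \<phi> x))"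

definition is_basis :: "('r, 'm) module \<Rightarrow> 'm list \<Rightarrow> bool" where
  "is_basis M bs \<longleftrightarrow> set bs \<subseteq> carrier M \<and>
     (\<forall>x\<in>carrier M. \<exists>!c. c \<in> {..<length bs} \<rightarrow>\<^sub>E UNIV \<and>
        x = (\<Oplus>\<^bsub>M\<^esub>i\<in>{..<length bs}. c i \<odot>\<^bsub>M\<^esub> bs ! i))"

definition C_wedge :: "'a::linorder set \<Rightarrow> ('a list \<times> 'a list) set" where
  "C_wedge A = {([a], [b, d]) | a b d. [a] \<in> Col A \<and> [b, d] \<in> Col A \<and> a \<le> b}"

end

theory Submission
  imports Defs
begin

text \<open>
  Bar cochains are read recursively in their first argument, so that restricting that argument to a
  right ideal \<open>N\<close> computes the Ext groups of \<open>N\<close>; over a free right ideal every cocycle of positive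
  degree is a coboundary.

  A 2-cocycle \<open>f(u, v)\<close> depends only on the word \<open>u v\<close>, and it is a coboundary iff it respects the Knuth
  relations. These have length 3, so they can be violated independently of each other, and products of
  1-cocycles, which live on words of length 2, respect them.

  For three letters the critical tuples \<open>1, 32, 1, 32, \<dots>\<close> and \<open>2, 1, 32, 1, 32, \<dots>\<close> are at the same time
  cycles and cocycles of the critical complex. Carried over to the bar complex they become a cycle and a
  cocycle with value 1 on each other.

  For two letters every element is uniquely \<open>(21)\<^sup>m 1\<^sup>i 2\<^sup>j\<close>. The right ideals generated by \<open>1\<close> and \<open>11\<close>
  are free, and dividing them out leaves \<open>f(2, 12, 1) - f(2, 21, 1)\<close> as the only obstruction
  in degree at least 3. On normalized cocycles it is the value of the quantum symmetrizer at \<open>(2, 1, 21)\<close>.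
\<close>

locale cochain_complex =
  fixes C :: "nat \<Rightarrow> ('x \<Rightarrow> 'r::comm_ring_1) set"
    and d :: "nat \<Rightarrow> ('x \<Rightarrow> 'r) \<Rightarrow> 'x \<Rightarrow> 'r"
  assumes C_lin: "\<And>k f g r s. f \<in> C k \<Longrightarrow> g \<in> C k \<Longrightarrow> (\<lambda>x. r * f x + s * g x) \<in> C k"
    and C_zero: "\<And>k. (\<lambda>_. 0) \<in> C k"
    and d_lin: "\<And>k f g r s. d k (\<lambda>x. r * f x + s * g x) = (\<lambda>x. r * d k f x + s * d k g x)"
begin

abbreviation "Z \<equiv> cocycles C d"
abbreviation "B \<equiv> coboundaries C d"
abbreviation "H \<equiv> cohomology C d"
abbreviation "cls k f \<equiv> cohomologous C d k `` {f}"

lemma Z_lin: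
  assumes "f \<in> Z k" "g \<in> Z k"
  shows "(\<lambda>x. r * f x + s * g x) \<in> Z k"
  using assms C_lin d_lin[of k r f s g] by (simp add: cocycles_def)

lemma Z_zero: "(\<lambda>_. 0) \<in> Z k"
  using C_zero d_lin[of k 0 "\<lambda>_. 0" 0 "\<lambda>_. 0"] by (simp add: cocycles_def)

lemma B_lin:
  assumes "f \<in> B k" "g \<in> B k"
  shows "(\<lambda>x. r * f x + s * g x) \<in> B k"
proof (cases k)
  case 0
  then show ?thesis using assms by (simp add: coboundaries_def)
next
  case (Suc j)
  then obtain f' g' where "f' \<in> C j" "f = d j f'" "g' \<in> C j" "g = d j g'"
    using assms by (auto simp: coboundaries_def)
  then show ?thesis
    using C_lin[of f' j g' r s] d_lin[of j r f' s g'] by (simp add: coboundaries_def Suc image_iff) metis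
qed

lemma B_zero: "(\<lambda>_. 0) \<in> B k"
proof (cases k)
  case (Suc j)
  have "d j (\<lambda>_. 0) = (\<lambda>_. 0)"
    using d_lin[of j 0 "\<lambda>_. 0" 0 "\<lambda>_. 0"] by simp
  then show ?thesis
    using C_zero[of j] by (force simp: coboundaries_def Suc)
qed (simp add: coboundaries_def)

lemma B_minus: "f \<in> B k \<Longrightarrow> (\<lambda>x. - f x) \<in> B k"
  using B_lin[of f k f "-1" 0] by simp

lemma B_add: "f \<in> B k \<Longrightarrow> g \<in> B k \<Longrightarrow> (\<lambda>x. f x + g x) \<in> B k"
  using B_lin[of f k g 1 1] by simp

lemma B_smult: "f \<in> B k \<Longrightarrow> (\<lambda>x. r * f x) \<in> B k"
  using B_lin[of f k f r 0] by simp

lemma Z_add: "f \<in> Z k \<Longrightarrow> g \<in> Z k \<Longrightarrow> (\<lambda>x. f x + g x) \<in> Z k"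
  using Z_lin[of f k g 1 1] by simp

lemma Z_minus: "f \<in> Z k \<Longrightarrow> g \<in> Z k \<Longrightarrow> (\<lambda>x. f x - g x) \<in> Z k"
  using Z_lin[of f k g 1 "-1"] by simp

lemma Z_smult: "f \<in> Z k \<Longrightarrow> (\<lambda>x. r * f x) \<in> Z k"
  using Z_lin[of f k f r 0] by simp

lemma Z_sum: "(\<And>i. i \<in> I \<Longrightarrow> f i \<in> Z k) \<Longrightarrow> (\<lambda>x. \<Sum>i\<in>I. c i * f i x) \<in> Z k"
proof (induction I rule: infinite_finite_induct)
  case (insert i I)
  then show ?case using Z_lin[of "f i" k "\<lambda>x. \<Sum>i\<in>I. c i * f i x" "c i" 1] by simp
qed (simp_all add: Z_zero)

lemma equiv_cohomologous: "equiv (Z k) (cohomologous C d k)"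
proof (rule equivI)
  show "refl_on (Z k) (cohomologous C d k)"
    using B_zero by (auto simp: refl_on_def cohomologous_def)
  show "sym (cohomologous C d k)"
    using B_minus by (fastforce simp: sym_def cohomologous_def)
  show "trans (cohomologous C d k)"
  proof (rule transI)
    fix f g h assume "(f, g) \<in> cohomologous C d k" "(g, h) \<in> cohomologous C d k"
    then show "(f, h) \<in> cohomologous C d k"
      using B_add[of "\<lambda>x. f x - g x" k "\<lambda>x. g x - h x"] by (simp add: cohomologous_def)
  qed
qed (auto simp: cohomologous_def)

lemma cls_eq_iff:
  assumes "f \<in> Z k" "g \<in> Z k"
  shows "cls k f = cls k g \<longleftrightarrow> (\<lambda>x. f x - g x) \<in> B k"
  using eq_equiv_class_iff[OF equiv_cohomologous assms] assms by (simp add: cohomologous_def)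

lemma mem_cls: "(f, g) \<in> cohomologous C d k \<longleftrightarrow> f \<in> Z k \<and> g \<in> Z k \<and> (\<lambda>x. f x - g x) \<in> B k"
  by (auto simp: cohomologous_def)

lemma self_mem_cls: "f \<in> Z k \<Longrightarrow> f \<in> cls k f"
  using B_zero by (simp add: mem_cls)

lemma carrier_H: "carrier (H k) = cls k ` Z k"
  by (auto simp: cohomology_def quotient_def)

lemma cls_in_carrier: "f \<in> Z k \<Longrightarrow> cls k f \<in> carrier (H k)"
  by (auto simp: carrier_H)

lemma zero_H: "\<zero>\<^bsub>H k\<^esub> = cls k (\<lambda>_. 0)"
  by (simp add: cohomology_def)

lemma cls_eq_zero_iff: "f \<in> Z k \<Longrightarrow> cls k f = \<zero>\<^bsub>H k\<^esub> \<longleftrightarrow> f \<in> B k"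
  using cls_eq_iff[OF _ Z_zero] by (simp add: zero_H)

lemma UN_cls_eq:
  assumes "S \<noteq> {}" "\<And>x. x \<in> S \<Longrightarrow> h x \<in> Z k" "f \<in> Z k" "\<And>x. x \<in> S \<Longrightarrow> (\<lambda>y. h x y - f y) \<in> B k"
  shows "(\<Union>x\<in>S. cls k (h x)) = cls k f"
proof -
  have "cls k (h x) = cls k f" if "x \<in> S" for x
    using that assms cls_eq_iff by blast
  then show ?thesis using assms(1) by auto
qed

lemma add_H:
  assumes "f \<in> Z k" "g \<in> Z k"
  shows "cls k f \<oplus>\<^bsub>H k\<^esub> cls k g = cls k (\<lambda>x. f x + g x)"
proof -
  have "(\<Union>g'\<in>cls k g. cls k (\<lambda>x. f' x + g' x)) = cls k (\<lambda>x. f x + g x)" if f': "f' \<in> cls k f" for f'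
  proof (rule UN_cls_eq)
    show "cls k g \<noteq> {}" using assms self_mem_cls by blast
    show "(\<lambda>x. f' x + g' x) \<in> Z k" if "g' \<in> cls k g" for g'
      using that f' by (simp add: mem_cls Z_add)
    show "(\<lambda>x. f x + g x) \<in> Z k" using assms by (rule Z_add)
    show "(\<lambda>y. f' y + g' y - (f y + g y)) \<in> B k" if g': "g' \<in> cls k g" for g'
    proof -
      have "(\<lambda>y. - ((f y - f' y) + (g y - g' y))) \<in> B k"
        using f' g' by (intro B_minus B_add) (auto simp: mem_cls)
      then show ?thesis by (simp add: algebra_simps)
    qed
  qed
  then show ?thesis
    using self_mem_cls[OF assms(1)] by (auto simp: cohomology_def)
qed

lemma smult_H:
  assumes "f \<in> Z k"
  shows "r \<odot>\<^bsub>H k\<^esub> cls k f = cls k (\<lambda>x. r * f x)"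
proof -
  have "(\<Union>f'\<in>cls k f. cls k (\<lambda>x. r * f' x)) = cls k (\<lambda>x. r * f x)"
  proof (rule UN_cls_eq)
    show "cls k f \<noteq> {}" using self_mem_cls[OF assms] by blast
    show "(\<lambda>y. r * f' y - r * f y) \<in> B k" if "f' \<in> cls k f" for f'
    proof -
      have "(\<lambda>y. (- r) * (f y - f' y)) \<in> B k"
        using that by (intro B_smult) (auto simp: mem_cls)
      then show ?thesis by (simp add: algebra_simps)
    qed
  qed (use assms in \<open>auto simp: mem_cls intro: Z_smult\<close>)
  then show ?thesis by (simp add: cohomology_def)
qed

lemma abelian_group_H: "abelian_group (H k)"
proof (rule abelian_groupI)
  fix X Y W assume "X \<in> carrier (H k)" "Y \<in> carrier (H k)" "W \<in> carrier (H k)"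
  then obtain f g h where X: "f \<in> Z k" "X = cls k f" and Y: "g \<in> Z k" "Y = cls k g"
    and W: "h \<in> Z k" "W = cls k h" by (auto simp: carrier_H)
  show "X \<oplus>\<^bsub>H k\<^esub> Y \<in> carrier (H k)"
    using X Y by (simp add: add_H Z_add cls_in_carrier)
  show "X \<oplus>\<^bsub>H k\<^esub> Y \<oplus>\<^bsub>H k\<^esub> W = X \<oplus>\<^bsub>H k\<^esub> (Y \<oplus>\<^bsub>H k\<^esub> W)"
    using X Y W by (simp add: add_H Z_add add.assoc)
  show "X \<oplus>\<^bsub>H k\<^esub> Y = Y \<oplus>\<^bsub>H k\<^esub> X"
    using X Y by (simp add: add_H add.commute)
  show "\<zero>\<^bsub>H k\<^esub> \<oplus>\<^bsub>H k\<^esub> X = X"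
    using X by (simp add: zero_H add_H Z_zero)
  have "cls k (\<lambda>x. - 1 * f x) \<oplus>\<^bsub>H k\<^esub> X = \<zero>\<^bsub>H k\<^esub>"
    using X by (simp add: add_H Z_smult[of f k "- 1", simplified] zero_H)
  then show "\<exists>Y\<in>carrier (H k). Y \<oplus>\<^bsub>H k\<^esub> X = \<zero>\<^bsub>H k\<^esub>"
    using X Z_smult cls_in_carrier by blast
qed (simp add: zero_H Z_zero cls_in_carrier)

lemma a_inv_H:
  assumes "f \<in> Z k"
  shows "\<ominus>\<^bsub>H k\<^esub> cls k f = cls k (\<lambda>x. - f x)"
proof -
  interpret abelian_group "H k" by (rule abelian_group_H)
  have m: "(\<lambda>x. - f x) \<in> Z k" using Z_smult[OF assms, of "- 1"] by simp
  show ?thesis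
    by (rule minus_equality) (use assms m in \<open>auto simp: add_H zero_H intro: cls_in_carrier\<close>)
qed

lemma finsum_H:
  assumes "finite I" "\<And>i. i \<in> I \<Longrightarrow> f i \<in> Z k"
  shows "(\<Oplus>\<^bsub>H k\<^esub>i\<in>I. c i \<odot>\<^bsub>H k\<^esub> cls k (f i)) = cls k (\<lambda>x. \<Sum>i\<in>I. c i * f i x)"
  using assms
proof (induction I rule: finite_induct)
  case empty
  interpret abelian_group "H k" by (rule abelian_group_H)
  show ?case by (simp add: zero_H)
next
  case (insert i I)
  interpret abelian_group "H k" by (rule abelian_group_H)
  have "c j \<odot>\<^bsub>H k\<^esub> cls k (f j) \<in> carrier (H k)" if "j \<in> insert i I" for j
    using insert.prems that by (simp add: smult_H Z_smult cls_in_carrier)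
  then have "(\<Oplus>\<^bsub>H k\<^esub>j\<in>insert i I. c j \<odot>\<^bsub>H k\<^esub> cls k (f j))
      = c i \<odot>\<^bsub>H k\<^esub> cls k (f i) \<oplus>\<^bsub>H k\<^esub> (\<Oplus>\<^bsub>H k\<^esub>j\<in>I. c j \<odot>\<^bsub>H k\<^esub> cls k (f j))"
    using insert.hyps by (intro finsum_insert) auto
  then show ?case
    using insert by (simp add: smult_H add_H Z_smult Z_sum)
qed

end

locale cohomology_coordinates = cochain_complex C d
  for C :: "nat \<Rightarrow> ('x \<Rightarrow> 'r::comm_ring_1) set" and d +
  fixes k :: nat and S :: "'s set" and \<Lambda> :: "'s \<Rightarrow> ('x \<Rightarrow> 'r) \<Rightarrow> 'r"
  assumes \<Lambda>_lin: "\<And>s f g a b. s \<in> S \<Longrightarrow> \<Lambda> s (\<lambda>x. a * f x + b * g x) = a * \<Lambda> s f + b * \<Lambda> s g"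
    and \<Lambda>_kernel: "\<And>f. f \<in> cocycles C d k \<Longrightarrow> f \<in> coboundaries C d k \<longleftrightarrow> (\<forall>s\<in>S. \<Lambda> s f = 0)"
begin

lemma \<Lambda>_add: "s \<in> S \<Longrightarrow> \<Lambda> s (\<lambda>x. f x + g x) = \<Lambda> s f + \<Lambda> s g"
  using \<Lambda>_lin[of s 1 f 1 g] by simp

lemma \<Lambda>_smult: "s \<in> S \<Longrightarrow> \<Lambda> s (\<lambda>x. r * f x) = r * \<Lambda> s f"
  using \<Lambda>_lin[of s r f 0 f] by simp

lemma \<Lambda>_diff: "s \<in> S \<Longrightarrow> \<Lambda> s (\<lambda>x. f x - g x) = \<Lambda> s f - \<Lambda> s g"
  using \<Lambda>_lin[of s 1 f "- 1" g] by simp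

lemma \<Lambda>_sum: "s \<in> S \<Longrightarrow> \<Lambda> s (\<lambda>x. \<Sum>i\<in>I. c i * f i x) = (\<Sum>i\<in>I. c i * \<Lambda> s (f i))"
proof (induction I rule: infinite_finite_induct)
  case (insert i I)
  then show ?case using \<Lambda>_lin[of s "c i" "f i" 1 "\<lambda>x. \<Sum>i\<in>I. c i * f i x"] by simp
qed (use \<Lambda>_smult[of s 0] in simp_all)

lemma cls_eq_iff_\<Lambda>:
  "f \<in> Z k \<Longrightarrow> g \<in> Z k \<Longrightarrow> cls k f = cls k g \<longleftrightarrow> (\<forall>s\<in>S. \<Lambda> s f = \<Lambda> s g)"
  by (simp add: cls_eq_iff \<Lambda>_kernel Z_minus \<Lambda>_diff)

lemma \<Lambda>_cong_cls: "g \<in> cls k f \<Longrightarrow> s \<in> S \<Longrightarrow> \<Lambda> s g = \<Lambda> s f"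
  using \<Lambda>_kernel[of "\<lambda>x. f x - g x"] by (simp add: mem_cls Z_minus \<Lambda>_diff)

lemma linearly_isomorphic_map_module:
  assumes surj: "\<And>h. \<exists>f\<in>Z k. \<forall>s\<in>S. \<Lambda> s f = h s"
  shows "linearly_isomorphic (H k) (map_module S)"
proof -
  define \<phi> where "\<phi> X = (\<lambda>s\<in>S. \<Lambda> s (SOME f. f \<in> X))" for X
  have \<phi>: "\<phi> (cls k f) = (\<lambda>s\<in>S. \<Lambda> s f)" if "f \<in> Z k" for f
  proof -
    have "(SOME g. g \<in> cls k f) \<in> cls k f" by (rule someI[of "\<lambda>g. g \<in> cls k f"]) (rule self_mem_cls[OF that])
    then show ?thesis by (auto simp: \<phi>_def \<Lambda>_cong_cls intro!: restrict_ext)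
  qed
  have "bij_betw \<phi> (carrier (H k)) (carrier (map_module S))"
  proof (rule bij_betw_imageI)
    show "inj_on \<phi> (carrier (H k))"
    proof (rule inj_onI)
      fix X Y assume "X \<in> carrier (H k)" "Y \<in> carrier (H k)" and eq: "\<phi> X = \<phi> Y"
      then obtain f g where fg: "f \<in> Z k" "X = cls k f" "g \<in> Z k" "Y = cls k g"
        by (auto simp: carrier_H)
      then have "\<Lambda> s f = \<Lambda> s g" if "s \<in> S" for s
        using that fun_cong[OF eq, of s] by (simp add: \<phi>)
      then show "X = Y" using fg by (simp add: cls_eq_iff_\<Lambda>)
    qed
    show "\<phi> ` carrier (H k) = carrier (map_module S)"
    proof
      show "\<phi> ` carrier (H k) \<subseteq> carrier (map_module S)"
        by (auto simp: carrier_H map_module_def \<phi>)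
      show "carrier (map_module S) \<subseteq> \<phi> ` carrier (H k)"
      proof
        fix h :: "'s \<Rightarrow> 'r" assume h: "h \<in> carrier (map_module S)"
        obtain f where f: "f \<in> Z k" "\<forall>s\<in>S. \<Lambda> s f = h s" using surj by blast
        then have "\<phi> (cls k f) = h" using h
          by (auto simp: \<phi> map_module_def PiE_def extensional_def restrict_def)
        then show "h \<in> \<phi> ` carrier (H k)" using f by (auto simp: carrier_H)
      qed
    qed
  qed
  moreover have "\<phi> (X \<oplus>\<^bsub>H k\<^esub> Y) = \<phi> X \<oplus>\<^bsub>map_module S\<^esub> \<phi> Y"
    if "X \<in> carrier (H k)" "Y \<in> carrier (H k)" for X Y
    using that by (auto simp: carrier_H add_H \<phi> Z_add map_module_def \<Lambda>_add intro!: restrict_ext)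
  moreover have "\<phi> (r \<odot>\<^bsub>H k\<^esub> X) = r \<odot>\<^bsub>map_module S\<^esub> \<phi> X" if "X \<in> carrier (H k)" for r X
    using that by (auto simp: carrier_H smult_H \<phi> Z_smult map_module_def \<Lambda>_smult intro!: restrict_ext)
  ultimately show ?thesis unfolding linearly_isomorphic_def by blast
qed

lemma cls_expansion:
  assumes "finite S" "\<And>s. s \<in> S \<Longrightarrow> G s \<in> Z k"
    "\<And>s t. s \<in> S \<Longrightarrow> t \<in> S \<Longrightarrow> \<Lambda> s (G t) = (if s = t then 1 else 0)" "f \<in> Z k"
  shows "cls k f = cls k (\<lambda>x. \<Sum>s\<in>S. \<Lambda> s f * G s x)"
proof -
  have "\<Lambda> t f = \<Lambda> t (\<lambda>x. \<Sum>s\<in>S. \<Lambda> s f * G s x)" if "t \<in> S" for t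
  proof -
    have "(\<Sum>s\<in>S. \<Lambda> s f * \<Lambda> t (G s)) = (\<Sum>s\<in>S. if t = s then \<Lambda> s f else 0)"
      using that by (intro sum.cong) (auto simp: assms(3))
    then show ?thesis using that assms(1) by (simp add: \<Lambda>_sum)
  qed
  moreover have "(\<lambda>x. \<Sum>s\<in>S. \<Lambda> s f * G s x) \<in> Z k"
    using assms(2) by (rule Z_sum)
  ultimately show ?thesis using cls_eq_iff_\<Lambda>[OF assms(4)] by blast
qed

end

locale cohomology_basis = cohomology_coordinates C d k "{..<n}" \<Lambda>
  for C :: "nat \<Rightarrow> ('x \<Rightarrow> 'r::comm_ring_1) set" and d k n \<Lambda> +
  fixes G :: "nat \<Rightarrow> 'x \<Rightarrow> 'r"
  assumes G_cocycle: "\<And>i. i < n \<Longrightarrow> G i \<in> cocycles C d k"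
    and \<Lambda>_G: "\<And>i j. i < n \<Longrightarrow> j < n \<Longrightarrow> \<Lambda> i (G j) = (if i = j then 1 else 0)"
begin

lemma \<Lambda>_combination: "j < n \<Longrightarrow> \<Lambda> j (\<lambda>x. \<Sum>i<n. c i * G i x) = c j"
  by (simp add: \<Lambda>_sum \<Lambda>_G if_distrib sum.delta' cong: if_cong)

lemma combination_cocycle: "(\<lambda>x. \<Sum>i<n. c i * G i x) \<in> Z k"
  by (rule Z_sum) (simp add: G_cocycle)

lemma is_basis_cls: "is_basis (H k) (map (\<lambda>i. cls k (G i)) [0..<n])"
proof -
  have sum: "(\<Oplus>\<^bsub>H k\<^esub>i\<in>{..<n}. c i \<odot>\<^bsub>H k\<^esub> map (\<lambda>i. cls k (G i)) [0..<n] ! i)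
      = cls k (\<lambda>x. \<Sum>i<n. c i * G i x)" for c
  proof -
    interpret abelian_group "H k" by (rule abelian_group_H)
    have "(\<Oplus>\<^bsub>H k\<^esub>i\<in>{..<n}. c i \<odot>\<^bsub>H k\<^esub> map (\<lambda>i. cls k (G i)) [0..<n] ! i)
        = (\<Oplus>\<^bsub>H k\<^esub>i\<in>{..<n}. c i \<odot>\<^bsub>H k\<^esub> cls k (G i))"
      by (rule finsum_cong') (auto simp: smult_H G_cocycle Z_smult cls_in_carrier)
    then show ?thesis using finsum_H[of "{..<n}" G k c] by (simp add: G_cocycle)
  qed
  have "\<exists>!c. c \<in> {..<n} \<rightarrow>\<^sub>E UNIV \<and> cls k f = cls k (\<lambda>x. \<Sum>i<n. c i * G i x)" if "f \<in> Z k" for f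
  proof (rule ex1I)
    have "cls k f = cls k (\<lambda>x. \<Sum>i<n. \<Lambda> i f * G i x)"
      using cls_expansion[of G f] that by (simp add: G_cocycle \<Lambda>_G)
    then show "(\<lambda>i\<in>{..<n}. \<Lambda> i f) \<in> {..<n} \<rightarrow>\<^sub>E UNIV \<and>
        cls k f = cls k (\<lambda>x. \<Sum>i<n. (\<lambda>i\<in>{..<n}. \<Lambda> i f) i * G i x)"
      by simp
  next
    fix c assume c: "c \<in> {..<n} \<rightarrow>\<^sub>E UNIV \<and> cls k f = cls k (\<lambda>x. \<Sum>i<n. c i * G i x)"
    then have "\<Lambda> j f = c j" if "j < n" for j
      using that \<open>f \<in> Z k\<close> cls_eq_iff_\<Lambda>[OF _ combination_cocycle] by (simp add: \<Lambda>_combination)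
    then show "c = (\<lambda>i\<in>{..<n}. \<Lambda> i f)"
      using c by (intro extensionalityI[of _ "{..<n}"]) (auto simp: PiE_def)
  qed
  then show ?thesis
    unfolding is_basis_def by (auto simp: sum carrier_H G_cocycle)
qed

end


section \<open>The plactic monoid\<close>

declare in_listsD [rule del] in_listsI [rule del] lists.Nil [simp]

lemma knuth_step_lists: "knuth_step A u v \<Longrightarrow> u \<in> lists A \<and> v \<in> lists A"
  by (auto elim!: knuth_step.cases simp: lists_eq_set)

lemma knuth_step_mset: "knuth_step A u v \<Longrightarrow> mset u = mset v"
  by (auto elim!: knuth_step.cases)

lemma knuth_step_append:
  assumes "knuth_step A u v" "p \<in> lists A" "s \<in> lists A"
  shows "knuth_step A (p @ u @ s) (p @ v @ s)"
  using assms(1)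
proof cases
  case (1 u' x y z v')
  then show ?thesis
    using knuth_step.intros(1)[of "p @ u'" x y z "v' @ s" A] assms(2,3) by (auto simp: lists_eq_set)
next
  case (2 u' x y z v')
  then show ?thesis
    using knuth_step.intros(2)[of "p @ u'" x y z "v' @ s" A] assms(2,3) by (auto simp: lists_eq_set)
qed

lemma knuth_cong_lists: "(u, v) \<in> knuth_cong A \<Longrightarrow> u \<in> lists A \<and> v \<in> lists A"
  by (auto simp: knuth_cong_def)

lemma knuth_cong_refl: "u \<in> lists A \<Longrightarrow> (u, u) \<in> knuth_cong A"
  by (simp add: knuth_cong_def)

lemma knuth_cong_sym: "(u, v) \<in> knuth_cong A \<Longrightarrow> (v, u) \<in> knuth_cong A"
  by (auto simp: knuth_cong_def equivclp_sym)

lemma knuth_cong_trans: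
  "(u, v) \<in> knuth_cong A \<Longrightarrow> (v, w) \<in> knuth_cong A \<Longrightarrow> (u, w) \<in> knuth_cong A"
  by (auto simp: knuth_cong_def intro: equivclp_trans)

lemma knuth_cong_step: "knuth_step A u v \<Longrightarrow> (u, v) \<in> knuth_cong A"
  using knuth_step_lists by (force simp: knuth_cong_def)

lemma equiv_knuth_cong: "equiv (lists A) (knuth_cong A)"
proof (rule equivI)
  show "knuth_cong A \<subseteq> lists A \<times> lists A" using knuth_cong_lists by auto
  show "refl_on (lists A) (knuth_cong A)" by (rule refl_onI) (rule knuth_cong_refl)
  show "sym (knuth_cong A)" by (rule symI) (rule knuth_cong_sym)
  show "trans (knuth_cong A)" by (rule transI) (rule knuth_cong_trans)
qed

lemma knuth_cong_invariant:
  assumes "(u, v) \<in> knuth_cong A" "\<And>x y. knuth_step A x y \<Longrightarrow> \<phi> x = \<phi> y"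
  shows "\<phi> u = \<phi> v"
proof -
  have "(symclp (knuth_step A))\<^sup>*\<^sup>* u v"
    using assms(1) by (simp add: knuth_cong_def equivclp_def)
  then show ?thesis
    by induction (auto simp: symclp_def assms(2))
qed

lemma knuth_cong_mset: "(u, v) \<in> knuth_cong A \<Longrightarrow> mset u = mset v"
  using knuth_cong_invariant knuth_step_mset by blast

lemma knuth_cong_length: "(u, v) \<in> knuth_cong A \<Longrightarrow> length u = length v"
  using knuth_cong_mset mset_eq_length by blast

lemma knuth_cong_set: "(u, v) \<in> knuth_cong A \<Longrightarrow> set u = set v"
  using knuth_cong_mset mset_eq_setD by blast

lemma knuth_cong_context:
  assumes "(u, v) \<in> knuth_cong A" "p \<in> lists A" "s \<in> lists A"
  shows "(p @ u @ s, p @ v @ s) \<in> knuth_cong A"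
proof -
  have "(symclp (knuth_step A))\<^sup>*\<^sup>* u v" "u \<in> lists A"
    using assms(1) by (simp_all add: knuth_cong_def equivclp_def)
  then show ?thesis
  proof induction
    case base
    then show ?case using assms by (intro knuth_cong_refl) auto
  next
    case (step y z)
    then have "(p @ y @ s, p @ z @ s) \<in> knuth_cong A"
      using knuth_step_append assms(2,3) knuth_cong_step knuth_cong_sym
      by (metis symclpE)
    then show ?case using step knuth_cong_trans by blast
  qed
qed

lemma knuth_cong_append:
  assumes "(u, u') \<in> knuth_cong A" "(v, v') \<in> knuth_cong A"
  shows "(u @ v, u' @ v') \<in> knuth_cong A"
  using knuth_cong_context[OF assms(1), of "[]" v] knuth_cong_context[OF assms(2), of u' "[]"]
    assms[THEN knuth_cong_lists] knuth_cong_trans by fastforce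

lemma knuth_cong_irreducible:
  assumes "(u, v) \<in> knuth_cong A" "\<And>w. \<not> knuth_step A u w \<and> \<not> knuth_step A w u"
  shows "v = u"
  using knuth_cong_invariant[OF assms(1), of "\<lambda>w. w = u"] assms(2) by auto

lemma knuth_cong_sorted:
  assumes "(u, v) \<in> knuth_cong A" "sorted u"
  shows "v = u"
proof (rule knuth_cong_irreducible[OF assms(1)])
  fix w
  show "\<not> knuth_step A u w \<and> \<not> knuth_step A w u"
    using assms(2) by (auto elim!: knuth_step.cases simp: sorted_append)
qed

lemma knuth_cong_short:
  assumes "(u, v) \<in> knuth_cong A" "length u < 3"
  shows "v = u"
proof (rule knuth_cong_irreducible[OF assms(1)])
  fix w
  show "\<not> knuth_step A u w \<and> \<not> knuth_step A w u"
    using assms(2) by (auto elim!: knuth_step.cases)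
qed

lemma mem_plactic_class: "v \<in> plactic_class A u \<longleftrightarrow> (u, v) \<in> knuth_cong A"
  by (simp add: plactic_class_def)

lemma plactic_class_eq_iff:
  "u \<in> lists A \<Longrightarrow> v \<in> lists A \<Longrightarrow> plactic_class A u = plactic_class A v \<longleftrightarrow> (u, v) \<in> knuth_cong A"
  unfolding plactic_class_def by (rule eq_equiv_class_iff[OF equiv_knuth_cong])

lemma carrier_plactic: "carrier (plactic A) = plactic_class A ` lists A"
  by (auto simp: plactic_def quotient_def plactic_class_def)

lemma plactic_class_in_carrier: "u \<in> lists A \<Longrightarrow> plactic_class A u \<in> carrier (plactic A)"
  by (auto simp: carrier_plactic)

lemma one_plactic: "\<one>\<^bsub>plactic A\<^esub> = plactic_class A []"
  by (simp add: plactic_def)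

lemma mult_plactic:
  assumes "u \<in> lists A" "v \<in> lists A"
  shows "plactic_class A u \<otimes>\<^bsub>plactic A\<^esub> plactic_class A v = plactic_class A (u @ v)"
proof -
  have "plactic_class A (u' @ v') = plactic_class A (u @ v)"
    if "u' \<in> plactic_class A u" "v' \<in> plactic_class A v" for u' v'
    using that knuth_cong_append[of u u' A v v'] knuth_cong_sym knuth_cong_lists
    by (metis mem_plactic_class plactic_class_eq_iff)
  moreover have "u \<in> plactic_class A u" "v \<in> plactic_class A v"
    using assms by (simp_all add: mem_plactic_class knuth_cong_refl)
  ultimately have "(\<Union>u'\<in>plactic_class A u. \<Union>v'\<in>plactic_class A v. plactic_class A (u' @ v'))
      = plactic_class A (u @ v)"
    by blast
  then show ?thesis by (simp add: plactic_def)
qed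

lemma monoid_plactic: "monoid (plactic A)"
  by (rule monoidI) (auto simp: carrier_plactic one_plactic mult_plactic)

lemma eps0_plactic_class:
  assumes "u \<in> lists A"
  shows "eps0 (plactic_class A u) = (if u = [] then 1 else 0)"
proof -
  have "[] \<in> plactic_class A u \<longleftrightarrow> u = []"
    using knuth_cong_length[of u "[]" A] knuth_cong_refl[OF assms] by (auto simp: mem_plactic_class)
  then show ?thesis by (simp add: eps0_def)
qed

lemma plactic_class_Nil_iff:
  "u \<in> lists A \<Longrightarrow> plactic_class A u = plactic_class A [] \<longleftrightarrow> u = []"
  using knuth_cong_length[of u "[]" A] by (auto simp: plactic_class_eq_iff intro: knuth_cong_refl)

lemma eps0_one: "eps0 \<one>\<^bsub>plactic A\<^esub> = 1"
  by (simp add: one_plactic eps0_plactic_class)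

lemma eps0_nonunit: "x \<in> carrier (plactic A) \<Longrightarrow> x \<noteq> \<one>\<^bsub>plactic A\<^esub> \<Longrightarrow> eps0 x = 0"
  by (auto simp: carrier_plactic one_plactic eps0_plactic_class split: if_splits)

lemma eps0_mult:
  assumes "x \<in> carrier (plactic A)" "y \<in> carrier (plactic A)"
  shows "eps0 (x \<otimes>\<^bsub>plactic A\<^esub> y) = eps0 x * eps0 y"
proof -
  obtain u v where "u \<in> lists A" "x = plactic_class A u" "v \<in> lists A" "y = plactic_class A v"
    using assms by (auto simp: carrier_plactic)
  then show ?thesis by (simp add: mult_plactic eps0_plactic_class)
qed


section \<open>Words in two letters\<close>

text \<open>\<open>(m, i, j)\<close> stands for the normal form \<open>(q p)\<^sup>m p\<^sup>i q\<^sup>j\<close> of a word in the letters \<open>p < q\<close>.\<close>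

fun push_letter :: "bool \<Rightarrow> nat \<times> nat \<times> nat \<Rightarrow> nat \<times> nat \<times> nat" where
  "push_letter True (m, i, j) = (m, Suc i, j)"
| "push_letter False (m, 0, j) = (m, 0, Suc j)"
| "push_letter False (m, Suc i, j) = (Suc m, i, j)"

definition two_letter_nf :: "'a \<Rightarrow> 'a list \<Rightarrow> nat \<times> nat \<times> nat" where
  "two_letter_nf p w = foldr (\<lambda>x. push_letter (x = p)) w (0, 0, 0)"

definition nf_word :: "'a \<Rightarrow> 'a \<Rightarrow> nat \<times> nat \<times> nat \<Rightarrow> 'a list" where
  "nf_word p q = (\<lambda>(m, i, j). concat (replicate m [q, p]) @ replicate i p @ replicate j q)"

lemma two_letter_nf_Nil: "two_letter_nf p [] = (0, 0, 0)"
  by (simp add: two_letter_nf_def)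

lemma two_letter_nf_Cons: "two_letter_nf p (x # w) = push_letter (x = p) (two_letter_nf p w)"
  by (simp add: two_letter_nf_def)

lemma two_letter_nf_append_cong:
  "two_letter_nf p v = two_letter_nf p v' \<Longrightarrow> two_letter_nf p (u @ v) = two_letter_nf p (u @ v')"
  by (simp add: two_letter_nf_def)

lemma two_letter_nf_step:
  assumes "knuth_step A u v" "set u \<subseteq> {p, q}" "p < q"
  shows "two_letter_nf p u = two_letter_nf p v"
  using assms(1)
proof cases
  case (1 u' x y z v')
  then have "x = p" "y = p" "z = q" using assms by auto
  moreover have "two_letter_nf p ([p, q, p] @ v') = two_letter_nf p ([q, p, p] @ v')"
    using assms(3) by (cases "two_letter_nf p v'") (simp add: two_letter_nf_Cons less_imp_neq[THEN not_sym])
  ultimately show ?thesis using 1 two_letter_nf_append_cong by metis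
next
  case (2 u' x y z v')
  then have "x = p" "y = q" "z = q" using assms by auto
  moreover have "two_letter_nf p ([q, p, q] @ v') = two_letter_nf p ([q, q, p] @ v')"
  proof -
    obtain m i j where "two_letter_nf p v' = (m, i, j)" by (cases "two_letter_nf p v'")
    then show ?thesis using assms(3)
      by (cases i) (simp_all add: two_letter_nf_Cons less_imp_neq[THEN not_sym])
  qed
  ultimately show ?thesis using 2 two_letter_nf_append_cong by metis
qed

lemma two_letter_nf_cong:
  assumes "(u, v) \<in> knuth_cong A" "set u \<subseteq> {p, q}" "p < q"
  shows "two_letter_nf p u = two_letter_nf p v"
proof -
  let ?\<phi> = "\<lambda>w. if set w \<subseteq> {p, q} then Some (two_letter_nf p w) else None"
  have "?\<phi> u = ?\<phi> v"
  proof (rule knuth_cong_invariant[OF assms(1)])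
    fix x y assume s: "knuth_step A x y"
    then have "set x = set y" using knuth_step_mset mset_eq_setD by blast
    then show "?\<phi> x = ?\<phi> y" using s two_letter_nf_step[OF s _ assms(3)] by auto
  qed
  moreover have "set v = set u" using knuth_cong_set[OF assms(1)] by simp
  ultimately show ?thesis using assms(2) by simp
qed

lemma knuth_cong_pqp: "p < q \<Longrightarrow> p \<in> A \<Longrightarrow> q \<in> A \<Longrightarrow> ([p, q, p], [q, p, p]) \<in> knuth_cong A"
  using knuth_step.intros(1)[of "[]" p p q "[]" A] by (intro knuth_cong_step) auto

lemma knuth_cong_qpq: "p < q \<Longrightarrow> p \<in> A \<Longrightarrow> q \<in> A \<Longrightarrow> ([q, p, q], [q, q, p]) \<in> knuth_cong A"
  using knuth_step.intros(2)[of "[]" p q q "[]" A] by (intro knuth_cong_step) auto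

lemma replicate_lists: "x \<in> A \<Longrightarrow> replicate n x \<in> lists A"
  by (induction n) auto

lemma columns_lists: "p \<in> A \<Longrightarrow> q \<in> A \<Longrightarrow> concat (replicate n [q, p]) \<in> lists A"
  by (induction n) auto

lemma nf_word_lists: "p \<in> A \<Longrightarrow> q \<in> A \<Longrightarrow> nf_word p q t \<in> lists A"
  by (cases t) (simp add: nf_word_def replicate_lists columns_lists)

lemma knuth_cong_shift_column:
  assumes "p < q" "p \<in> A" "q \<in> A" "x = p \<or> x = q"
  shows "(x # concat (replicate m [q, p]), concat (replicate m [q, p]) @ [x]) \<in> knuth_cong A"
proof (induction m)
  case 0
  then show ?case using assms by (auto intro!: knuth_cong_refl)
next
  case (Suc m)
  have l: "concat (replicate m [q, p]) \<in> lists A" using assms by (simp add: columns_lists)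
  have "([x, q, p], [q, p, x]) \<in> knuth_cong A"
    using assms knuth_cong_pqp[OF assms(1-3)] knuth_cong_sym[OF knuth_cong_qpq[OF assms(1-3)]]
      knuth_cong_qpq[OF assms(1-3)] by auto
  then have "(x # concat (replicate (Suc m) [q, p]), [q, p] @ (x # concat (replicate m [q, p]))) \<in> knuth_cong A"
    using knuth_cong_context[of "[x, q, p]" "[q, p, x]" A "[]"] l by simp
  moreover have "([q, p] @ (x # concat (replicate m [q, p])), concat (replicate (Suc m) [q, p]) @ [x]) \<in> knuth_cong A"
    using knuth_cong_context[OF Suc, of "[q, p]" "[]"] assms by simp
  ultimately show ?case by (rule knuth_cong_trans)
qed

lemma knuth_cong_push:
  assumes "p < q" "p \<in> A" "q \<in> A" "x = p \<or> x = q"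
  shows "(x # nf_word p q t, nf_word p q (push_letter (x = p) t)) \<in> knuth_cong A"
proof -
  obtain m i j where t: "t = (m, i, j)" by (cases t)
  let ?c = "concat (replicate m [q, p])"
  have "(x # nf_word p q t, ?c @ x # replicate i p @ replicate j q) \<in> knuth_cong A"
    using knuth_cong_context[OF knuth_cong_shift_column[OF assms, of m], of "[]" "replicate i p @ replicate j q"]
      assms by (simp add: t nf_word_def replicate_lists)
  moreover have "?c @ x # replicate i p @ replicate j q = nf_word p q (push_letter (x = p) t)"
  proof (cases "x = p")
    case False
    have "concat (replicate m [q, p]) @ [q, p] = [q, p] @ concat (replicate m [q, p])" for m
      by (induction m) auto
    then show ?thesis using False assms
      by (cases i) (auto simp: t nf_word_def)
  qed (simp add: t nf_word_def)
  ultimately show ?thesis by simp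
qed

lemma knuth_cong_nf_word:
  assumes "p < q" "p \<in> A" "q \<in> A" "set w \<subseteq> {p, q}"
  shows "(w, nf_word p q (two_letter_nf p w)) \<in> knuth_cong A"
  using assms(4)
proof (induction w)
  case Nil
  then show ?case by (simp add: two_letter_nf_Nil nf_word_def knuth_cong_refl)
next
  case (Cons x w)
  then have "(w, nf_word p q (two_letter_nf p w)) \<in> knuth_cong A" by simp
  then have "(x # w, x # nf_word p q (two_letter_nf p w)) \<in> knuth_cong A"
    using knuth_cong_context[of w _ A "[x]" "[]"] Cons.prems assms by auto
  moreover have "x = p \<or> x = q" using Cons.prems by auto
  ultimately show ?case
    using knuth_cong_trans[OF _ knuth_cong_push[OF assms(1-3)]] by (simp add: two_letter_nf_Cons)
qed

lemma two_letter_knuth_cong_iff: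
  assumes "p < q" "p \<in> A" "q \<in> A" "set w \<subseteq> {p, q}" "set w' \<subseteq> {p, q}"
  shows "(w, w') \<in> knuth_cong A \<longleftrightarrow> two_letter_nf p w = two_letter_nf p w'"
proof
  assume "two_letter_nf p w = two_letter_nf p w'"
  then have "(w, nf_word p q (two_letter_nf p w')) \<in> knuth_cong A"
    using knuth_cong_nf_word[OF assms(1-4)] by simp
  then show "(w, w') \<in> knuth_cong A"
    by (rule knuth_cong_trans) (rule knuth_cong_sym[OF knuth_cong_nf_word[OF assms(1-3,5)]])
qed (rule two_letter_nf_cong[OF _ assms(4,1)])

lemma two_letter_nf_nf_word:
  assumes "p \<noteq> q"
  shows "two_letter_nf p (nf_word p q t) = t"
proof -
  obtain m i j where t: "t = (m, i, j)" by (cases t)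
  have "two_letter_nf p (replicate j q) = (0, 0, j)"
    using assms by (induction j) (auto simp: two_letter_nf_Cons two_letter_nf_Nil)
  then have "two_letter_nf p (replicate i p @ replicate j q) = (0, i, j)"
    by (induction i) (auto simp: two_letter_nf_Cons)
  then have "two_letter_nf p (concat (replicate m [q, p]) @ replicate i p @ replicate j q) = (m, i, j)"
    using assms by (induction m) (auto simp: two_letter_nf_Cons)
  then show ?thesis by (simp add: t nf_word_def)
qed


section \<open>The Hochschild complex\<close>

lemma mem_tuples_Cons: "x # xs \<in> tuples X (Suc k) \<longleftrightarrow> x \<in> X \<and> xs \<in> tuples X k"
  by (auto simp: tuples_def)

lemma hoch_cochain_complex: "cochain_complex (hoch_cochains M) (hoch_diff M chi)"
proof
  show "hoch_diff M chi k (\<lambda>x. r * f x + s * g x) = (\<lambda>x. r * hoch_diff M chi k f x + s * hoch_diff M chi k g x)"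
    for k r f s g
    by (auto simp: hoch_diff_def fun_eq_iff sum.distrib sum_distrib_left sum_subtractf sum_negf algebra_simps)
qed (auto simp: hoch_cochains_def)

text \<open>Differential of cochains on a right ideal of \<open>M\<close> (the first argument) with values in
  functions of \<open>n\<close> elements; it computes the Ext groups from that right module to the trivial one.
  The length of the list determines \<open>n\<close>.\<close>

fun module_diff ::
  "('m, 'b) monoid_scheme \<Rightarrow> ('m \<Rightarrow> 'r::comm_ring_1) \<Rightarrow> ('m \<Rightarrow> 'm list \<Rightarrow> 'r) \<Rightarrow> 'm \<Rightarrow> 'm list \<Rightarrow> 'r" where
  "module_diff M chi f v [] = 0"
| "module_diff M chi f v [x] = f (v \<otimes>\<^bsub>M\<^esub> x) [] - chi x * f v []"
| "module_diff M chi f v (x # y # ys) =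
     f (v \<otimes>\<^bsub>M\<^esub> x) (y # ys) - module_diff M chi (\<lambda>u zs. f v (u # zs)) x (y # ys)"

lemma module_diff_lin:
  "module_diff M chi (\<lambda>u zs. a * f u zs + b * g u zs) v xs
     = a * module_diff M chi f v xs + b * module_diff M chi g v xs"
proof (induction M chi f v xs arbitrary: g rule: module_diff.induct)
  case (3 M chi f v x y ys)
  show ?case by (simp add: 3[of "\<lambda>u zs. g v (u # zs)"]) (simp add: algebra_simps)
qed (simp_all add: algebra_simps)

lemma module_diff_diff:
  "module_diff M chi (\<lambda>u zs. f u zs - g u zs) v xs
     = module_diff M chi f v xs - module_diff M chi g v xs"
  using module_diff_lin[of M chi 1 f "- 1" g v xs] by simp

lemma module_diff_zero: "module_diff M chi (\<lambda>u zs. 0) v xs = 0"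
  using module_diff_lin[of M chi 0 "\<lambda>u zs. 0" 0 "\<lambda>u zs. 0" v xs] by simp

lemma hoch_diff_Cons:
  fixes f :: "'m list \<Rightarrow> 'r::comm_ring_1"
  assumes "x # y # ys \<in> tuples (carrier M) (Suc k)"
  shows "hoch_diff M chi k f (x # y # ys)
    = chi x * f (y # ys) - module_diff M chi (\<lambda>v zs. f (v # zs)) x (y # ys)"
proof -
  define S where "S k f xs = (\<Sum>i<k. (- 1) ^ Suc i *
      f (take i xs @ [xs ! i \<otimes>\<^bsub>M\<^esub> xs ! Suc i] @ drop (Suc (Suc i)) xs))
      + (- 1) ^ Suc k * (f (butlast xs) * chi (last xs))" for k and f :: "'m list \<Rightarrow> 'r" and xs
  have "S (Suc (length ys)) f (x # y # ys) = - module_diff M chi (\<lambda>v zs. f (v # zs)) x (y # ys)" for f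
  proof (induction ys arbitrary: f x y)
    case Nil
    then show ?case by (simp add: S_def mult.commute)
  next
    case (Cons z zs)
    have "S (Suc (length (z # zs))) f (x # y # z # zs)
        = - f ((x \<otimes>\<^bsub>M\<^esub> y) # z # zs) - S (Suc (length zs)) (\<lambda>ws. f (x # ws)) (y # z # zs)"
      unfolding S_def by (subst sum.lessThan_Suc_shift) (simp add: sum_negf)
    then show ?case by (simp add: Cons)
  qed
  moreover have "k = Suc (length ys)" using assms by (simp add: tuples_def)
  moreover have "hoch_diff M chi k f (x # y # ys) = chi x * f (y # ys) + S k f (x # y # ys)"
    using assms by (simp add: hoch_diff_def S_def del: sum.lessThan_Suc)
  ultimately show ?thesis by simp
qed

lemma hoch_diff_0: "hoch_diff M chi 0 f = (\<lambda>_. 0)"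
  by (auto simp: hoch_diff_def fun_eq_iff tuples_def length_Suc_conv)

lemma module_diff_cong:
  assumes "\<And>u x. u \<in> N \<Longrightarrow> x \<in> carrier M \<Longrightarrow> u \<otimes>\<^bsub>M\<^esub> x \<in> N"
    and "\<And>x y. x \<in> carrier M \<Longrightarrow> y \<in> carrier M \<Longrightarrow> x \<otimes>\<^bsub>M\<^esub> y \<in> carrier M"
    and "\<And>u zs. u \<in> N \<Longrightarrow> zs \<in> tuples (carrier M) n \<Longrightarrow> f u zs = g u zs"
    and "v \<in> N" "xs \<in> tuples (carrier M) (Suc n)"
  shows "module_diff M chi f v xs = module_diff M chi g v xs"
  using assms
proof (induction M chi f v xs arbitrary: g N n rule: module_diff.induct)
  case (1 M chi f v)
  then show ?case by simp
next
  case (2 M chi f v x)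
  then show ?case by (simp add: tuples_def)
next
  case (3 M chi f v x y ys)
  then have n: "n = Suc (length ys)" by (simp add: tuples_def)
  have "module_diff M chi (\<lambda>u zs. f v (u # zs)) x (y # ys)
      = module_diff M chi (\<lambda>u zs. g v (u # zs)) x (y # ys)"
  proof (rule "3.IH")
    show "f v (u # zs) = g v (u # zs)" if "u \<in> carrier M" "zs \<in> tuples (carrier M) (length ys)" for u zs
      using that "3.prems"(3)[of v "u # zs"] "3.prems"(4) by (simp add: n mem_tuples_Cons)
  qed (use "3.prems" in \<open>auto simp: tuples_def\<close>)
  moreover have "f (v \<otimes>\<^bsub>M\<^esub> x) (y # ys) = g (v \<otimes>\<^bsub>M\<^esub> x) (y # ys)"
    using "3.prems" by (simp add: mem_tuples_Cons n)
  ultimately show ?case by simp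
qed

lemma module_diff_map:
  assumes "j (v \<otimes>\<^bsub>M\<^esub> x) = j v \<otimes>\<^bsub>M\<^esub> x"
  shows "module_diff M chi (\<lambda>u. f (j u)) v (x # xs) = module_diff M chi f (j v) (x # xs)"
  using assms by (cases xs) simp_all

lemma module_diff_translate:
  assumes "monoid M" "w \<in> carrier M" "v \<in> carrier M" "set xs \<subseteq> carrier M"
  shows "module_diff M chi (\<lambda>u. f (w \<otimes>\<^bsub>M\<^esub> u)) v xs = module_diff M chi f (w \<otimes>\<^bsub>M\<^esub> v) xs"
proof (cases xs)
  case (Cons x ys)
  then show ?thesis
    using assms module_diff_map[where j = "\<lambda>u. w \<otimes>\<^bsub>M\<^esub> u" and v = v and M = M and x = x] by (simp add: monoid.m_assoc)
qed simp

lemma module_diff_module_diff: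
  assumes "monoid M" "v \<in> carrier M" "set xs \<subseteq> carrier M"
    and "\<And>x y. x \<in> carrier M \<Longrightarrow> y \<in> carrier M \<Longrightarrow> chi (x \<otimes>\<^bsub>M\<^esub> y) = chi x * chi y"
    and "2 \<le> length xs"
  shows "module_diff M chi (module_diff M chi f) v xs = 0"
  using assms(2,3,5)
proof (induction xs arbitrary: f v)
  case (Cons x xs)
  interpret monoid M by fact
  obtain y ys where xs: "xs = y # ys" using Cons.prems by (cases xs) auto
  show ?case
  proof (cases ys)
    case Nil
    then show ?thesis using Cons.prems assms(4) by (simp add: xs m_assoc algebra_simps)
  next
    case (Cons z zs)
    have "module_diff M chi (\<lambda>u ws. module_diff M chi f v (u # ws)) x (y # z # zs)
        = module_diff M chi (\<lambda>u ws. f (v \<otimes>\<^bsub>M\<^esub> u) ws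
            - module_diff M chi (\<lambda>u zs. f v (u # zs)) u ws) x (y # z # zs)"
    proof (rule module_diff_cong)
      fix u ws assume "u \<in> carrier M" "ws \<in> tuples (carrier M) (Suc (length zs))"
      then show "module_diff M chi f v (u # ws)
          = f (v \<otimes>\<^bsub>M\<^esub> u) ws - module_diff M chi (\<lambda>u zs. f v (u # zs)) u ws"
        by (cases ws) (auto simp: tuples_def)
    qed (use Cons.prems in \<open>auto simp: tuples_def xs Cons\<close>)
    also have "\<dots> = module_diff M chi f (v \<otimes>\<^bsub>M\<^esub> x) (y # z # zs)"
      using Cons.prems Cons.IH[of x "\<lambda>u zs. f v (u # zs)"] assms(1)
      by (simp add: module_diff_diff module_diff_translate xs Cons del: module_diff.simps)
    finally show ?thesis by (simp add: xs Cons)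
  qed
qed simp


lemma take_mem_tuples: "xs \<in> tuples X k \<Longrightarrow> p \<le> k \<Longrightarrow> take p xs \<in> tuples X p"
  using set_take_subset[of p xs] by (auto simp: tuples_def)

lemma drop_mem_tuples: "xs \<in> tuples X (p + q) \<Longrightarrow> drop p xs \<in> tuples X q"
  using set_drop_subset[of p xs] by (auto simp: tuples_def)

definition cup_cochain :: "nat \<Rightarrow> ('m list \<Rightarrow> 'r::comm_ring_1) \<Rightarrow> ('m list \<Rightarrow> 'r) \<Rightarrow> 'm list \<Rightarrow> 'r" where
  "cup_cochain p f g xs = f (take p xs) * g (drop p xs)"

lemma cup_cochain_mem:
  assumes "f \<in> hoch_cochains M p" "g \<in> hoch_cochains M q"
  shows "cup_cochain p f g \<in> hoch_cochains M (p + q)"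
proof -
  have "xs \<in> tuples (carrier M) (p + q)"
    if "take p xs \<in> tuples (carrier M) p" "drop p xs \<in> tuples (carrier M) q" for xs
  proof -
    have "length xs = p + q" using that by (auto simp: tuples_def min_def split: if_splits)
    moreover have "set xs = set (take p xs) \<union> set (drop p xs)"
      by (metis append_take_drop_id set_append)
    ultimately show ?thesis using that by (auto simp: tuples_def)
  qed
  then have "cup_cochain p f g xs = 0" if "xs \<notin> tuples (carrier M) (p + q)" for xs
    using assms that by (fastforce simp: hoch_cochains_def cup_cochain_def)
  then show ?thesis by (simp add: hoch_cochains_def)
qed

lemma hoch_diff_cup:
  assumes "xs \<in> tuples (carrier M) (Suc (p + q))"
  shows "hoch_diff M chi (p + q) (cup_cochain p f g) xs
    = hoch_diff M chi p f (take (Suc p) xs) * g (drop (Suc p) xs)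
      + (- 1) ^ p * (f (take p xs) * hoch_diff M chi q g (drop p xs))"
proof -
  let ?m = "\<lambda>i xs. take i xs @ [xs ! i \<otimes>\<^bsub>M\<^esub> xs ! Suc i] @ drop (Suc (Suc i)) xs"
  have len: "length xs = Suc (p + q)" using assms by (simp add: tuples_def)
  have t: "take (Suc p) xs \<in> tuples (carrier M) (Suc p)" "drop p xs \<in> tuples (carrier M) (Suc q)"
    using take_mem_tuples[OF assms] drop_mem_tuples[of xs _ p "Suc q"] assms by simp_all
  have lo: "cup_cochain p f g (?m i xs) = f (?m i (take (Suc p) xs)) * g (drop (Suc p) xs)" if "i < p" for i
  proof -
    obtain n where "p = Suc (i + n)" using \<open>i < p\<close> less_imp_Suc_add by blast
    then show ?thesis using len by (simp add: cup_cochain_def drop_take Suc_diff_le add.commute)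
  qed
  have hi: "cup_cochain p f g (?m (p + j) xs) = f (take p xs) * g (?m j (drop p xs))" if "j < q" for j
    using that len by (simp add: cup_cochain_def drop_take add.commute)
  have "(\<Sum>i<p + q. (- 1) ^ Suc i * cup_cochain p f g (?m i xs))
      = (\<Sum>i<p. (- 1) ^ Suc i * cup_cochain p f g (?m i xs))
        + (\<Sum>j<q. (- 1) ^ Suc (p + j) * cup_cochain p f g (?m (p + j) xs))"
    by (induction q) (simp_all add: algebra_simps)
  also have "\<dots> = (\<Sum>i<p. (- 1) ^ Suc i * f (?m i (take (Suc p) xs))) * g (drop (Suc p) xs)
        + (- 1) ^ p * (f (take p xs) * (\<Sum>j<q. (- 1) ^ Suc j * g (?m j (drop p xs))))"
    unfolding sum_distrib_left sum_distrib_right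
    by (intro arg_cong2[of _ _ _ _ "(+)"] sum.cong refl)
      (simp_all only: lo hi lessThan_iff, simp_all add: power_add algebra_simps)
  finally have 1: "(\<Sum>i<p + q. (- 1) ^ Suc i * cup_cochain p f g (?m i xs)) = \<dots>" .
  have 2: "cup_cochain p f g (tl xs) = f (tl (take (Suc p) xs)) * g (drop (Suc p) xs)"
    using len by (cases xs) (simp_all add: cup_cochain_def)
  have 3: "cup_cochain p f g (butlast xs) = f (take p xs) * g (butlast (drop p xs))"
    using len by (simp add: cup_cochain_def take_butlast drop_butlast)
  have 4: "hd (take (Suc p) xs) = hd xs" "last (drop p xs) = last xs"
    using len by (cases xs; simp)+
  have 5: "butlast (take (Suc p) xs) = take p xs" "last (take (Suc p) xs) = xs ! p"
    using len by (simp_all add: take_Suc_conv_app_nth)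
  have 6: "hd (drop p xs) = xs ! p" "tl (drop p xs) = drop (Suc p) xs"
    using len by (simp_all add: hd_drop_conv_nth drop_Suc tl_drop)
  show ?thesis
    using assms t unfolding hoch_diff_def
    by (simp only: if_True 1 2 3 4 5 6) (simp add: algebra_simps power_add)
qed


section \<open>Cohomology of plactic monoids in low degrees\<close>

interpretation plactic: cochain_complex "hoch_cochains (plactic A)" "hoch_diff (plactic A) eps0" for A
  by (rule hoch_cochain_complex)

lemma plactic_cohomology_eq:
  "plactic_cohomology A = cohomology (hoch_cochains (plactic A)) (hoch_diff (plactic A) eps0)"
  by (simp add: plactic_cohomology_def fun_eq_iff)

abbreviation plactic_cocycles :: "'a::linorder set \<Rightarrow> nat \<Rightarrow> ('a list set list \<Rightarrow> 'r::comm_ring_1) set" where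
  "plactic_cocycles A \<equiv> cocycles (hoch_cochains (plactic A)) (hoch_diff (plactic A) eps0)"

abbreviation plactic_coboundaries :: "'a::linorder set \<Rightarrow> nat \<Rightarrow> ('a list set list \<Rightarrow> 'r::comm_ring_1) set" where
  "plactic_coboundaries A \<equiv> coboundaries (hoch_cochains (plactic A)) (hoch_diff (plactic A) eps0)"

abbreviation hoch_class :: "'a::linorder set \<Rightarrow> nat \<Rightarrow> ('a list set list \<Rightarrow> 'r::comm_ring_1) \<Rightarrow> ('a list set list \<Rightarrow> 'r) set" where
  "hoch_class A k f \<equiv> cohomologous (hoch_cochains (plactic A)) (hoch_diff (plactic A) eps0) k `` {f}"

lemma hoch_diff_1:
  assumes "x \<in> carrier M" "y \<in> carrier M"
  shows "hoch_diff M chi (Suc 0) f [x, y] = chi x * f [y] - f [x \<otimes>\<^bsub>M\<^esub> y] + chi y * f [x]"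
  using assms hoch_diff_Cons[of x y "[]" M 1 chi f] by (simp add: tuples_def)

lemma hoch_diff_2:
  assumes "x \<in> carrier M" "y \<in> carrier M" "z \<in> carrier M"
  shows "hoch_diff M chi 2 f [x, y, z]
    = chi x * f [y, z] - f [x \<otimes>\<^bsub>M\<^esub> y, z] + f [x, y \<otimes>\<^bsub>M\<^esub> z] - chi z * f [x, y]"
  using assms hoch_diff_Cons[of x y "[z]" M 2 chi f] by (simp add: tuples_def)

lemma tuples_1: "xs \<in> tuples X (Suc 0) \<longleftrightarrow> (\<exists>x\<in>X. xs = [x])"
  by (auto simp: tuples_def length_Suc_conv)

lemma tuples_2: "xs \<in> tuples X 2 \<longleftrightarrow> (\<exists>x\<in>X. \<exists>y\<in>X. xs = [x, y])"
  by (auto simp: tuples_def length_Suc_conv numeral_2_eq_2)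

lemma tuples_3: "xs \<in> tuples X 3 \<longleftrightarrow> (\<exists>x\<in>X. \<exists>y\<in>X. \<exists>z\<in>X. xs = [x, y, z])"
  by (auto simp: tuples_def length_Suc_conv numeral_3_eq_3)

lemma hoch_diff_outside: "xs \<notin> tuples (carrier M) (Suc k) \<Longrightarrow> hoch_diff M chi k f xs = 0"
  by (simp add: hoch_diff_def)

lemma cocycle_1_iff:
  "f \<in> plactic_cocycles A 1 \<longleftrightarrow> f \<in> hoch_cochains (plactic A) 1 \<and>
    (\<forall>u\<in>lists A. \<forall>v\<in>lists A. f [plactic_class A (u @ v)]
       = eps0 (plactic_class A u) * f [plactic_class A v] + eps0 (plactic_class A v) * f [plactic_class A u])"
proof -
  have "hoch_diff (plactic A) eps0 1 f = (\<lambda>_. 0) \<longleftrightarrow>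
    (\<forall>x\<in>carrier (plactic A). \<forall>y\<in>carrier (plactic A). hoch_diff (plactic A) eps0 1 f [x, y] = 0)"
    using hoch_diff_outside[of _ "plactic A" 1 eps0 f]
    by (auto simp: fun_eq_iff tuples_2 numeral_2_eq_2[symmetric]) metis
  also have "\<dots> \<longleftrightarrow> (\<forall>u\<in>lists A. \<forall>v\<in>lists A. f [plactic_class A (u @ v)]
       = eps0 (plactic_class A u) * f [plactic_class A v] + eps0 (plactic_class A v) * f [plactic_class A u])"
    unfolding carrier_plactic ball_simps
    by (intro ball_cong refl)
      (auto simp: hoch_diff_1 plactic_class_in_carrier mult_plactic algebra_simps eq_diff_eq add_eq_0_iff2)
  finally show ?thesis by (simp add: cocycles_def)
qed

lemma cocycle_2_iff:
  "f \<in> plactic_cocycles A 2 \<longleftrightarrow> f \<in> hoch_cochains (plactic A) 2 \<and>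
    (\<forall>u\<in>lists A. \<forall>v\<in>lists A. \<forall>w\<in>lists A.
       f [plactic_class A (u @ v), plactic_class A w] + eps0 (plactic_class A w) * f [plactic_class A u, plactic_class A v]
       = f [plactic_class A u, plactic_class A (v @ w)] + eps0 (plactic_class A u) * f [plactic_class A v, plactic_class A w])"
proof -
  have "hoch_diff (plactic A) eps0 2 f = (\<lambda>_. 0) \<longleftrightarrow>
    (\<forall>x\<in>carrier (plactic A). \<forall>y\<in>carrier (plactic A). \<forall>z\<in>carrier (plactic A).
       hoch_diff (plactic A) eps0 2 f [x, y, z] = 0)"
    using hoch_diff_outside[of _ "plactic A" 2 eps0 f]
    by (auto simp: fun_eq_iff tuples_3 numeral_3_eq_3[symmetric]) metis
  also have "\<dots> \<longleftrightarrow> (\<forall>u\<in>lists A. \<forall>v\<in>lists A. \<forall>w\<in>lists A.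
       f [plactic_class A (u @ v), plactic_class A w] + eps0 (plactic_class A w) * f [plactic_class A u, plactic_class A v]
       = f [plactic_class A u, plactic_class A (v @ w)] + eps0 (plactic_class A u) * f [plactic_class A v, plactic_class A w])"
    unfolding carrier_plactic ball_simps
    by (intro ball_cong refl)
      (auto simp: hoch_diff_2 plactic_class_in_carrier mult_plactic algebra_simps eq_diff_eq add_eq_0_iff2)
  finally show ?thesis by (simp add: cocycles_def)
qed

lemma plactic_class_letter_eq_iff:
  "a \<in> A \<Longrightarrow> u \<in> lists A \<Longrightarrow> plactic_class A u = plactic_class A [a] \<longleftrightarrow> u = [a]"
  using knuth_cong_short[of "[a]" u A] knuth_cong_sym by (fastforce simp: plactic_class_eq_iff)

lemma plactic_coordinates_1:
  "cohomology_coordinates (hoch_cochains (plactic A)) (hoch_diff (plactic A) eps0) 1 A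
     (\<lambda>a f. f [plactic_class A [a]])"
proof (unfold_locales, goal_cases)
  case (2 f)
  have "f = (\<lambda>_. 0)" if z: "\<forall>a\<in>A. f [plactic_class A [a]] = 0"
  proof
    fix xs
    show "f xs = 0"
    proof (cases "xs \<in> tuples (carrier (plactic A)) 1")
      case True
      then obtain w where w: "w \<in> lists A" "xs = [plactic_class A w]"
        by (auto simp: tuples_1 carrier_plactic)
      have *: "f [plactic_class A (u @ v)] = eps0 (plactic_class A u) * f [plactic_class A v]
          + eps0 (plactic_class A v) * f [plactic_class A u]" if "u \<in> lists A" "v \<in> lists A" for u v
        using 2 that unfolding cocycle_1_iff by blast
      show ?thesis
      proof (cases w)
        case Nil
        then show ?thesis using *[of "[]" "[]"] w by (simp add: eps0_plactic_class)
      next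
        case (Cons a v)
        then have "a \<in> A" "v \<in> lists A" using w by auto
        then show ?thesis using *[of "[a]" v] z w by (simp add: Cons eps0_plactic_class)
      qed
    next
      case False
      then show ?thesis using 2 by (simp add: cocycles_def hoch_cochains_def)
    qed
  qed
  moreover have "plactic_coboundaries A 1 = {\<lambda>_. 0}"
    using plactic.C_zero by (auto simp: coboundaries_def hoch_diff_0)
  ultimately show ?case by auto
qed simp

lemma letter_cochain_cocycle:
  fixes A :: "'a::linorder set" and h :: "'a \<Rightarrow> 'r::comm_ring_1"
  defines "f \<equiv> (\<lambda>xs. if \<exists>a\<in>A. xs = [plactic_class A [a]] then h (THE a. a \<in> A \<and> xs = [plactic_class A [a]]) else 0)"
  shows "f \<in> plactic_cocycles A 1" "\<And>a. a \<in> A \<Longrightarrow> f [plactic_class A [a]] = h a"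
proof -
  have inj: "plactic_class A [a] = plactic_class A [b] \<longleftrightarrow> a = b" if "a \<in> A" "b \<in> A" for a b
    using that plactic_class_letter_eq_iff[of b A "[a]"] by simp
  have letter: "f [plactic_class A [a]] = h a" if a: "a \<in> A" for a
  proof -
    have "(THE b. b \<in> A \<and> [plactic_class A [a]] = [plactic_class A [b]]) = a"
      using a inj by (intro the_equality) auto
    then show ?thesis using a by (auto simp: f_def)
  qed
  have other: "f [plactic_class A u] = 0" if "u \<in> lists A" "length u \<noteq> 1" for u
    using that by (auto simp: f_def plactic_class_letter_eq_iff)
  show "f \<in> plactic_cocycles A 1"
    unfolding cocycle_1_iff
  proof (intro conjI ballI)
    show "f \<in> hoch_cochains (plactic A) 1"
      by (auto simp: hoch_cochains_def f_def tuples_1 plactic_class_in_carrier)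
    fix u v assume uv: "u \<in> lists A" "v \<in> lists A"
    show "f [plactic_class A (u @ v)] = eps0 (plactic_class A u) * f [plactic_class A v]
        + eps0 (plactic_class A v) * f [plactic_class A u]"
    proof (cases "u = [] \<or> v = []")
      case True
      then show ?thesis using uv other[of "[]"] by (auto simp: eps0_plactic_class)
    next
      case False
      then have "length (u @ v) \<noteq> 1" by (cases u) auto
      then show ?thesis using False uv other[of "u @ v"] by (simp add: eps0_plactic_class)
    qed
  qed
  show "\<And>a. a \<in> A \<Longrightarrow> f [plactic_class A [a]] = h a" by (rule letter)
qed

lemma plactic_cohomology_1:
  "linearly_isomorphic (plactic_cohomology A 1 :: ('r::comm_ring_1, _) module) (map_module A)"
proof -
  interpret cohomology_coordinates "hoch_cochains (plactic A)" "hoch_diff (plactic A) eps0 :: _ \<Rightarrow> _ \<Rightarrow> _ \<Rightarrow> 'r"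
    1 A "\<lambda>a f. f [plactic_class A [a]]"
    by (rule plactic_coordinates_1)
  show ?thesis
    unfolding plactic_cohomology_eq
  proof (rule linearly_isomorphic_map_module)
    show "\<exists>f\<in>plactic_cocycles A 1. \<forall>a\<in>A. f [plactic_class A [a]] = h a" for h :: "'a \<Rightarrow> 'r"
      by (rule bexI[OF _ letter_cochain_cocycle(1)[of A h]]) (intro ballI letter_cochain_cocycle(2))
  qed
qed

text \<open>The value at \<open>([a], [b, d])\<close> measures a 2-cocycle against the Knuth relation for the
  word \<open>a b d\<close>.\<close>

definition knuth_functional :: "'a::linorder set \<Rightarrow> 'a list \<times> 'a list \<Rightarrow> ('a list set list \<Rightarrow> 'r::comm_ring_1) \<Rightarrow> 'r" where
  "knuth_functional A = (\<lambda>(x, y) f. let a = hd x; b = hd y; c = last y in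
     f [plactic_class A [a], plactic_class A [b, c]]
     - (if a \<le> c then f [plactic_class A [b], plactic_class A [a, c]]
        else f [plactic_class A [a], plactic_class A [c, b]]))"

lemma knuth_functional_apply:
  "knuth_functional A ([a], [b, c]) f = f [plactic_class A [a], plactic_class A [b, c]]
     - (if a \<le> c then f [plactic_class A [b], plactic_class A [a, c]]
        else f [plactic_class A [a], plactic_class A [c, b]])"
  by (simp add: knuth_functional_def)

lemma C_wedge_iff: "s \<in> C_wedge A \<longleftrightarrow> (\<exists>a\<in>A. \<exists>b\<in>A. \<exists>c\<in>A. s = ([a], [b, c]) \<and> c < b \<and> a \<le> b)"
  by (auto simp: C_wedge_def Col_def)

lemma knuth_relation_cong:
  assumes "a \<in> A" "b \<in> A" "c \<in> A" "c < b" "a \<le> b"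
  shows "([a, b, c], if a \<le> c then [b, a, c] else [a, c, b]) \<in> knuth_cong A"
proof (cases "a \<le> c")
  case True
  then show ?thesis
    using assms knuth_step.intros(1)[of "[]" a c b "[]" A] by (auto intro: knuth_cong_step)
next
  case False
  then show ?thesis
    using assms knuth_cong_sym[OF knuth_cong_step, of A "[a, c, b]" "[a, b, c]"]
      knuth_step.intros(2)[of "[]" c a b "[]" A] by auto
qed

lemma knuth_functional_coboundary:
  assumes "s \<in> C_wedge A" "f \<in> plactic_coboundaries A 2"
  shows "knuth_functional A s f = 0"
proof -
  obtain a b c where s: "a \<in> A" "b \<in> A" "c \<in> A" "s = ([a], [b, c])" "c < b" "a \<le> b"
    using assms(1) by (auto simp: C_wedge_iff)
  obtain g where f: "f = hoch_diff (plactic A) eps0 1 g"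
    using assms(2) by (auto simp: coboundaries_def numeral_2_eq_2)
  have *: "f [plactic_class A u, plactic_class A v] = - g [plactic_class A (u @ v)]"
    if "u \<in> lists A" "v \<in> lists A" "u \<noteq> []" "v \<noteq> []" for u v
    using that by (simp add: f hoch_diff_1 plactic_class_in_carrier mult_plactic eps0_plactic_class)
  have "plactic_class A [a, b, c] = plactic_class A (if a \<le> c then [b, a, c] else [a, c, b])"
    using s knuth_relation_cong[of a A b c] by (simp add: plactic_class_eq_iff)
  then show ?thesis using s by (simp add: knuth_functional_apply * split: if_splits)
qed

lemma cocycle_2_shift:
  assumes f: "f \<in> plactic_cocycles A 2" and "set u \<subseteq> A" "v \<in> lists A" "u \<noteq> []" "v \<noteq> []"
  shows "f [plactic_class A u, plactic_class A v]
    = f [plactic_class A [hd (u @ v)], plactic_class A (tl (u @ v))]"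
proof (cases u)
  case (Cons a w)
  have *: "f [plactic_class A (u @ v), plactic_class A w] + eps0 (plactic_class A w) * f [plactic_class A u, plactic_class A v]
       = f [plactic_class A u, plactic_class A (v @ w)] + eps0 (plactic_class A u) * f [plactic_class A v, plactic_class A w]"
    if "u \<in> lists A" "v \<in> lists A" "w \<in> lists A" for u v w
    using f that unfolding cocycle_2_iff by blast
  show ?thesis
    using *[of "[a]" w v] assms Cons by (cases "w = []") (auto simp: eps0_plactic_class lists_eq_set)
qed (use assms in simp)

lemma cocycle_2_unit:
  assumes f: "f \<in> plactic_cocycles A 2" and w: "w \<in> lists A" "w \<noteq> []"
  shows "f [plactic_class A [], plactic_class A w] = 0" "f [plactic_class A w, plactic_class A []] = 0"
proof -
  have *: "f [plactic_class A (u @ v), plactic_class A w] + eps0 (plactic_class A w) * f [plactic_class A u, plactic_class A v]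
       = f [plactic_class A u, plactic_class A (v @ w)] + eps0 (plactic_class A u) * f [plactic_class A v, plactic_class A w]"
    if "u \<in> lists A" "v \<in> lists A" "w \<in> lists A" for u v w
    using f that unfolding cocycle_2_iff by blast
  show "f [plactic_class A [], plactic_class A w] = 0"
    using *[of "[]" "[]" w] w by (simp add: eps0_plactic_class)
  show "f [plactic_class A w, plactic_class A []] = 0"
    using *[of w "[]" "[]"] w by (simp add: eps0_plactic_class)
qed

lemma cocycle_2_step:
  assumes f: "f \<in> plactic_cocycles A 2" and z: "\<forall>s\<in>C_wedge A. knuth_functional A s f = 0"
    and st: "knuth_step A x y"
  shows "f [plactic_class A [hd x], plactic_class A (tl x)] = f [plactic_class A [hd y], plactic_class A (tl y)]"
proof -
  obtain u r r' v where xy: "x = u @ r @ v" "y = u @ r' @ v" and r: "knuth_step A r r'"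
    "r \<noteq> []" "r' \<noteq> []" "length (tl r) = 2" "length (tl r') = 2"
    and r0: "f [plactic_class A [hd r], plactic_class A (tl r)] = f [plactic_class A [hd r'], plactic_class A (tl r')]"
    and uv: "u \<in> lists A" "v \<in> lists A"
    using st
  proof cases
    case (1 u a c b v)
    have "([a], [b, c]) \<in> C_wedge A" using 1 by (auto simp: C_wedge_iff)
    then have "f [plactic_class A [a], plactic_class A [b, c]] = f [plactic_class A [b], plactic_class A [a, c]]"
      using z 1 knuth_functional_apply[of A a b c f] by auto
    then show ?thesis
      using that[of u "[a, b, c]" v "[b, a, c]"] 1 knuth_step.intros(1)[of "[]" a c b "[]" A]
      by (auto simp: lists_eq_set)
  next
    case (2 u c a b v)
    have "([a], [b, c]) \<in> C_wedge A" using 2 by (auto simp: C_wedge_iff)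
    then have "f [plactic_class A [a], plactic_class A [c, b]] = f [plactic_class A [a], plactic_class A [b, c]]"
      using z 2 knuth_functional_apply[of A a b c f] by auto
    then show ?thesis
      using that[of u "[a, c, b]" v "[a, b, c]"] 2 knuth_step.intros(2)[of "[]" c a b "[]" A]
      by (auto simp: lists_eq_set)
  qed
  have rl: "r \<in> lists A" "r' \<in> lists A" using knuth_step_lists[OF r(1)] by auto
  have rr: "(r, r') \<in> knuth_cong A" using r(1) by (rule knuth_cong_step)
  show ?thesis
  proof (cases "u = []")
    case False
    have "plactic_class A (tl u @ r @ v) = plactic_class A (tl u @ r' @ v)"
      using knuth_cong_context[OF rr, of "tl u" v] uv rl False
      by (cases u) (auto simp: plactic_class_eq_iff)
    then show ?thesis using False by (simp add: xy)
  next
    case u: True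
    show ?thesis
    proof (cases "v = []")
      case True
      then show ?thesis using u r0 by (simp add: xy)
    next
      case False
      have "plactic_class A r = plactic_class A r'"
        using rl rr by (simp add: plactic_class_eq_iff)
      then show ?thesis
        using cocycle_2_shift[OF f, of r v] cocycle_2_shift[OF f, of r' v] False r rl uv
        by (simp add: xy u lists_eq_set)
    qed
  qed
qed

lemma cocycle_2_coboundary:
  assumes f: "f \<in> plactic_cocycles A 2" and z: "\<forall>s\<in>C_wedge A. knuth_functional A s f = 0"
  shows "f \<in> plactic_coboundaries A 2"
proof -
  define t where "t w = (if w = [] then f [plactic_class A [], plactic_class A []]
    else if length w = 1 then 0 else - f [plactic_class A [hd w], plactic_class A (tl w)])" for w
  have t: "t u = t v" if "(u, v) \<in> knuth_cong A" for u v
  proof (rule knuth_cong_invariant[OF that])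
    fix x y assume st: "knuth_step A x y"
    then have "length x = length y" using knuth_step_mset mset_eq_length by blast
    moreover have "2 < length x" using st by (auto elim!: knuth_step.cases)
    ultimately show "t x = t y" using cocycle_2_step[OF f z st] by (auto simp: t_def)
  qed
  define g where "g xs = (if xs \<in> tuples (carrier (plactic A)) 1 then t (SOME w. w \<in> hd xs) else 0)" for xs
  have g: "g [plactic_class A w] = t w" if "w \<in> lists A" for w
  proof -
    have "(SOME v. v \<in> plactic_class A w) \<in> plactic_class A w"
      using knuth_cong_refl[OF that] by (intro someI[of "\<lambda>v. v \<in> plactic_class A w"]) (simp add: mem_plactic_class)
    then have "t w = t (SOME v. v \<in> plactic_class A w)"
      by (intro t) (simp add: mem_plactic_class)
    then show ?thesis using that by (simp add: g_def tuples_1 plactic_class_in_carrier)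
  qed
  have "hoch_diff (plactic A) eps0 1 g = f"
  proof
    fix xs
    show "hoch_diff (plactic A) eps0 1 g xs = f xs"
    proof (cases "xs \<in> tuples (carrier (plactic A)) 2")
      case True
      then obtain u v where uv: "u \<in> lists A" "v \<in> lists A" "xs = [plactic_class A u, plactic_class A v]"
        by (auto simp: tuples_2 carrier_plactic)
      have d: "hoch_diff (plactic A) eps0 1 g xs
          = eps0 (plactic_class A u) * t v - t (u @ v) + eps0 (plactic_class A v) * t u"
        using uv by (simp add: hoch_diff_1 plactic_class_in_carrier mult_plactic g)
      consider "u = []" "v = []" | "u = []" "v \<noteq> []" | "u \<noteq> []" "v = []" | "u \<noteq> []" "v \<noteq> []" by blast
      then show ?thesis
      proof cases
        case 1
        then show ?thesis using d uv by (simp add: eps0_plactic_class t_def)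
      next
        case 2
        then show ?thesis using d uv cocycle_2_unit[OF f, of v] by (simp add: eps0_plactic_class)
      next
        case 3
        then show ?thesis using d uv cocycle_2_unit[OF f, of u] by (simp add: eps0_plactic_class)
      next
        case 4
        then have "length (u @ v) \<noteq> 1" by (cases u) auto
        then show ?thesis using d uv 4 cocycle_2_shift[OF f, of u v]
          by (simp add: eps0_plactic_class t_def lists_eq_set)
      qed
    next
      case False
      then show ?thesis using f
        by (simp add: cocycles_def hoch_cochains_def hoch_diff_outside numeral_2_eq_2)
    qed
  qed
  moreover have "g \<in> hoch_cochains (plactic A) 1" by (simp add: hoch_cochains_def g_def)
  ultimately show ?thesis by (auto simp: coboundaries_def numeral_2_eq_2)
qed

lemma plactic_coordinates_2:
  "cohomology_coordinates (hoch_cochains (plactic A)) (hoch_diff (plactic A) eps0) 2 (C_wedge A)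
     (knuth_functional A)"
proof (unfold_locales, goal_cases)
  case (1 s f g a b)
  then show ?case
    by (cases s) (simp add: knuth_functional_def Let_def algebra_simps)
next
  case (2 f)
  then show ?case using cocycle_2_coboundary knuth_functional_coboundary by blast
qed

text \<open>A function \<open>\<theta>\<close> on words defines a cochain \<open>f(u, v) = \<theta>(u v)\<close> as soon as it is Knuth invariant in
  length at least 4, since classes of words of length at most 2 are singletons.\<close>

definition word_cochain :: "'a::linorder set \<Rightarrow> ('a list \<Rightarrow> 'r::comm_ring_1) \<Rightarrow> 'a list set list \<Rightarrow> 'r" where
  "word_cochain A \<theta> xs = (if \<exists>u\<in>lists A - {[]}. \<exists>v\<in>lists A - {[]}. xs = [plactic_class A u, plactic_class A v]
     then \<theta> (concat (map (\<lambda>X. SOME w. w \<in> X) xs)) else 0)"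

lemma word_cochain_apply:
  assumes \<theta>: "\<And>u v. (u, v) \<in> knuth_cong A \<Longrightarrow> 4 \<le> length u \<Longrightarrow> \<theta> u = \<theta> v"
    and "u \<in> lists A" "v \<in> lists A" "u \<noteq> []" "v \<noteq> []"
  shows "word_cochain A \<theta> [plactic_class A u, plactic_class A v] = \<theta> (u @ v)"
proof -
  have some: "(w, SOME v. v \<in> plactic_class A w) \<in> knuth_cong A" if "w \<in> lists A" for w
    using someI[of "\<lambda>v. v \<in> plactic_class A w" w] knuth_cong_refl[OF that] by (simp add: mem_plactic_class)
  let ?u = "SOME w. w \<in> plactic_class A u" and ?v = "SOME w. w \<in> plactic_class A v"
  have "\<theta> (u @ v) = \<theta> (?u @ ?v)"
  proof (cases "4 \<le> length (u @ v)")
    case True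
    then show ?thesis using \<theta> knuth_cong_append some assms by blast
  next
    case False
    then have "length u < 3" "length v < 3" using assms by (cases u; cases v; simp)+
    then have "?u = u" "?v = v" using knuth_cong_short some assms by blast+
    then show ?thesis by simp
  qed
  moreover have "word_cochain A \<theta> [plactic_class A u, plactic_class A v] = \<theta> (?u @ ?v)"
    using assms by (auto simp: word_cochain_def)
  ultimately show ?thesis by simp
qed

lemma word_cochain_unit:
  assumes "u = [] \<or> v = []" "u \<in> lists A" "v \<in> lists A"
  shows "word_cochain A \<theta> [plactic_class A u, plactic_class A v] = 0"
  using assms plactic_class_Nil_iff[of _ A] by (fastforce simp: word_cochain_def)

lemma word_cochain_cocycle:
  assumes \<theta>: "\<And>u v. (u, v) \<in> knuth_cong A \<Longrightarrow> 4 \<le> length u \<Longrightarrow> \<theta> u = \<theta> v"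
  shows "word_cochain A \<theta> \<in> plactic_cocycles A 2"
  unfolding cocycle_2_iff
proof (intro conjI ballI)
  show "word_cochain A \<theta> \<in> hoch_cochains (plactic A) 2"
    by (auto simp: hoch_cochains_def word_cochain_def tuples_2 plactic_class_in_carrier)
  fix u v w assume uvw: "u \<in> lists A" "v \<in> lists A" "w \<in> lists A"
  show "word_cochain A \<theta> [plactic_class A (u @ v), plactic_class A w]
        + eps0 (plactic_class A w) * word_cochain A \<theta> [plactic_class A u, plactic_class A v]
       = word_cochain A \<theta> [plactic_class A u, plactic_class A (v @ w)]
        + eps0 (plactic_class A u) * word_cochain A \<theta> [plactic_class A v, plactic_class A w]"
    using uvw
    by (cases "u = []"; cases "v = []"; cases "w = []")
      (simp_all add: eps0_plactic_class word_cochain_unit word_cochain_apply[OF \<theta>])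
qed

lemma plactic_cohomology_2:
  "linearly_isomorphic (plactic_cohomology A 2 :: ('r::comm_ring_1, _) module) (map_module (C_wedge A))"
proof -
  interpret cohomology_coordinates "hoch_cochains (plactic A)" "hoch_diff (plactic A) eps0 :: _ \<Rightarrow> _ \<Rightarrow> _ \<Rightarrow> 'r"
    2 "C_wedge A" "knuth_functional A"
    by (rule plactic_coordinates_2)
  show ?thesis
    unfolding plactic_cohomology_eq
  proof (rule linearly_isomorphic_map_module)
    fix h :: "'a list \<times> 'a list \<Rightarrow> 'r"
    define \<theta> where "\<theta> w = (if length w = 3 \<and> ([hd w], tl w) \<in> C_wedge A then h ([hd w], tl w) else 0)" for w
    have \<theta>: "\<theta> u = \<theta> v" if "(u, v) \<in> knuth_cong A" "4 \<le> length u" for u v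
      using that knuth_cong_length[of u v A] by (simp add: \<theta>_def)
    have "knuth_functional A s (word_cochain A \<theta>) = h s" if s: "s \<in> C_wedge A" for s
    proof -
      obtain a b c where abc: "a \<in> A" "b \<in> A" "c \<in> A" "s = ([a], [b, c])" "c < b" "a \<le> b"
        using s by (auto simp: C_wedge_iff)
      have "\<theta> [b, a, c] = 0" if "a \<le> c" using that by (auto simp: \<theta>_def C_wedge_iff)
      moreover have "\<theta> [a, c, b] = 0" using abc by (auto simp: \<theta>_def C_wedge_iff)
      moreover have "\<theta> [a, b, c] = h s" using abc by (simp add: \<theta>_def C_wedge_iff)
      ultimately show ?thesis
        using abc by (simp add: knuth_functional_apply word_cochain_apply[where A = A, OF \<theta>])
    qed
    then have "\<forall>s\<in>C_wedge A. knuth_functional A s (word_cochain A \<theta>) = h s" by simp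
    moreover have "word_cochain A \<theta> \<in> plactic_cocycles A 2"
      by (rule word_cochain_cocycle) (rule \<theta>)
    ultimately show "\<exists>f\<in>plactic_cocycles A 2. \<forall>s\<in>C_wedge A. knuth_functional A s f = h s"
      by (rule bexI)
  qed
qed


section \<open>The cup product\<close>

lemma cup_cochain_cocycle:
  assumes "f \<in> plactic_cocycles A p" "g \<in> plactic_cocycles A q"
  shows "cup_cochain p f g \<in> plactic_cocycles A (p + q)"
proof -
  have "hoch_diff (plactic A) eps0 (p + q) (cup_cochain p f g) xs = 0" for xs
    using assms hoch_diff_cup[of xs "plactic A" p q eps0 f g] hoch_diff_outside[of xs "plactic A" "p + q"]
    by (cases "xs \<in> tuples (carrier (plactic A)) (Suc (p + q))") (auto simp: cocycles_def)
  then show ?thesis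
    using assms cup_cochain_mem[of f "plactic A" p g q] by (simp add: cocycles_def fun_eq_iff)
qed

lemma cup_coboundary_left:
  assumes "f \<in> plactic_coboundaries A p" "g \<in> plactic_cocycles A q"
  shows "cup_cochain p f g \<in> plactic_coboundaries A (p + q)"
proof (cases p)
  case 0
  then show ?thesis
    using assms(1) plactic.B_zero by (auto simp: coboundaries_def cup_cochain_def[abs_def])
next
  case (Suc j)
  then obtain h where h: "h \<in> hoch_cochains (plactic A) j" "f = hoch_diff (plactic A) eps0 j h"
    using assms(1) by (auto simp: coboundaries_def)
  have "hoch_diff (plactic A) eps0 (j + q) (cup_cochain j h g) xs = cup_cochain p f g xs" for xs
  proof (cases "xs \<in> tuples (carrier (plactic A)) (Suc (j + q))")
    case True
    then show ?thesis
      using assms(2) by (simp add: hoch_diff_cup Suc h(2) cocycles_def) (simp add: cup_cochain_def)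
  next
    case False
    have "f \<in> hoch_cochains (plactic A) p"
      by (auto simp: h(2) Suc hoch_cochains_def hoch_diff_outside)
    then have "cup_cochain p f g \<in> hoch_cochains (plactic A) (p + q)"
      using assms(2) by (intro cup_cochain_mem) (auto simp: cocycles_def)
    then show ?thesis using False by (simp add: hoch_diff_outside hoch_cochains_def Suc)
  qed
  then have "cup_cochain p f g = hoch_diff (plactic A) eps0 (j + q) (cup_cochain j h g)" by auto
  moreover have "cup_cochain j h g \<in> hoch_cochains (plactic A) (j + q)"
    using assms(2) h(1) by (intro cup_cochain_mem) (auto simp: cocycles_def)
  ultimately show ?thesis by (simp add: coboundaries_def Suc)
qed

lemma cup_coboundary_right:
  assumes "f \<in> plactic_cocycles A p" "g \<in> plactic_coboundaries A q"
  shows "cup_cochain p f g \<in> plactic_coboundaries A (p + q)"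
proof (cases q)
  case 0
  then show ?thesis
    using assms(2) plactic.B_zero by (auto simp: coboundaries_def cup_cochain_def[abs_def])
next
  case (Suc j)
  then obtain h where h: "h \<in> hoch_cochains (plactic A) j" "g = hoch_diff (plactic A) eps0 j h"
    using assms(2) by (auto simp: coboundaries_def)
  have "hoch_diff (plactic A) eps0 (p + j) (cup_cochain p f h) xs = (- 1) ^ p * cup_cochain p f g xs" for xs
  proof (cases "xs \<in> tuples (carrier (plactic A)) (Suc (p + j))")
    case True
    then show ?thesis
      using assms(1) by (simp add: hoch_diff_cup h(2) cocycles_def) (simp add: cup_cochain_def)
  next
    case False
    have "g \<in> hoch_cochains (plactic A) q"
      by (auto simp: h(2) Suc hoch_cochains_def hoch_diff_outside)
    then have "cup_cochain p f g \<in> hoch_cochains (plactic A) (p + q)"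
      using assms(1) by (intro cup_cochain_mem) (auto simp: cocycles_def)
    then show ?thesis using False by (simp add: hoch_diff_outside hoch_cochains_def Suc)
  qed
  then have "(\<lambda>xs. (- 1) ^ p * cup_cochain p f g xs) = hoch_diff (plactic A) eps0 (p + j) (cup_cochain p f h)" by auto
  moreover have "cup_cochain p f h \<in> hoch_cochains (plactic A) (p + j)"
    using assms(1) h(1) by (intro cup_cochain_mem) (auto simp: cocycles_def)
  ultimately have "(\<lambda>xs. (- 1) ^ p * cup_cochain p f g xs) \<in> plactic_coboundaries A (p + q)"
    by (simp add: coboundaries_def Suc)
  from plactic.B_smult[OF this, of "(- 1) ^ p"] show ?thesis
    by (simp add: mult.assoc[symmetric] power_mult_distrib[symmetric])
qed

lemma plactic_cup_hoch_class:
  fixes f g :: "'a::linorder list set list \<Rightarrow> 'r::comm_ring_1"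
  assumes "f \<in> plactic_cocycles A p" "g \<in> plactic_cocycles A q"
  shows "plactic_cup A p q (hoch_class A p f) (hoch_class A q g) = hoch_class A (p + q) (cup_cochain p f g)"
proof -
  have "hoch_class A (p + q) (cup_cochain p f' g') = hoch_class A (p + q) (cup_cochain p f g)"
    if f': "f' \<in> hoch_class A p f" and g': "g' \<in> hoch_class A q g" for f' g'
  proof -
    have "(\<lambda>xs. cup_cochain p (\<lambda>x. f x - f' x) g' xs + cup_cochain p f (\<lambda>x. g x - g' x) xs)
        \<in> plactic_coboundaries A (p + q)"
      using f' g' assms
      by (intro plactic.B_add cup_coboundary_left cup_coboundary_right) (auto simp: plactic.mem_cls)
    then have "(\<lambda>xs. cup_cochain p f g xs - cup_cochain p f' g' xs) \<in> plactic_coboundaries A (p + q)"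
      by (simp add: cup_cochain_def algebra_simps)
    then show ?thesis
      using assms f' g' by (subst eq_commute) (simp add: plactic.cls_eq_iff cup_cochain_cocycle plactic.mem_cls)
  qed
  then have "(\<Union>f'\<in>hoch_class A p f. \<Union>g'\<in>hoch_class A q g. hoch_class A (p + q) (cup_cochain p f' g'))
      = (\<Union>f'\<in>hoch_class A p f. \<Union>g'\<in>hoch_class A q g. hoch_class A (p + q) (cup_cochain p f g))"
    by (intro SUP_cong refl)
  moreover have "hoch_class A p f \<noteq> {}" "hoch_class A q g \<noteq> {}"
    using plactic.self_mem_cls[OF assms(1)] plactic.self_mem_cls[OF assms(2)] by blast+
  moreover have "(\<lambda>xs. f' (take p xs) * g' (drop p xs)) = cup_cochain p f' g'" for f' g' :: "'a list set list \<Rightarrow> 'r"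
    by (simp add: cup_cochain_def fun_eq_iff)
  ultimately show ?thesis by (simp add: plactic_cup_def)
qed

lemma cup_1_1:
  assumes "X \<in> carrier (plactic_cohomology A 1 :: ('r::comm_ring_1, _) module)"
    "Y \<in> carrier (plactic_cohomology A 1 :: ('r, _) module)"
  shows "plactic_cup A 1 1 X Y = \<zero>\<^bsub>plactic_cohomology A 2\<^esub>"
proof -
  obtain f g where f: "f \<in> plactic_cocycles A 1" "X = hoch_class A 1 f"
    and g: "g \<in> plactic_cocycles A 1" "Y = hoch_class A 1 g"
    using assms by (auto simp: plactic_cohomology_eq plactic.carrier_H)
  have "knuth_functional A s (cup_cochain 1 f g) = 0" if "s \<in> C_wedge A" for s
  proof -
    have "g [plactic_class A [x, y]] = 0" if "x \<in> A" "y \<in> A" for x y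
    proof -
      have "g [plactic_class A ([x] @ [y])] = eps0 (plactic_class A [x]) * g [plactic_class A [y]]
          + eps0 (plactic_class A [y]) * g [plactic_class A [x]]"
        using g(1) that unfolding cocycle_1_iff by (metis Cons_in_lists_iff lists.Nil)
      then show ?thesis using that by (simp add: eps0_plactic_class)
    qed
    then show ?thesis using that
      by (auto simp: C_wedge_iff knuth_functional_apply cup_cochain_def)
  qed
  moreover have c: "cup_cochain 1 f g \<in> plactic_cocycles A 2"
    using cup_cochain_cocycle[OF f(1) g(1)] by (simp add: numeral_2_eq_2)
  ultimately have "cup_cochain 1 f g \<in> plactic_coboundaries A 2"
    by (intro cocycle_2_coboundary) auto
  then show ?thesis
    using plactic_cup_hoch_class[OF f(1) g(1)] c
    by (simp add: f(2) g(2) plactic_cohomology_eq plactic.cls_eq_zero_iff numeral_2_eq_2)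
qed


section \<open>Non-vanishing cohomology for three letters\<close>

text \<open>The cocycle of the critical tuple \<open>1, 32, 1, 32, \<dots>\<close>, preceded by \<open>2\<close> in odd degree, reads its
  arguments from left to right: each step splits off the column prescribed by the tuple and multiplies the
  rest with the next argument. The prescribed columns are given by relations \<open>s\<close>, where \<open>s v r\<close> means that
  \<open>v\<close> splits into the column and \<open>r\<close>.\<close>

fun peels :: "('m, 'b) monoid_scheme \<Rightarrow> ('m \<Rightarrow> 'm \<Rightarrow> bool) list \<Rightarrow> 'm \<Rightarrow> 'm list \<Rightarrow> bool" where
  "peels M [s] v [] = s v \<one>\<^bsub>M\<^esub>"
| "peels M (s # s' # ss) v (u # us) = (\<exists>r. s v r \<and> peels M (s' # ss) (r \<otimes>\<^bsub>M\<^esub> u) us)"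
| "peels M _ _ _ = False"

lemma peels_nonempty: "peels M (s # ss) v us \<Longrightarrow> \<exists>r. s v r"
  by (cases ss; cases us) auto

locale three_letters =
  fixes A :: "'a::linorder set" and x y z :: 'a
  assumes letters: "x \<in> A" "y \<in> A" "z \<in> A" and xy: "x < y" and yz: "y < z"
begin

abbreviation "M \<equiv> plactic A"
abbreviation "P \<equiv> plactic_class A"
abbreviation times (infixl \<open>\<cdot>\<close> 70) where "u \<cdot> v \<equiv> u \<otimes>\<^bsub>M\<^esub> v"

definition row :: "'a \<Rightarrow> 'a list set \<Rightarrow> 'a list set \<Rightarrow> bool" where
  "row a v r \<longleftrightarrow> (\<exists>w\<in>lists A. sorted (a # w) \<and> v = P (a # w) \<and> r = P w)"

definition col :: "'a list set \<Rightarrow> 'a list set \<Rightarrow> bool" where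
  "col v r \<longleftrightarrow> (\<exists>w. set w \<subseteq> {y, z} \<and> v = P (z # y # w) \<and> r = P w)"

lemma yz_lists: "set w \<subseteq> {y, z} \<Longrightarrow> w \<in> lists A"
  using letters by (auto simp: lists_eq_set)

lemma P_sorted_eq: "u \<in> lists A \<Longrightarrow> v \<in> lists A \<Longrightarrow> sorted v \<Longrightarrow> P u = P v \<longleftrightarrow> u = v"
  using knuth_cong_sorted knuth_cong_sym by (fastforce simp: plactic_class_eq_iff)

lemma row_P:
  assumes "a \<in> A" "u \<in> lists A"
  shows "row a (P u) r \<longleftrightarrow> (\<exists>w. u = a # w \<and> sorted u \<and> r = P w)"
proof
  assume "row a (P u) r"
  then obtain w where w: "w \<in> lists A" "sorted (a # w)" "P u = P (a # w)" "r = P w"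
    by (auto simp: row_def)
  then have "u = a # w" using assms P_sorted_eq[of u "a # w"] by simp
  then show "\<exists>w. u = a # w \<and> sorted u \<and> r = P w" using w by auto
next
  assume "\<exists>w. u = a # w \<and> sorted u \<and> r = P w"
  then show "row a (P u) r" using assms unfolding row_def by force
qed

lemma col_set:
  assumes "u \<in> lists A" "col (P u) r"
  shows "set u \<subseteq> {y, z}"
proof -
  obtain w where w: "set w \<subseteq> {y, z}" "P u = P (z # y # w)" using assms by (auto simp: col_def)
  then have "set u = set (z # y # w)"
    using assms(1) letters yz_lists[of w] knuth_cong_set[of u "z # y # w" A] by (simp add: plactic_class_eq_iff)
  then show ?thesis using w by auto
qed

lemma nf_zy: "two_letter_nf y (z # y # w) = (case two_letter_nf y w of (m, i, j) \<Rightarrow> (Suc m, i, j))"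
  using yz by (cases "two_letter_nf y w") (simp add: two_letter_nf_Cons less_imp_neq[THEN not_sym])

lemma P_eq_iff_nf:
  assumes "set u \<subseteq> {y, z}" "set v \<subseteq> {y, z}"
  shows "P u = P v \<longleftrightarrow> two_letter_nf y u = two_letter_nf y v"
  using assms yz letters by (simp add: plactic_class_eq_iff yz_lists two_letter_knuth_cong_iff)

lemma col_zy:
  assumes "set w \<subseteq> {y, z}"
  shows "col (P (z # y # w)) r \<longleftrightarrow> r = P w"
proof -
  have "P w' = P w" if "set w' \<subseteq> {y, z}" "P (z # y # w) = P (z # y # w')" for w'
    using that assms by (simp add: P_eq_iff_nf nf_zy split: prod.splits)
  then show ?thesis using assms unfolding col_def by metis
qed

lemma col_or_sorted:
  assumes "set u \<subseteq> {y, z}"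
  shows "(\<exists>r. col (P u) r) \<or> sorted (x # u)"
proof -
  obtain m i j where nf: "two_letter_nf y u = (m, i, j)" by (cases "two_letter_nf y u")
  have u: "P u = P (nf_word y z (m, i, j))"
    using knuth_cong_nf_word[OF yz letters(2,3) assms] assms letters
    by (simp add: plactic_class_eq_iff yz_lists nf_word_lists nf)
  show ?thesis
  proof (cases m)
    case 0
    have "sorted (replicate i y @ replicate j z)" using yz by (auto simp: sorted_append)
    then have "u = replicate i y @ replicate j z"
      using u assms letters by (subst (asm) P_sorted_eq)
        (auto simp: 0 nf_word_def yz_lists replicate_lists)
    then show ?thesis using xy yz by (auto simp: sorted_append)
  next
    case (Suc m')
    then have "P u = P (z # y # nf_word y z (m', i, j))" using u by (simp add: nf_word_def)
    moreover have "set (nf_word y z (m', i, j)) \<subseteq> {y, z}"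
      using nf_word_lists[of y "{y, z}" z] by (simp add: lists_eq_set)
    ultimately show ?thesis by (auto simp: col_def)
  qed
qed

definition G :: "('a list set \<Rightarrow> 'a list set \<Rightarrow> bool) list \<Rightarrow> 'a list set \<Rightarrow> 'a list set list \<Rightarrow> 'r::comm_ring_1" where
  "G ss v us = of_bool (peels M ss v us)"

lemma module_diff_G_Some:
  assumes "s v r" "\<And>r'. s v r' \<Longrightarrow> r' = r" "r \<in> carrier M"
    and c: "u \<in> carrier M" "set us \<subseteq> carrier M"
  shows "module_diff M eps0 (\<lambda>b zs. G (s # s' # ss) v (b # zs) :: 'r::comm_ring_1) u us
    = module_diff M eps0 (G (s' # ss)) (r \<cdot> u) us"
proof -
  have "s v r' \<longleftrightarrow> r' = r" for r' using assms(1,2) by blast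
  then have "(\<lambda>b zs. G (s # s' # ss) v (b # zs) :: 'r) = (\<lambda>b. G (s' # ss) (r \<cdot> b))"
    by (simp add: G_def fun_eq_iff)
  then show ?thesis
    using c assms(3) by (simp add: module_diff_translate monoid_plactic)
qed

lemma module_diff_G_None:
  assumes "\<nexists>r. s v r"
  shows "module_diff M eps0 (\<lambda>b zs. G (s # s' # ss) v (b # zs) :: 'r::comm_ring_1) u us = 0"
  using assms by (simp add: G_def module_diff_zero)

lemma eps0_P: "u \<in> lists A \<Longrightarrow> eps0 (P u) = of_bool (u = [])"
  by (simp add: eps0_plactic_class)

text \<open>\<open>G ss\<close> is a cocycle on non-units if \<open>ss\<close> starts with a row step; for other \<open>ss\<close> the defect is
  supported on rows which remain rows when preceded by the letter \<open>a\<close> of the previous step.\<close>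

definition row_cocycle :: "'r::comm_ring_1 itself \<Rightarrow> ('a list set \<Rightarrow> 'a list set \<Rightarrow> bool) list \<Rightarrow> bool" where
  "row_cocycle _ ss \<longleftrightarrow> (\<forall>v u us. v \<in> carrier M \<longrightarrow> u \<in> carrier M \<longrightarrow> set us \<subseteq> carrier M \<longrightarrow>
     module_diff M eps0 (G ss :: _ \<Rightarrow> _ \<Rightarrow> 'r) v (u # us) = of_bool (v = \<one>\<^bsub>M\<^esub>) * G ss u us)"

definition row_supported :: "'r::comm_ring_1 itself \<Rightarrow> 'a \<Rightarrow> ('a list set \<Rightarrow> 'a list set \<Rightarrow> bool) list \<Rightarrow> bool" where
  "row_supported _ a ss \<longleftrightarrow> (\<forall>w u us. w \<in> lists A \<longrightarrow> u \<in> carrier M \<longrightarrow> set us \<subseteq> carrier M \<longrightarrow>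
     module_diff M eps0 (G ss :: _ \<Rightarrow> _ \<Rightarrow> 'r) (P w) (u # us)
       = of_bool (sorted (a # w)) * G ss (P w \<cdot> u) us)"

lemma row_supported_col: "row_supported TYPE('r::comm_ring_1) x [col]"
  unfolding row_supported_def
proof (intro allI impI)
  fix w u us assume w: "w \<in> lists A" and u: "u \<in> carrier M" and "set us \<subseteq> carrier M"
  obtain w' where w': "w' \<in> lists A" "u = P w'" using u by (auto simp: carrier_plactic)
  have zy: "col (P v) (P []) \<longleftrightarrow> v = [z, y]" if "v \<in> lists A" for v
  proof
    assume "col (P v) (P [])"
    then obtain s where s: "set s \<subseteq> {y, z}" "P v = P (z # y # s)" "P [] = P s" by (auto simp: col_def)
    then have "s = []" using plactic_class_Nil_iff[of s A] by (simp add: yz_lists)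
    then have "(v, [z, y]) \<in> knuth_cong A"
      using s(2) that letters by (simp add: plactic_class_eq_iff)
    then show "v = [z, y]"
      using knuth_cong_short[of "[z, y]" v A] knuth_cong_sym[of v "[z, y]" A] by simp
  next
    assume "v = [z, y]"
    then show "col (P v) (P [])" using col_zy[of "[]"] by simp
  qed
  show "module_diff M eps0 (G [col] :: _ \<Rightarrow> _ \<Rightarrow> 'r) (P w) (u # us)
      = of_bool (sorted (x # w)) * G [col] (P w \<cdot> u) us"
  proof (cases us)
    case Nil
    have "w @ w' = [z, y] \<longleftrightarrow> w = [] \<and> w' = [z, y] \<or> w = [z] \<and> w' = [y] \<or> w = [z, y] \<and> w' = []"
      by (auto simp: append_eq_Cons_conv)
    then show ?thesis
      using w w' xy yz by (auto simp: Nil G_def mult_plactic eps0_P one_plactic zy)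
  next
    case (Cons a as)
    then show ?thesis by (simp add: G_def module_diff_zero)
  qed
qed

lemma row_cocycle_Cons:
  assumes "a \<in> A" "row_supported TYPE('r::comm_ring_1) a (s # ss)"
  shows "row_cocycle TYPE('r) (row a # s # ss)"
  unfolding row_cocycle_def
proof (intro allI impI)
  fix v u us assume v: "v \<in> carrier M" and u: "u \<in> carrier M" and us: "set us \<subseteq> carrier M"
  obtain w where w: "w \<in> lists A" "v = P w" using v by (auto simp: carrier_plactic)
  obtain w' where w': "w' \<in> lists A" "u = P w'" using u by (auto simp: carrier_plactic)
  have one: "v = \<one>\<^bsub>M\<^esub> \<longleftrightarrow> w = []" using w by (simp add: one_plactic plactic_class_Nil_iff)
  show "module_diff M eps0 (G (row a # s # ss) :: _ \<Rightarrow> _ \<Rightarrow> 'r) v (u # us)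
      = of_bool (v = \<one>\<^bsub>M\<^esub>) * G (row a # s # ss) u us"
  proof (cases us)
    case Nil
    then show ?thesis by (simp add: G_def)
  next
    case (Cons b bs)
    have b: "b \<in> carrier M" "set bs \<subseteq> carrier M" using us Cons by auto
    show ?thesis
    proof (cases "\<exists>r. row a v r")
      case True
      then obtain t where t: "w = a # t" "sorted w" "t \<in> lists A"
        using w assms(1) by (auto simp: row_P)
      have row: "row a v r \<longleftrightarrow> r = P t" for r using t w assms(1) by (simp add: row_P)
      have d: "module_diff M eps0 (G (row a # s # ss) :: _ \<Rightarrow> _ \<Rightarrow> 'r) v (u # us)
        = G (row a # s # ss) (v \<cdot> u) us - module_diff M eps0 (G (s # ss)) (P t \<cdot> u) us"
        using module_diff_G_Some[where s = "row a" and v = v, OF iffD2[OF row refl] iffD1[OF row]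
            plactic_class_in_carrier[OF t(3)] u us, of s ss]
        by (simp add: Cons)
      have "module_diff M eps0 (G (s # ss) :: _ \<Rightarrow> _ \<Rightarrow> 'r) (P t \<cdot> u) us
          = of_bool (sorted (a # t @ w')) * G (s # ss) (P (t @ w') \<cdot> b) bs"
        using assms(2) t w' b unfolding row_supported_def Cons by (simp add: mult_plactic del: module_diff.simps)
      moreover have "G (row a # s # ss) (v \<cdot> u) us
          = (of_bool (sorted (a # t @ w')) * G (s # ss) (P (t @ w') \<cdot> b) bs :: 'r)"
        using w w' t assms(1) by (auto simp: G_def Cons mult_plactic row_P)
      ultimately show ?thesis using d one t by simp
    next
      case False
      then have "row a (v \<cdot> u) r \<longleftrightarrow> w = [] \<and> row a u r" for r
        using w w' assms(1) by (cases w) (auto simp: mult_plactic row_P sorted_append)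
      then have "G (row a # s # ss) (v \<cdot> u) us = (of_bool (w = []) * G (row a # s # ss) u us :: 'r)"
        by (auto simp add: G_def Cons)
      then show ?thesis
        using module_diff_G_None[of "row a" v s ss u us] False one by (simp add: Cons)
    qed
  qed
qed

lemma row_supported_col_Cons:
  assumes "row_cocycle TYPE('r::comm_ring_1) (row x # ss)"
  shows "row_supported TYPE('r) x (col # row x # ss)"
  unfolding row_supported_def
proof (intro allI impI)
  fix w u us assume w: "w \<in> lists A" and u: "u \<in> carrier M" and us: "set us \<subseteq> carrier M"
  obtain w' where w': "w' \<in> lists A" "u = P w'" using u by (auto simp: carrier_plactic)
  show "module_diff M eps0 (G (col # row x # ss) :: _ \<Rightarrow> _ \<Rightarrow> 'r) (P w) (u # us)
      = of_bool (sorted (x # w)) * G (col # row x # ss) (P w \<cdot> u) us"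
  proof (cases us)
    case Nil
    then show ?thesis by (simp add: G_def)
  next
    case (Cons a as)
    obtain w'' where a: "a = P w''" "w'' \<in> lists A" "set as \<subseteq> carrier M" "a \<in> carrier M"
      using us Cons by (auto simp: carrier_plactic)
    show ?thesis
    proof (cases "\<exists>r. col (P w) r")
      case True
      then obtain t where t: "set t \<subseteq> {y, z}" "P w = P (z # y # t)" by (auto simp: col_def)
      have col: "col (P w) r \<longleftrightarrow> r = P t" for r using t col_zy by simp
      have tl: "t \<in> lists A" using t yz_lists by blast
      have d: "module_diff M eps0 (G (col # row x # ss) :: _ \<Rightarrow> _ \<Rightarrow> 'r) (P w) (u # us)
        = G (col # row x # ss) (P w \<cdot> u) us - module_diff M eps0 (G (row x # ss)) (P t \<cdot> u) us"
        using module_diff_G_Some[where s = col and v = "P w", OF iffD2[OF col refl] iffD1[OF col]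
            plactic_class_in_carrier[OF tl] u us, of "row x" ss]
        by (simp add: Cons)
      have "\<not> sorted (x # w)"
      proof
        assume "sorted (x # w)"
        then have "z # y # t = w"
          using P_sorted_eq[of "z # y # t" w] t tl w letters by simp
        then show False using \<open>sorted (x # w)\<close> yz by auto
      qed
      moreover have "module_diff M eps0 (G (row x # ss) :: _ \<Rightarrow> _ \<Rightarrow> 'r) (P t \<cdot> u) us
          = of_bool (t @ w' = []) * G (row x # ss) a as"
        using assms tl w' a unfolding row_cocycle_def Cons
        by (simp add: mult_plactic plactic_class_in_carrier one_plactic plactic_class_Nil_iff del: module_diff.simps)
      moreover have "peels M (col # row x # ss) (P w \<cdot> u) (a # as)
          \<longleftrightarrow> t @ w' = [] \<and> peels M (row x # ss) a as"
      proof -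
        have zyt: "P w \<cdot> u = P (z # y # t @ w')"
          using t tl w' letters by (simp add: mult_plactic)
        show ?thesis
        proof (cases "set w' \<subseteq> {y, z}")
          case True
          then have c: "col (P w \<cdot> u) r \<longleftrightarrow> r = P (t @ w')" for r
            using zyt t col_zy[of "t @ w'"] by simp
          show ?thesis
          proof (cases "t @ w' = []")
            case True
            then show ?thesis using c a by (simp add: mult_plactic)
          next
            case False
            then obtain b s where b: "t @ w' = b # s" "b \<in> {y, z}"
              using True t by (cases "t @ w'") (auto simp: append_eq_Cons_conv)
            have l: "b # s \<in> lists A" using tl w' by (simp flip: b(1))
            then have "P (t @ w') \<cdot> a = P (b # s @ w'')"
              using mult_plactic[OF l a(2)] by (simp only: b(1) a(1) append_Cons)
            moreover have "x \<noteq> b" using b(2) xy yz by auto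
            ultimately have "\<not> row x (P (t @ w') \<cdot> a) r" for r
              using l a(2) letters by (simp add: row_P)
            then have "\<not> peels M (row x # ss) (P (t @ w') \<cdot> a) as"
              using peels_nonempty[of M "row x" ss] by auto
            then show ?thesis using False by (auto simp: c)
          qed
        next
          case False
          then have "\<not> col (P w \<cdot> u) r" for r
            using zyt col_set[of "z # y # t @ w'" r] tl w' letters by auto
          then show ?thesis using False by auto
        qed
      qed
      ultimately show ?thesis
        using d unfolding Cons by (simp only: G_def of_bool_conj of_bool_eq(1) mult_zero_left diff_self)
    next
      case False
      have sorted: "\<exists>r. col (P w \<cdot> u) r \<Longrightarrow> sorted (x # w)"
        using False col_or_sorted[of w] col_set[of "w @ w'"] w w' by (auto simp: mult_plactic)
      have "G (col # row x # ss) (P w \<cdot> u) us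
          = (of_bool (sorted (x # w)) * G (col # row x # ss) (P w \<cdot> u) us :: 'r)"
      proof (cases "sorted (x # w)")
        case False
        then have "\<not> peels M (col # row x # ss) (P w \<cdot> u) us"
          using sorted peels_nonempty[of M col "row x # ss" "P w \<cdot> u" us] by blast
        then show ?thesis by (simp only: G_def of_bool_eq mult_zero_right)
      next
        case True
        then show ?thesis by (simp only: of_bool_eq mult_1)
      qed
      then show ?thesis
        using module_diff_G_None[of col "P w" "row x" ss u us] False by (simp add: Cons)
    qed
  qed
qed

definition pattern :: "nat \<Rightarrow> ('a list set \<Rightarrow> 'a list set \<Rightarrow> bool) list" where
  "pattern m = concat (replicate m [row x, col])"

lemma pattern_Suc: "pattern (Suc m) = row x # col # pattern m"
  by (simp add: pattern_def)

lemma length_pattern: "length (pattern m) = 2 * m"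
  by (induction m) (auto simp: pattern_def)

lemma row_supported_pattern: "row_supported TYPE('r::comm_ring_1) x (col # pattern m)"
proof (induction m)
  case 0
  then show ?case by (simp add: pattern_def row_supported_col)
next
  case (Suc m)
  then show ?case by (simp add: pattern_Suc row_supported_col_Cons row_cocycle_Cons letters)
qed

lemma row_cocycle_pattern: "row_cocycle TYPE('r::comm_ring_1) (pattern (Suc m))"
  by (simp add: pattern_Suc row_cocycle_Cons row_supported_pattern letters)

lemma row_cocycle_single: "row_cocycle TYPE('r::comm_ring_1) [row y]"
  unfolding row_cocycle_def
proof (intro allI impI)
  fix v u us assume v: "v \<in> carrier M" and u: "u \<in> carrier M" and us: "set us \<subseteq> carrier M"
  obtain w where w: "w \<in> lists A" "v = P w" using v by (auto simp: carrier_plactic)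
  obtain w' where w': "w' \<in> lists A" "u = P w'" using u by (auto simp: carrier_plactic)
  show "module_diff M eps0 (G [row y] :: _ \<Rightarrow> _ \<Rightarrow> 'r) v (u # us) = of_bool (v = \<one>\<^bsub>M\<^esub>) * G [row y] u us"
  proof (cases us)
    case Nil
    have r: "row y (P t) (P []) \<longleftrightarrow> t = [y]" if tl: "t \<in> lists A" for t
    proof
      assume "row y (P t) (P [])"
      then obtain v where v: "t = y # v" "P [] = P v" using tl letters by (auto simp: row_P)
      then show "t = [y]" using plactic_class_Nil_iff[of v A] tl by simp
    qed (use letters in \<open>simp add: row_P\<close>)
    have "w @ w' = [y] \<longleftrightarrow> w = [] \<and> w' = [y] \<or> w = [y] \<and> w' = []"
      by (auto simp: append_eq_Cons_conv)
    then show ?thesis using w w'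
      by (auto simp: Nil G_def mult_plactic eps0_P one_plactic r plactic_class_Nil_iff)
  next
    case (Cons a as)
    then show ?thesis by (simp add: G_def module_diff_zero)
  qed
qed

lemma row_supported_row_Cons:
  assumes "row_cocycle TYPE('r::comm_ring_1) (row x # ss)"
  shows "row_supported TYPE('r) y (row x # ss)"
  unfolding row_supported_def
proof (intro allI impI)
  fix w u us assume w: "w \<in> lists A" and u: "u \<in> carrier M" and us: "set us \<subseteq> carrier M"
  obtain w' where w': "w' \<in> lists A" "u = P w'" using u by (auto simp: carrier_plactic)
  have d: "module_diff M eps0 (G (row x # ss) :: _ \<Rightarrow> _ \<Rightarrow> 'r) (P w) (u # us)
      = of_bool (w = []) * G (row x # ss) u us"
    using assms w u us unfolding row_cocycle_def
    by (simp add: plactic_class_in_carrier one_plactic plactic_class_Nil_iff del: module_diff.simps)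
  show "module_diff M eps0 (G (row x # ss) :: _ \<Rightarrow> _ \<Rightarrow> 'r) (P w) (u # us)
      = of_bool (sorted (y # w)) * G (row x # ss) (P w \<cdot> u) us"
  proof (cases w)
    case Nil
    then show ?thesis using d w' by (simp add: mult_plactic del: module_diff.simps)
  next
    case (Cons b t)
    have "\<not> row x (P w \<cdot> u) r" if "sorted (y # w)" for r
      using that w w' letters xy by (auto simp: Cons mult_plactic row_P)
    then have "sorted (y # w) \<Longrightarrow> \<not> peels M (row x # ss) (P w \<cdot> u) us"
      using peels_nonempty[of M "row x" ss] by blast
    then show ?thesis using d by (auto simp: Cons G_def simp del: module_diff.simps)
  qed
qed

lemma row_cocycle_y_pattern: "row_cocycle TYPE('r::comm_ring_1) (row y # pattern m)"
proof (cases m)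
  case 0
  then show ?thesis by (simp add: pattern_def row_cocycle_single)
next
  case (Suc n)
  have "row_supported TYPE('r) y (row x # col # pattern n)"
    using row_cocycle_pattern[of n] unfolding pattern_Suc by (rule row_supported_row_Cons)
  then show ?thesis unfolding Suc pattern_Suc by (rule row_cocycle_Cons[OF letters(2)])
qed

definition G_cochain :: "('a list set \<Rightarrow> 'a list set \<Rightarrow> bool) list \<Rightarrow> 'a list set list \<Rightarrow> 'r::comm_ring_1" where
  "G_cochain ss xs = (if xs \<in> tuples (carrier M) (length ss) then G ss (hd xs) (tl xs) else 0)"

lemma G_cochain_cocycle:
  assumes "row_cocycle TYPE('r::comm_ring_1) ss" "ss \<noteq> []"
  shows "(G_cochain ss :: _ \<Rightarrow> 'r) \<in> plactic_cocycles A (length ss)"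
proof -
  interpret monoid M by (rule monoid_plactic)
  have "hoch_diff M eps0 (length ss) (G_cochain ss :: _ \<Rightarrow> 'r) xs = 0" for xs
  proof (cases "xs \<in> tuples (carrier M) (Suc (length ss))")
    case True
    then obtain v u us where xs: "xs = v # u # us"
      using assms(2) by (cases xs; cases "tl xs") (auto simp: tuples_def)
    have vu: "v \<in> carrier M" "u \<in> carrier M" "set us \<subseteq> carrier M" "length us = length ss - 1"
      using True by (auto simp: xs tuples_def)
    have "module_diff M eps0 (\<lambda>v zs. G_cochain ss (v # zs) :: 'r) v (u # us) = module_diff M eps0 (G ss) v (u # us)"
      by (rule module_diff_cong[where N = "carrier M" and n = "length ss - 1"])
        (use vu assms(2) in \<open>auto simp: tuples_def G_cochain_def\<close>)
    then show ?thesis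
      using True assms vu unfolding row_cocycle_def
      by (simp add: xs hoch_diff_Cons del: module_diff.simps)
        (auto simp: G_cochain_def tuples_def eps0_one eps0_nonunit)
  qed (simp add: hoch_diff_outside)
  then show ?thesis
    by (auto simp: cocycles_def hoch_cochains_def G_cochain_def fun_eq_iff)
qed

end

text \<open>The sum of the inner faces of the bar differential.\<close>

fun merge_diff :: "('m, 'b) monoid_scheme \<Rightarrow> ('m list \<Rightarrow> 'r::comm_ring_1) \<Rightarrow> 'm list \<Rightarrow> 'r" where
  "merge_diff M f (x # y # ys) = - f ((x \<otimes>\<^bsub>M\<^esub> y) # ys) - merge_diff M (\<lambda>zs. f (x # zs)) (y # ys)"
| "merge_diff M f _ = 0"

lemma module_diff_merge_diff:
  assumes "\<forall>y\<in>set ys. chi y = 0" "ys \<noteq> []"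
  shows "module_diff M chi (\<lambda>v zs. f (v # zs)) x ys = - merge_diff M f (x # ys)"
  using assms
proof (induction ys arbitrary: f x)
  case (Cons y ys)
  then show ?case using Cons.IH[of "\<lambda>zs. f (x # zs)" y] by (cases ys) simp_all
qed simp

lemma hoch_diff_merge_diff:
  assumes "xs \<in> tuples (carrier M) (Suc k)" "\<forall>x\<in>set xs. chi x = 0"
  shows "hoch_diff M chi k f xs = merge_diff M f xs"
proof -
  obtain x ys where xs: "xs = x # ys" using assms by (cases xs) (auto simp: tuples_def)
  show ?thesis
  proof (cases ys)
    case Nil
    then have "k = 0" using assms by (simp add: xs tuples_def)
    then show ?thesis by (simp add: xs Nil hoch_diff_0)
  next
    case (Cons y zs)
    then show ?thesis
      using assms module_diff_merge_diff[of ys chi M f x] by (simp add: xs hoch_diff_Cons del: module_diff.simps merge_diff.simps)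
  qed
qed

context three_letters
begin

text \<open>The cycles pairing with these cocycles, as functionals on cochains: they are the images in the
  bar complex of the critical tuples \<open>32, 1, 32, 1, \<dots>\<close> and \<open>2, 1, 32, 1, 32, \<dots>\<close>.\<close>

fun cyc_col :: "nat \<Rightarrow> ('a list set list \<Rightarrow> 'r::comm_ring_1) \<Rightarrow> 'r"
  and cyc_y :: "nat \<Rightarrow> ('a list set list \<Rightarrow> 'r) \<Rightarrow> 'r" where
  "cyc_col 0 f = f [P [z, y]]"
| "cyc_y 0 f = f [P [y]]"
| "cyc_col (Suc m) f =
     cyc_col m (\<lambda>us. f (P [z, y] # P [x] # us)) - cyc_y m (\<lambda>us. f (P [z, y] # P [z, x] # us))
     + cyc_y m (\<lambda>us. f (P [z, y, x] # P [z] # us))"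
| "cyc_y (Suc m) f =
     cyc_col m (\<lambda>us. f (P [y] # P [x] # us)) - cyc_y m (\<lambda>us. f (P [y] # P [z, x] # us))
     + cyc_y m (\<lambda>us. f (P [y, x] # P [z] # us))"

definition cyc_row :: "nat \<Rightarrow> ('a list set list \<Rightarrow> 'r::comm_ring_1) \<Rightarrow> 'r" where
  "cyc_row m f = cyc_col m (\<lambda>us. f (P [x] # us)) - cyc_y m (\<lambda>us. f (P [z, x] # us))"

lemma cyc_Suc:
  "cyc_col (Suc m) f = cyc_row m (\<lambda>us. f (P [z, y] # us)) + cyc_y m (\<lambda>us. f (P [z, y, x] # P [z] # us))"
  "cyc_y (Suc m) f = cyc_row m (\<lambda>us. f (P [y] # us)) + cyc_y m (\<lambda>us. f (P [y, x] # P [z] # us))"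
  by (simp_all add: cyc_row_def)

lemma cyc_diff:
  "cyc_col m (\<lambda>us. f us - g us) = cyc_col m f - cyc_col m g"
  "cyc_y m (\<lambda>us. f us - g us) = cyc_y m f - cyc_y m g"
  by (induction m arbitrary: f g) simp_all

lemma cyc_neg:
  "cyc_col m (\<lambda>us. - f us) = - cyc_col m f" "cyc_y m (\<lambda>us. - f us) = - cyc_y m f"
proof -
  have zero: "cyc_col m (\<lambda>us. 0) = 0" "cyc_y m (\<lambda>us. 0) = 0"
    using cyc_diff[of m "\<lambda>_. 0" "\<lambda>_. 0"] by simp_all
  show "cyc_col m (\<lambda>us. - f us) = - cyc_col m f" "cyc_y m (\<lambda>us. - f us) = - cyc_y m f"
    using cyc_diff[of m "\<lambda>_. 0" f] by (simp_all add: zero)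
qed

abbreviation "nonunits \<equiv> P ` (lists A - {[]})"

lemma nonunits_P: "u \<in> lists A \<Longrightarrow> u \<noteq> [] \<Longrightarrow> P u \<in> nonunits"
  by auto

lemma cyc_cong:
  "(\<And>us. us \<in> tuples nonunits (Suc (2 * m)) \<Longrightarrow> f us = g us) \<Longrightarrow> cyc_col m f = cyc_col m g"
  "(\<And>us. us \<in> tuples nonunits (Suc (2 * m)) \<Longrightarrow> f us = g us) \<Longrightarrow> cyc_y m f = cyc_y m g"
proof (induction m arbitrary: f g)
  case 0
  { case 1
    then show ?case using letters by (simp add: mem_tuples_Cons nonunits_P tuples_def)
  next
    case 2
    then show ?case using letters by (simp add: mem_tuples_Cons nonunits_P tuples_def)
  }
next
  case (Suc m)
  have *: "f (P u # P v # us) = g (P u # P v # us)"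
    if "\<And>us. us \<in> tuples nonunits (Suc (2 * Suc m)) \<Longrightarrow> f us = g us" "us \<in> tuples nonunits (Suc (2 * m))"
      "set u \<subseteq> {x, y, z}" "set v \<subseteq> {x, y, z}" "u \<noteq> []" "v \<noteq> []" for f g :: "_ \<Rightarrow> 'b" and u v us
    using that letters by (intro that(1)) (auto simp: mem_tuples_Cons lists_eq_set)
  { case 1
    show ?case unfolding cyc_col.simps
      by (intro arg_cong2[of _ _ _ _ "(+)"] arg_cong2[of _ _ _ _ "(-)"] Suc.IH) (rule *[OF 1], simp_all)+
  next
    case 2
    show ?case unfolding cyc_y.simps
      by (intro arg_cong2[of _ _ _ _ "(+)"] arg_cong2[of _ _ _ _ "(-)"] Suc.IH) (rule *[OF 2], simp_all)+
  }
qed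

definition act_hd :: "'a list set \<Rightarrow> ('a list set list \<Rightarrow> 'r) \<Rightarrow> 'a list set list \<Rightarrow> 'r" where
  "act_hd v f us = f ((v \<cdot> hd us) # tl us)"

lemma act_hd_Cons: "act_hd v f (u # us) = f ((v \<cdot> u) # us)"
  by (simp add: act_hd_def)

lemma cyc_merge_Cons:
  "cyc_col m (\<lambda>us. merge_diff M f (v # us))
     = - cyc_col m (act_hd v f) - cyc_col m (merge_diff M (\<lambda>us. f (v # us)))"
  "cyc_y m (\<lambda>us. merge_diff M f (v # us))
     = - cyc_y m (act_hd v f) - cyc_y m (merge_diff M (\<lambda>us. f (v # us)))"
proof -
  have *: "merge_diff M f (v # us) = - act_hd v f us - merge_diff M (\<lambda>us. f (v # us)) us"
    if "us \<in> tuples nonunits (Suc (2 * m))" for us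
    using that by (cases us) (simp_all add: tuples_def act_hd_def)
  have "cyc_col m (\<lambda>us. merge_diff M f (v # us))
      = cyc_col m (\<lambda>us. - act_hd v f us - merge_diff M (\<lambda>us. f (v # us)) us)"
    "cyc_y m (\<lambda>us. merge_diff M f (v # us))
      = cyc_y m (\<lambda>us. - act_hd v f us - merge_diff M (\<lambda>us. f (v # us)) us)"
    by (rule cyc_cong; rule *; assumption)+
  then show "cyc_col m (\<lambda>us. merge_diff M f (v # us))
     = - cyc_col m (act_hd v f) - cyc_col m (merge_diff M (\<lambda>us. f (v # us)))"
  "cyc_y m (\<lambda>us. merge_diff M f (v # us))
     = - cyc_y m (act_hd v f) - cyc_y m (merge_diff M (\<lambda>us. f (v # us)))"
    by (simp_all add: cyc_diff cyc_neg)
qed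

lemma P_mult:
  "set u \<subseteq> {x, y, z} \<Longrightarrow> set v \<subseteq> {x, y, z} \<Longrightarrow> P u \<cdot> P v = P (u @ v)"
  using letters by (intro mult_plactic) (auto simp: lists_eq_set)

lemma knuth_relations:
  "P [x, z, y] = P [z, x, y]" "P [x, z, y, x] = P [z, x, y, x]"
  "P [y, z, x] = P [y, x, z]" "P [z, y, z, x] = P [z, y, x, z]"
proof -
  have 1: "([x, z, y], [z, x, y]) \<in> knuth_cong A"
    using knuth_step.intros(1)[of "[]" x y z "[]" A] letters xy yz by (intro knuth_cong_step) auto
  have 2: "([y, x, z], [y, z, x]) \<in> knuth_cong A"
    using knuth_step.intros(2)[of "[]" x y z "[]" A] letters xy yz by (intro knuth_cong_step) auto
  show "P [x, z, y] = P [z, x, y]" "P [x, z, y, x] = P [z, x, y, x]"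
    "P [y, z, x] = P [y, x, z]" "P [z, y, z, x] = P [z, y, x, z]"
    using 1 knuth_cong_context[OF 1, of "[]" "[x]"] knuth_cong_sym[OF 2]
      knuth_cong_context[OF knuth_cong_sym[OF 2], of "[z]" "[]"] letters
    by (simp_all add: plactic_class_eq_iff)
qed

lemma cyc_act:
  "cyc_col m (act_hd (P [x]) f) = cyc_y m (act_hd (P [z, x]) f)"
  "cyc_y m (act_hd (P [z]) f) = cyc_col m f"
  by (cases m; simp add: act_hd_Cons P_mult knuth_relations)+

lemma cyc_row_act:
  "set v \<subseteq> {x, y, z} \<Longrightarrow> cyc_row m (act_hd (P v) f)
     = cyc_col m (\<lambda>us. f (P (v @ [x]) # us)) - cyc_y m (\<lambda>us. f (P (v @ [z, x]) # us))"
  by (simp add: cyc_row_def act_hd_Cons P_mult)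

lemma cyc_row_merge_Cons:
  "cyc_row m (\<lambda>us. merge_diff M f (v # us))
     = - cyc_row m (act_hd v f) - cyc_row m (merge_diff M (\<lambda>us. f (v # us)))"
proof -
  have "(\<lambda>us. merge_diff M f (v # u # us)) =
      (\<lambda>us. - act_hd v f (u # us) - merge_diff M (\<lambda>us. f (v # us)) (u # us))" for u
    by (simp add: act_hd_Cons)
  then show ?thesis by (simp only: cyc_row_def cyc_diff cyc_neg) (simp add: algebra_simps)
qed

lemma cyc_y_z_merge:
  assumes "\<And>f. cyc_y m (merge_diff M f) = (0 :: 'r::comm_ring_1)"
  shows "cyc_y m (\<lambda>us. merge_diff M f (v # P [z] # us))
    = - cyc_y m (\<lambda>us. f ((v \<cdot> P [z]) # us)) + (cyc_col m (\<lambda>us. f (v # us)) :: 'r)"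
proof -
  have "(\<lambda>us. merge_diff M f (v # P [z] # us))
      = (\<lambda>us. - f ((v \<cdot> P [z]) # us) - merge_diff M (\<lambda>us. f (v # us)) (P [z] # us))"
    by simp
  then show ?thesis
    by (simp only: cyc_diff cyc_neg cyc_merge_Cons cyc_act assms) simp
qed

lemma cyc_merge:
  "cyc_col m (merge_diff M f) = 0" "cyc_y m (merge_diff M f) = 0"
proof (induction m arbitrary: f)
  case 0
  { case 1 show ?case by simp
  next case 2 show ?case by simp }
next
  case (Suc m)
  have row: "cyc_row m (merge_diff M f) = 0" for f :: "_ \<Rightarrow> 'b"
    by (simp add: cyc_row_def cyc_merge_Cons Suc.IH cyc_act)
  { case 1
    show ?case
      by (simp only: cyc_Suc cyc_row_merge_Cons row cyc_y_z_merge[OF Suc.IH(2)])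
        (simp add: cyc_row_act P_mult knuth_relations)
  next
    case 2
    show ?case
      by (simp only: cyc_Suc cyc_row_merge_Cons row cyc_y_z_merge[OF Suc.IH(2)])
        (simp add: cyc_row_act P_mult knuth_relations)
  }
qed

lemma cyc_row_merge: "cyc_row m (merge_diff M f) = 0"
  by (simp add: cyc_row_def cyc_merge_Cons cyc_merge cyc_act)

lemma peels_P:
  "peels M (row a # s # ss) (P [a]) (P u # us) \<longleftrightarrow> peels M (s # ss) (P u) us" if "a \<in> A" "u \<in> lists A"
proof -
  have "row a (P [a]) r \<longleftrightarrow> r = P []" for r using that by (simp add: row_P)
  then show ?thesis using that by (simp add: mult_plactic)
qed

lemma not_row: "\<not> peels M (row a # ss) (P (b # w)) us" if "a \<in> A" "b # w \<in> lists A" "a \<noteq> b \<or> \<not> sorted (b # w)"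
  using peels_nonempty[of M "row a" ss "P (b # w)" us] that by (auto simp: row_P)

lemma peels_col:
  "peels M (col # s # ss) (P [z, y]) (P u # us) \<longleftrightarrow> peels M (s # ss) (P u) us" if "u \<in> lists A"
  using that col_zy[of "[]"] by (simp add: mult_plactic)

lemma not_col: "\<not> peels M (col # ss) (P [z, y, x]) us"
proof
  assume "peels M (col # ss) (P [z, y, x]) us"
  from peels_nonempty[OF this] obtain r where "col (P [z, y, x]) r" ..
  then show False using col_set[of "[z, y, x]" r] letters xy yz by auto
qed

lemma cyc_row_G:
  assumes "cyc_col m (\<lambda>us. G (col # ss) (hd us) (tl us)) = (1 :: 'r::comm_ring_1)"
  shows "cyc_row m (\<lambda>us. G (row x # col # ss) (hd us) (tl us)) = (1 :: 'r)"
proof -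
  have "cyc_col m (\<lambda>us. G (row x # col # ss) (P [x]) us) = cyc_col m (\<lambda>us. G (col # ss) (hd us) (tl us) :: 'r)"
  proof (rule cyc_cong)
    fix us :: "'a list set list" assume "us \<in> tuples nonunits (Suc (2 * m))"
    then show "G (row x # col # ss) (P [x]) us = (G (col # ss) (hd us) (tl us) :: 'r)"
      using letters by (cases us) (auto simp: G_def peels_P tuples_def simp del: peels.simps)
  qed
  moreover have "G (row x # col # ss) (P [z, x]) = (\<lambda>us. 0 :: 'r)"
    using not_row[of x z "[x]" "col # ss"] letters xy yz by (simp add: G_def fun_eq_iff)
  ultimately show ?thesis
    using assms cyc_neg(2)[of m "\<lambda>_. 0 :: 'r"] cyc_diff(2)[of m "\<lambda>_. 0 :: 'r" "\<lambda>_. 0"] by (simp add: cyc_row_def)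
qed

lemma cyc_col_G: "cyc_col m (\<lambda>us. G (col # pattern m) (hd us) (tl us)) = (1 :: 'r::comm_ring_1)"
proof (induction m)
  case 0
  then show ?case using col_zy[of "[]" "P []"] by (simp add: pattern_def G_def one_plactic)
next
  case (Suc m)
  have "(G (col # pattern (Suc m)) (P [z, y]) (u # us) :: 'r) = G (pattern (Suc m)) u us"
    if "u = P [x] \<or> u = P [z, x]" for u us
    using that letters by (auto simp: G_def pattern_Suc peels_col simp del: peels.simps)
  then have "cyc_row m (\<lambda>us. G (col # pattern (Suc m)) (P [z, y]) us)
      = cyc_row m (\<lambda>us. G (pattern (Suc m)) (hd us) (tl us) :: 'r)"
    by (simp add: cyc_row_def)
  moreover have "\<dots> = 1" using cyc_row_G[OF Suc] by (simp add: pattern_Suc)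
  moreover have "G (col # pattern (Suc m)) (P [z, y, x]) = (\<lambda>us. 0 :: 'r)"
    by (simp add: G_def fun_eq_iff not_col)
  ultimately show ?case
    using cyc_diff(2)[of m "\<lambda>_. 0 :: 'r" "\<lambda>_. 0"] by (simp only: cyc_Suc) simp
qed

lemma cyc_row_pattern: "cyc_row m (\<lambda>us. G (pattern (Suc m)) (hd us) (tl us)) = (1 :: 'r::comm_ring_1)"
  using cyc_row_G[OF cyc_col_G] by (simp add: pattern_Suc)

lemma cyc_y_pattern: "cyc_y m (\<lambda>us. G (row y # pattern m) (hd us) (tl us)) = (1 :: 'r::comm_ring_1)"
proof (cases m)
  case 0
  then show ?thesis using letters by (simp add: pattern_def G_def one_plactic row_P)
next
  case (Suc n)
  have "(G (row y # pattern (Suc n)) (P [y]) (u # us) :: 'r) = G (pattern (Suc n)) u us"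
    if "u = P [x] \<or> u = P [z, x]" for u us
    using that letters by (auto simp: G_def pattern_Suc peels_P simp del: peels.simps)
  then have "cyc_row n (\<lambda>us. G (row y # pattern (Suc n)) (P [y]) us)
      = cyc_row n (\<lambda>us. G (pattern (Suc n)) (hd us) (tl us) :: 'r)"
    by (simp add: cyc_row_def)
  moreover have "G (row y # pattern (Suc n)) (P [y, x]) = (\<lambda>us. 0 :: 'r)"
    using not_row[of y y "[x]"] letters xy by (simp add: G_def fun_eq_iff)
  ultimately show ?thesis
    using cyc_diff(2)[of n "\<lambda>_. 0 :: 'r" "\<lambda>_. 0"] by (simp only: Suc cyc_Suc cyc_row_pattern) simp
qed

lemma nonunits_tuples:
  assumes "us \<in> tuples nonunits k"
  shows "us \<in> tuples (carrier M) k \<and> (\<forall>u\<in>set us. eps0 u = 0)"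
proof -
  have "u \<in> carrier M \<and> eps0 u = 0" if "u \<in> nonunits" for u
    using that by (auto simp: plactic_class_in_carrier eps0_plactic_class)
  then show ?thesis using assms unfolding tuples_def by blast
qed

lemma nonzero_class:
  assumes k: "0 < k"
  shows "\<exists>f :: 'a list set list \<Rightarrow> 'r::comm_ring_1. f \<in> plactic_cocycles A k \<and> f \<notin> plactic_coboundaries A k"
proof -
  have len: "length (row y # pattern m) = Suc (2 * m)" for m by (simp add: length_pattern)
  show ?thesis
  proof (cases "even k")
    case True
    then obtain n where "k = 2 * n" by (rule evenE)
    then obtain m where m: "k = 2 * Suc m" using k by (cases n) auto
    let ?f = "G_cochain (pattern (Suc m)) :: _ \<Rightarrow> 'r"
    have "?f \<in> plactic_cocycles A k"
      using G_cochain_cocycle[OF row_cocycle_pattern[of m]] by (simp add: m length_pattern) (simp add: pattern_Suc)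
    moreover have "?f \<notin> plactic_coboundaries A k"
    proof
      assume "?f \<in> plactic_coboundaries A k"
      then obtain g where g: "?f = hoch_diff M eps0 (Suc (2 * m)) g" by (auto simp: m coboundaries_def)
      have "cyc_row m (\<lambda>us. G (pattern (Suc m)) (hd us) (tl us)) = cyc_row m (merge_diff M g)"
        unfolding cyc_row_def
      proof (intro arg_cong2[of _ _ _ _ "(-)"] cyc_cong)
        fix us assume us: "us \<in> tuples nonunits (Suc (2 * m))"
        have "G (pattern (Suc m)) (hd (P u # us)) (tl (P u # us)) = merge_diff M g (P u # us)"
          if "u \<in> lists A" "u \<noteq> []" for u
        proof -
          have "P u # us \<in> tuples nonunits (Suc (Suc (2 * m)))" using us that by (auto simp: mem_tuples_Cons)
          then have t: "P u # us \<in> tuples (carrier M) (Suc (Suc (2 * m)))" "\<forall>v\<in>set (P u # us). eps0 v = (0 :: 'r)"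
            using nonunits_tuples by blast+
          then have "?f (P u # us) = merge_diff M g (P u # us)"
            using hoch_diff_merge_diff[OF t, of g] by (simp add: g)
          then show ?thesis using t(1) by (simp add: G_cochain_def length_pattern)
        qed
        from this[of "[x]"] this[of "[z, x]"]
        show "G (pattern (Suc m)) (hd (P [x] # us)) (tl (P [x] # us)) = merge_diff M g (P [x] # us)"
          "G (pattern (Suc m)) (hd (P [z, x] # us)) (tl (P [z, x] # us)) = merge_diff M g (P [z, x] # us)"
          using letters by simp_all
      qed
      then show False by (simp add: cyc_row_pattern cyc_row_merge)
    qed
    ultimately show ?thesis by blast
  next
    case False
    then obtain m where m: "k = Suc (2 * m)" by (auto elim!: oddE)
    let ?f = "G_cochain (row y # pattern m) :: _ \<Rightarrow> 'r"
    have "?f \<in> plactic_cocycles A k"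
      using G_cochain_cocycle[OF row_cocycle_y_pattern[of m]] by (simp add: m length_pattern)
    moreover have "?f \<notin> plactic_coboundaries A k"
    proof
      assume "?f \<in> plactic_coboundaries A k"
      then obtain g where g: "?f = hoch_diff M eps0 (2 * m) g" by (auto simp: m coboundaries_def)
      have "cyc_y m (\<lambda>us. G (row y # pattern m) (hd us) (tl us)) = cyc_y m (merge_diff M g)"
      proof (rule cyc_cong)
        fix us assume us: "us \<in> tuples nonunits (Suc (2 * m))"
        then have t: "us \<in> tuples (carrier M) (Suc (2 * m))" "\<forall>v\<in>set us. eps0 v = (0 :: 'r)"
          using nonunits_tuples by blast+
        then have "?f us = merge_diff M g us"
          using hoch_diff_merge_diff[OF t, of g] by (simp add: g)
        then show "G (row y # pattern m) (hd us) (tl us) = merge_diff M g us"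
          using t(1) by (simp add: G_cochain_def length_pattern)
      qed
      then show False by (simp add: cyc_y_pattern cyc_merge)
    qed
    ultimately show ?thesis by blast
  qed
qed

end

lemma three_letters_exist:
  fixes A :: "'a::linorder set"
  assumes "\<not> (finite A \<and> card A \<le> 2)"
  obtains x y z where "three_letters A x y z"
proof -
  obtain B where B: "B \<subseteq> A" "card B = 3"
  proof (cases "finite A")
    case True
    then show ?thesis using assms obtain_subset_with_card_n[of 3 A] that by force
  next
    case False
    then show ?thesis using infinite_arbitrarily_large[of A 3] that by blast
  qed
  then obtain a b c where "B = {a, b, c}" "a \<noteq> b" "b \<noteq> c" "a \<noteq> c" by (auto simp: card_3_iff)
  then show ?thesis
    using B(1) that unfolding three_letters_def by (metis insert_subset linorder_neqE)
qed

lemma plactic_cohomology_nonzero: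
  fixes A :: "'a::linorder set"
  assumes "\<not> (finite A \<and> card A \<le> 2)"
  shows "carrier (plactic_cohomology A k :: ('r::comm_ring_1, _) module) \<noteq> {\<zero>\<^bsub>plactic_cohomology A k\<^esub>}"
proof -
  obtain x y z where "three_letters A x y z" using three_letters_exist[OF assms] .
  then interpret three_letters A x y z .
  have "\<exists>f :: 'a list set list \<Rightarrow> 'r. f \<in> plactic_cocycles A k \<and> f \<notin> plactic_coboundaries A k"
  proof (cases k)
    case 0
    have "(\<lambda>xs. if xs = [] then 1 else 0 :: 'r) \<in> plactic_cocycles A 0"
      by (auto simp: cocycles_def hoch_cochains_def hoch_diff_0 tuples_def)
    moreover have "(\<lambda>xs. if xs = [] then 1 else 0 :: 'r) \<notin> plactic_coboundaries A 0"
      by (auto simp: coboundaries_def fun_eq_iff)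
    ultimately show ?thesis unfolding 0 by blast
  qed (use nonzero_class in blast)
  then obtain f :: "'a list set list \<Rightarrow> 'r" where "f \<in> plactic_cocycles A k" "f \<notin> plactic_coboundaries A k"
    by blast
  then show ?thesis
    unfolding plactic_cohomology_eq
    using plactic.cls_in_carrier[of f A k] plactic.cls_eq_zero_iff[of f A k] by blast
qed


section \<open>The plactic monoid of rank two\<close>

lemma free_exact:
  fixes f :: "'m \<Rightarrow> 'm list \<Rightarrow> 'r::comm_ring_1"
  assumes M: "monoid M" and s: "s \<in> carrier M" and inj: "inj_on (\<lambda>u. s \<otimes>\<^bsub>M\<^esub> u) (carrier M)"
    and f: "\<And>xs. xs \<in> tuples (carrier M) (Suc (Suc n)) \<Longrightarrow> module_diff M chi f s xs = 0"
  shows "\<exists>g. \<forall>u\<in>carrier M. \<forall>xs\<in>tuples (carrier M) (Suc n).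
      f (s \<otimes>\<^bsub>M\<^esub> u) xs = module_diff M chi g (s \<otimes>\<^bsub>M\<^esub> u) xs"
proof (intro exI ballI)
  interpret monoid M by (rule M)
  let ?t = "\<lambda>u. s \<otimes>\<^bsub>M\<^esub> u"
  let ?g = "\<lambda>v xs. f s (the_inv_into (carrier M) ?t v # xs)"
  fix u xs assume u: "u \<in> carrier M" and xs: "xs \<in> tuples (carrier M) (Suc n)"
  obtain x ys where x: "xs = x # ys" "x \<in> carrier M"
    using xs by (cases xs) (auto simp: tuples_def)
  have "module_diff M chi f s (u # xs) = f (?t u) xs - module_diff M chi (\<lambda>u zs. f s (u # zs)) u xs"
    by (simp add: x)
  moreover have "module_diff M chi f s (u # xs) = 0"
    using u xs by (intro f) (simp add: mem_tuples_Cons)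
  moreover have "module_diff M chi (\<lambda>u zs. f s (u # zs)) u xs = module_diff M chi (\<lambda>u. ?g (?t u)) u xs"
    by (rule module_diff_cong[where N = "carrier M" and n = n])
      (use u xs inj in \<open>auto simp: the_inv_into_f_f\<close>)
  moreover have "module_diff M chi (\<lambda>u. ?g (?t u)) u xs = module_diff M chi ?g (?t u) xs"
    using M s u xs by (intro module_diff_translate) (auto simp: tuples_def)
  ultimately show "f (?t u) xs = module_diff M chi ?g (?t u) xs" by simp
qed

locale two_letters =
  fixes p q :: "'a::linorder"
  assumes pq: "p < q"
begin

abbreviation "M \<equiv> plactic {p, q}"
abbreviation "P \<equiv> plactic_class {p, q}"
abbreviation "C \<equiv> carrier M"
abbreviation times (infixl \<open>\<cdot>\<close> 70) where "u \<cdot> v \<equiv> u \<otimes>\<^bsub>M\<^esub> v"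
abbreviation "a \<equiv> P [p]"
abbreviation "b \<equiv> P [q]"
abbreviation D :: "('a list set \<Rightarrow> 'a list set list \<Rightarrow> 'r::comm_ring_1) \<Rightarrow> 'a list set \<Rightarrow> 'a list set list \<Rightarrow> 'r" where
  "D \<equiv> module_diff M eps0"

sublocale monoid M by (rule monoid_plactic)

definition coords :: "'a list set \<Rightarrow> nat \<times> nat \<times> nat" where
  "coords v = two_letter_nf p (SOME w. w \<in> v)"

lemma P_in_C [simp]: "set w \<subseteq> {p, q} \<Longrightarrow> P w \<in> C"
  by (intro plactic_class_in_carrier) (auto simp: lists_eq_set)

lemma coords_P: "set w \<subseteq> {p, q} \<Longrightarrow> coords (P w) = two_letter_nf p w"
proof -
  assume w: "set w \<subseteq> {p, q}"
  have "(SOME v. v \<in> P w) \<in> P w"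
    using w knuth_cong_refl[of w "{p, q}"]
    by (intro someI[of "\<lambda>v. v \<in> P w"]) (simp add: mem_plactic_class lists_eq_set)
  then show ?thesis
    using two_letter_nf_cong[OF _ w pq] by (auto simp: coords_def mem_plactic_class)
qed

lemma C_cases: "v \<in> C \<Longrightarrow> \<exists>w. set w \<subseteq> {p, q} \<and> v = P w"
  by (auto simp: carrier_plactic lists_eq_set)

lemma coords_eq_iff: "u \<in> C \<Longrightarrow> v \<in> C \<Longrightarrow> u = v \<longleftrightarrow> coords u = coords v"
proof -
  assume "u \<in> C" "v \<in> C"
  then obtain w w' where "set w \<subseteq> {p, q}" "u = P w" "set w' \<subseteq> {p, q}" "v = P w'"
    using C_cases by blast
  then show ?thesis
    using pq by (simp add: coords_P plactic_class_eq_iff lists_eq_set two_letter_knuth_cong_iff)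
qed

lemma coords_mult_a: "v \<in> C \<Longrightarrow> coords (a \<cdot> v) = push_letter True (coords v)"
  using C_cases[of v] by (auto simp: mult_plactic coords_P lists_eq_set two_letter_nf_Cons)

lemma coords_mult_b: "v \<in> C \<Longrightarrow> coords (b \<cdot> v) = push_letter False (coords v)"
  using C_cases[of v] less_imp_neq[OF pq, THEN not_sym]
  by (auto simp: mult_plactic coords_P lists_eq_set two_letter_nf_Cons)

lemma coords_surj: "\<exists>v\<in>C. coords v = t"
proof -
  have "set (nf_word p q t) \<subseteq> {p, q}" using nf_word_lists[of p "{p, q}" q] by (simp add: lists_eq_set)
  then show ?thesis
    using pq by (intro bexI[of _ "P (nf_word p q t)"]) (auto simp: coords_P two_letter_nf_nf_word)
qed

definition unmatched :: "'a list set \<Rightarrow> nat" where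
  "unmatched v = fst (snd (coords v))"

lemma unmatched_a: "v \<in> C \<Longrightarrow> unmatched (a \<cdot> v) = Suc (unmatched v)"
  by (cases "coords v") (simp add: unmatched_def coords_mult_a)

lemma unmatched_b: "v \<in> C \<Longrightarrow> unmatched (b \<cdot> v) = unmatched v - 1"
  by (cases "coords v"; cases "unmatched v") (simp_all add: unmatched_def coords_mult_b)

lemma unmatched_aE:
  assumes "v \<in> C" "0 < unmatched v"
  obtains u where "u \<in> C" "v = a \<cdot> u"
proof -
  obtain m i j where c: "coords v = (m, Suc i, j)"
    using assms(2) by (cases "coords v") (auto simp: unmatched_def gr0_conv_Suc)
  obtain u where "u \<in> C" "coords u = (m, i, j)" using coords_surj by blast
  then show ?thesis using that[of u] c assms(1) by (simp add: coords_eq_iff coords_mult_a)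
qed

lemma mult_a_inj: "u \<in> C \<Longrightarrow> v \<in> C \<Longrightarrow> a \<cdot> u = a \<cdot> v \<Longrightarrow> u = v"
  by (cases "coords u"; cases "coords v") (simp add: coords_eq_iff coords_mult_a)

lemma relations:
  assumes "u \<in> C"
  shows "b \<cdot> (a \<cdot> (a \<cdot> u)) = a \<cdot> (b \<cdot> (a \<cdot> u))"
    "b \<cdot> (b \<cdot> (a \<cdot> u)) = b \<cdot> (a \<cdot> (b \<cdot> u))"
proof -
  obtain m i j where c: "coords u = (m, i, j)" by (cases "coords u")
  show "b \<cdot> (a \<cdot> (a \<cdot> u)) = a \<cdot> (b \<cdot> (a \<cdot> u))"
    using assms by (simp add: coords_eq_iff coords_mult_a coords_mult_b c)
  show "b \<cdot> (b \<cdot> (a \<cdot> u)) = b \<cdot> (a \<cdot> (b \<cdot> u))"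
    using assms by (cases i) (simp_all add: coords_eq_iff coords_mult_a coords_mult_b c)
qed

lemma ba_inj:
  assumes "u \<in> C" "v \<in> C" "b \<cdot> (a \<cdot> u) = b \<cdot> (a \<cdot> v)"
  shows "u = v"
  using assms by (cases "coords u"; cases "coords v") (simp add: coords_eq_iff coords_mult_a coords_mult_b)

lemma b_cancel:
  assumes u: "u \<in> C" and v: "v \<in> C" and eq: "b \<cdot> u = b \<cdot> v" and "unmatched (b \<cdot> u) = 0"
  shows "u = v \<or> (\<exists>w\<in>C. {u, v} = {b \<cdot> (a \<cdot> w), a \<cdot> (b \<cdot> w)})"
proof -
  obtain m i j where cu: "coords u = (m, i, j)" by (cases "coords u")
  obtain m' i' j' where cv: "coords v = (m', i', j')" by (cases "coords v")
  have i: "unmatched u \<le> 1" "unmatched v \<le> 1"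
    using assms unmatched_b[OF u] unmatched_b[OF v] by auto
  have e: "push_letter False (m, i, j) = push_letter False (m', i', j')"
    using eq coords_mult_b[OF u] coords_mult_b[OF v] cu cv by simp
  have *: "\<exists>w\<in>C. u = b \<cdot> (a \<cdot> w) \<and> v = a \<cdot> (b \<cdot> w)"
    if uv: "u \<in> C" "v \<in> C" "coords u = (Suc n, 0, k)" "coords v = (n, 1, Suc k)" for u v n k
  proof -
    obtain w where w: "w \<in> C" "coords w = (n, 0, k)" using coords_surj by blast
    then show ?thesis
      using uv by (intro bexI[of _ w]) (simp_all add: coords_eq_iff coords_mult_a coords_mult_b)
  qed
  consider "i = 0" "i' = 0" | "i = 1" "i' = 1" | "i = 0" "i' = 1" | "i = 1" "i' = 0"
    using i cu cv by (fastforce simp: unmatched_def)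
  then show ?thesis
  proof cases
    case 3
    then show ?thesis using *[OF u v, of m' j] e cu cv by (auto simp: insert_commute)
  next
    case 4
    then show ?thesis using *[OF v u, of m j'] e cu cv by (auto simp: insert_commute)
  qed (use e cu cv u v in \<open>auto simp: coords_eq_iff\<close>)
qed

lemma nonunit_cases:
  assumes "v \<in> C" "v \<noteq> \<one>\<^bsub>M\<^esub>"
  obtains u where "u \<in> C" "v = a \<cdot> u" | u where "u \<in> C" "v = b \<cdot> u"
proof -
  obtain w where w: "set w \<subseteq> {p, q}" "v = P w" using C_cases assms by blast
  then obtain x w' where "w = x # w'" using assms by (cases w) (auto simp: one_plactic)
  then have "v = P [x] \<cdot> P w'" "P w' \<in> C" "x = p \<or> x = q"
    using w by (auto simp: mult_plactic lists_eq_set)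
  then show ?thesis using that by blast
qed

lemma D_D:
  assumes "v \<in> C" "xs \<in> tuples C (Suc (Suc n))"
  shows "D (D f) v xs = (0 :: 'r::comm_ring_1)"
  using assms by (intro module_diff_module_diff monoid_axioms eps0_mult) (auto simp: tuples_def)

lemma D_sub_D:
  assumes "v \<in> C" "xs \<in> tuples C (Suc (Suc n))"
  shows "D (\<lambda>v xs. f v xs - D g v xs) v xs = (D f v xs :: 'r::comm_ring_1)"
  using D_D[OF assms, of g] by (simp add: module_diff_diff)

lemma D_translate:
  assumes "\<And>x. x \<in> C \<Longrightarrow> j (v \<cdot> x) = j v \<cdot> x" "xs \<in> tuples C (Suc n)"
  shows "D (\<lambda>u. f (j u)) v xs = (D f (j v) xs :: 'r::comm_ring_1)"
proof -
  obtain x ys where "xs = x # ys" "x \<in> C" using assms(2) by (cases xs) (auto simp: tuples_def)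
  then show ?thesis using module_diff_map[where j = j and v = v and x = x] assms(1) by blast
qed

lemma D_cong:
  assumes "\<And>u zs. u \<in> C \<Longrightarrow> zs \<in> tuples C n \<Longrightarrow> f u zs = g u zs" "v \<in> C" "xs \<in> tuples C (Suc n)"
  shows "D f v xs = (D g v xs :: 'r::comm_ring_1)"
  using assms by (intro module_diff_cong[where N = C and n = n]) auto

lemma D_ideal_zero:
  assumes s: "s \<in> C" and z: "\<And>u zs. u \<in> C \<Longrightarrow> zs \<in> tuples C n \<Longrightarrow> f (s \<cdot> u) zs = 0"
    and "v \<in> C" "xs \<in> tuples C (Suc n)"
  shows "D f (s \<cdot> v) xs = (0 :: 'r::comm_ring_1)"
proof -
  have "D f (s \<cdot> v) xs = D (\<lambda>u. f (s \<cdot> u)) v xs"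
    using assms by (intro D_translate[symmetric]) (auto simp: m_assoc)
  also have "\<dots> = D (\<lambda>u zs. 0) v xs" using assms by (intro D_cong) auto
  finally show ?thesis by (simp add: module_diff_zero)
qed

lemma D_Cons:
  "xs \<in> tuples C (Suc n) \<Longrightarrow> D f s (u # xs) = f (s \<cdot> u) xs - (D (\<lambda>u zs. f s (u # zs)) u xs :: 'r::comm_ring_1)"
  by (cases xs) (auto simp: tuples_def)

text \<open>A cocycle on the augmentation ideal is killed in the following steps: first on the free right ideal \<open>a M\<close>;
  then, as a cochain \<open>h\<close> on \<open>M\<close> pulled back along \<open>u \<mapsto> b u\<close>, on the free ideal \<open>a a M\<close>; and finally by making
  \<open>h\<close> compatible with the relation \<open>b b a = b a b\<close>, where \<open>e w = h (b a w) - h (a b w)\<close> is a cocycle of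
  \<open>M / a M\<close>. In lowest degree the single obstruction is the hypothesis \<open>obst\<close>.\<close>

lemma augmentation_exact:
  fixes f :: "'a list set \<Rightarrow> 'a list set list \<Rightarrow> 'r::comm_ring_1"
  assumes f: "\<And>v xs. v \<in> C \<Longrightarrow> v \<noteq> \<one>\<^bsub>M\<^esub> \<Longrightarrow> xs \<in> tuples C (Suc (Suc (Suc n))) \<Longrightarrow> D f v xs = 0"
    and obst: "n = 0 \<Longrightarrow> f b [P [q, p], a] = f b [P [p, q], a]"
  obtains g where "\<And>v xs. v \<in> C \<Longrightarrow> v \<noteq> \<one>\<^bsub>M\<^esub> \<Longrightarrow> xs \<in> tuples C (Suc (Suc n)) \<Longrightarrow> f v xs = D g v xs"
proof -
  have ab: "a \<in> C" "b \<in> C" "P [q, p] \<in> C" "P [p, q] \<in> C" by auto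
  have b1: "b \<noteq> \<one>\<^bsub>M\<^esub>" "a \<noteq> \<one>\<^bsub>M\<^esub>" by (simp_all add: one_plactic plactic_class_Nil_iff)
  have inj_a: "inj_on (\<lambda>u. a \<cdot> u) C" by (rule inj_onI) (rule mult_a_inj)
  have inj_aa: "inj_on (\<lambda>u. (a \<cdot> a) \<cdot> u) C"
  proof (rule inj_onI)
    fix u v assume uv: "u \<in> C" "v \<in> C" "(a \<cdot> a) \<cdot> u = (a \<cdot> a) \<cdot> v"
    then have "a \<cdot> u = a \<cdot> v"
      using ab by (intro mult_a_inj[of "a \<cdot> u" "a \<cdot> v"]) (simp_all add: m_assoc)
    then show "u = v" by (rule mult_a_inj[OF uv(1,2)])
  qed
  obtain g1 where g1: "\<forall>u\<in>C. \<forall>xs\<in>tuples C (Suc (Suc n)). f (a \<cdot> u) xs = D g1 (a \<cdot> u) xs"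
    using free_exact[OF monoid_axioms ab(1) inj_a f[OF ab(1) b1(2)]] by blast
  define f1 where "f1 = (\<lambda>v xs. f v xs - D g1 v xs)"
  have f1_cocycle: "D f1 v xs = 0" if "v \<in> C" "v \<noteq> \<one>\<^bsub>M\<^esub>" "xs \<in> tuples C (Suc (Suc (Suc n)))" for v xs
    using that f by (simp add: f1_def D_sub_D)
  have f1_a: "f1 (a \<cdot> u) xs = 0" if "u \<in> C" "xs \<in> tuples C (Suc (Suc n))" for u xs
    using that g1 by (simp add: f1_def)
  define h where "h = (\<lambda>u zs. f1 b (u # zs))"
  have h: "D h u xs = f1 (b \<cdot> u) xs" if "u \<in> C" "xs \<in> tuples C (Suc (Suc n))" for u xs
    using that f1_cocycle[of b "u # xs"] ab b1 by (simp add: D_Cons mem_tuples_Cons h_def)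
  have baa: "f1 (b \<cdot> ((a \<cdot> a) \<cdot> u)) xs = 0" if "u \<in> C" "xs \<in> tuples C (Suc (Suc n))" for u xs
    using that ab f1_a[of "b \<cdot> (a \<cdot> u)" xs] by (simp add: m_assoc relations)
  have "D h (a \<cdot> a) xs = 0" if "xs \<in> tuples C (Suc (Suc n))" for xs
    using that h[of "a \<cdot> a" xs] baa[of "\<one>\<^bsub>M\<^esub>" xs] ab by simp
  then obtain g2 where g2: "\<forall>u\<in>C. \<forall>xs\<in>tuples C (Suc n).
      h ((a \<cdot> a) \<cdot> u) xs = D g2 ((a \<cdot> a) \<cdot> u) xs"
    using free_exact[OF monoid_axioms m_closed[OF ab(1) ab(1)] inj_aa] by blast
  define h1 where "h1 = (\<lambda>u zs. h u zs - D g2 u zs)"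
  have h1: "D h1 u xs = f1 (b \<cdot> u) xs" if "u \<in> C" "xs \<in> tuples C (Suc (Suc n))" for u xs
    using that h by (simp add: h1_def D_sub_D)
  have h1_aa: "h1 ((a \<cdot> a) \<cdot> u) xs = 0" if "u \<in> C" "xs \<in> tuples C (Suc n)" for u xs
    using that g2 by (simp add: h1_def)
  let ?ba = "\<lambda>w. b \<cdot> (a \<cdot> w)" and ?ab = "\<lambda>w. a \<cdot> (b \<cdot> w)"
  define e where "e = (\<lambda>w zs. h1 (?ba w) zs - h1 (?ab w) zs)"
  have D_ba_ab: "D (\<lambda>w zs. k (?ba w) zs - k (?ab w) zs) w xs = D k (?ba w) xs - D k (?ab w) xs"
    if "w \<in> C" "xs \<in> tuples C (Suc l)" for k :: "_ \<Rightarrow> _ \<Rightarrow> 'r" and w xs l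
    using that ab D_translate[of ?ba w xs l k] D_translate[of ?ab w xs l k]
    by (simp add: module_diff_diff m_assoc)
  have e_cocycle: "D e w xs = 0" if "w \<in> C" "xs \<in> tuples C (Suc (Suc n))" for w xs
    using that ab by (simp add: e_def D_ba_ab h1 relations)
  have e_a: "e (a \<cdot> w) zs = 0" if "w \<in> C" for w zs
    using that by (simp add: e_def relations)
  define e1 where "e1 = (\<lambda>w zs. e \<one>\<^bsub>M\<^esub> (w # zs))"
  have e1: "D e1 w xs = e w xs" if "w \<in> C" "xs \<in> tuples C (Suc n)" for w xs
    using that e_cocycle[of "\<one>\<^bsub>M\<^esub>" "w # xs"] by (simp add: D_Cons mem_tuples_Cons e1_def)
  have "\<exists>e2. (\<forall>w\<in>C. \<forall>xs\<in>tuples C (Suc n). D e2 w xs = e w xs) \<and> (\<forall>w\<in>C. \<forall>zs\<in>tuples C n. e2 (a \<cdot> w) zs = 0)"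
  proof (cases n)
    case 0
    have "e1 (a \<cdot> w) [] = 0" if w: "w \<in> C" for w
    proof (cases "w = \<one>\<^bsub>M\<^esub>")
      case True
      have g: "D g2 (P [q, p]) [a] = D g2 (P [p, q]) [a]"
        using relations(1)[of "\<one>\<^bsub>M\<^esub>"] ab by (simp add: mult_plactic eps0_plactic_class one_plactic)
      have "D g1 b [P [q, p], a] - D g1 b [P [p, q], a] = 0"
        using relations(1)[of "\<one>\<^bsub>M\<^esub>"] relations(2)[of "\<one>\<^bsub>M\<^esub>"] ab
        by (simp add: mult_plactic eps0_plactic_class one_plactic)
      then have "f1 b [P [q, p], a] = f1 b [P [p, q], a]"
        using obst[OF 0] by (simp add: f1_def)
      then have "h1 (P [q, p]) [a] = h1 (P [p, q]) [a]"
        by (simp only: h1_def h_def g)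
      then show ?thesis
        using True ab by (simp add: e1_def e_def mult_plactic one_plactic)
    next
      case False
      then have "D e1 a [w] = e1 (a \<cdot> w) []" using w by (simp add: eps0_nonunit)
      then show ?thesis using e1[of a "[w]"] e_a[of "\<one>\<^bsub>M\<^esub>" "[w]"] w ab by (simp add: 0 mem_tuples_Cons tuples_def)
    qed
    then show ?thesis using e1 by (intro exI[of _ e1]) (auto simp: 0 tuples_def)
  next
    case (Suc l)
    have "D e1 a xs = 0" if "xs \<in> tuples C (Suc (Suc l))" for xs
      using that e1[of a xs] e_a[of "\<one>\<^bsub>M\<^esub>" xs] ab by (simp add: Suc)
    then obtain g3 where g3: "\<forall>u\<in>C. \<forall>xs\<in>tuples C (Suc l).
        e1 (a \<cdot> u) xs = D g3 (a \<cdot> u) xs"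
      using free_exact[OF monoid_axioms ab(1) inj_a] by blast
    then show ?thesis
      using e1 by (intro exI[of _ "\<lambda>w zs. e1 w zs - D g3 w zs"]) (simp add: Suc D_sub_D)
  qed
  then obtain e2 where e2: "\<And>w xs. w \<in> C \<Longrightarrow> xs \<in> tuples C (Suc n) \<Longrightarrow> D e2 w xs = e w xs"
    and e2_a: "\<And>w zs. w \<in> C \<Longrightarrow> zs \<in> tuples C n \<Longrightarrow> e2 (a \<cdot> w) zs = 0" by blast
  define W where "W = {w \<in> C. unmatched w = 0}"
  define k where "k v zs = (if v \<in> ?ba ` W then e2 (the_inv_into W ?ba v) zs else 0)" for v zs
  have inj_ba: "inj_on ?ba W" by (rule inj_onI) (simp add: W_def ba_inj)
  have k_ba: "k (?ba w) zs = e2 w zs" if "w \<in> W" for w zs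
    using that the_inv_into_f_f[OF inj_ba that] by (simp add: k_def)
  have k_0: "k v zs = 0" if "v \<in> C" "0 < unmatched v" for v zs
  proof -
    have "unmatched (?ba w) = 0" if "w \<in> W" for w
      using that ab by (simp add: W_def unmatched_b unmatched_a)
    then show ?thesis using that by (auto simp: k_def)
  qed
  have k: "k (?ba w) zs - k (?ab w) zs = e2 w zs" if w: "w \<in> C" and zs: "zs \<in> tuples C n" for w zs
  proof (cases "unmatched w = 0")
    case True
    then show ?thesis using w ab by (simp add: k_ba W_def k_0 unmatched_a)
  next
    case False
    then obtain u where u: "u \<in> C" "w = a \<cdot> u" using unmatched_aE w by blast
    then show ?thesis using e2_a zs by (simp add: relations)
  qed
  define h2 where "h2 = (\<lambda>u zs. h1 u zs - D k u zs)"
  have h2: "D h2 u xs = f1 (b \<cdot> u) xs" if "u \<in> C" "xs \<in> tuples C (Suc (Suc n))" for u xs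
    using that h1 by (simp add: h2_def D_sub_D)
  have h2_aa: "h2 ((a \<cdot> a) \<cdot> u) xs = 0" if "u \<in> C" "xs \<in> tuples C (Suc n)" for u xs
  proof -
    have "D k ((a \<cdot> a) \<cdot> u) xs = 0"
      using that ab by (intro D_ideal_zero[where n = n]) (auto simp: m_assoc unmatched_a intro!: k_0)
    then show ?thesis using that by (simp add: h2_def h1_aa)
  qed
  have h2_ba: "h2 (?ba w) xs = h2 (?ab w) xs" if w: "w \<in> C" and xs: "xs \<in> tuples C (Suc n)" for w xs
  proof -
    have "D k (?ba w) xs - D k (?ab w) xs = D (\<lambda>w zs. k (?ba w) zs - k (?ab w) zs) w xs"
      using w xs by (simp add: D_ba_ab)
    also have "\<dots> = D e2 w xs" using k w xs by (intro D_cong) auto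
    also have "\<dots> = h1 (?ba w) xs - h1 (?ab w) xs" using e2[OF w xs] by (simp add: e_def)
    finally show ?thesis by (simp add: h2_def algebra_simps)
  qed
  define g where "g v zs = (if v \<in> (\<lambda>u. b \<cdot> u) ` C \<and> unmatched v = 0
      then h2 (SOME u. u \<in> C \<and> b \<cdot> u = v) zs else 0)" for v zs
  have g_b: "g (b \<cdot> u) zs = h2 u zs" if u: "u \<in> C" and zs: "zs \<in> tuples C (Suc n)" for u zs
  proof (cases "unmatched (b \<cdot> u) = 0")
    case True
    let ?u = "SOME u'. u' \<in> C \<and> b \<cdot> u' = b \<cdot> u"
    have u': "?u \<in> C" "b \<cdot> ?u = b \<cdot> u"
      using someI[of "\<lambda>u'. u' \<in> C \<and> b \<cdot> u' = b \<cdot> u" u] u by auto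
    have "h2 ?u zs = h2 u zs"
      using b_cancel[OF u u'(1)] u'(2) True h2_ba zs by (force simp: doubleton_eq_iff)
    then show ?thesis using u True by (simp add: g_def)
  next
    case False
    then have "2 \<le> unmatched u" using u by (simp add: unmatched_b)
    then obtain u1 where u1: "u1 \<in> C" "u = a \<cdot> u1"
      by (elim unmatched_aE[OF u less_le_trans[OF zero_less_numeral]])
    have "0 < unmatched u1" using \<open>2 \<le> unmatched u\<close> u1 by (simp add: unmatched_a)
    then obtain u2 where u2: "u2 \<in> C" "u1 = a \<cdot> u2" by (rule unmatched_aE[OF u1(1)])
    have "u = (a \<cdot> a) \<cdot> u2" using u1 u2 ab by (simp add: m_assoc)
    moreover note u2(1)
    ultimately show ?thesis using False zs h2_aa by (simp add: g_def)
  qed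
  have g_a: "g (a \<cdot> u) zs = 0" if "u \<in> C" for u zs
    using that by (simp add: g_def unmatched_a)
  have "f v xs = D (\<lambda>v zs. g1 v zs + g v zs) v xs" if v: "v \<in> C" "v \<noteq> \<one>\<^bsub>M\<^esub>" and xs: "xs \<in> tuples C (Suc (Suc n))" for v xs
  proof -
    have "D g v xs = f1 v xs"
      using v
    proof (cases v rule: nonunit_cases)
      case (1 u)
      then show ?thesis using D_ideal_zero[of a "Suc n" g u xs] g_a f1_a ab xs by simp
    next
      case (2 u)
      have "D g (b \<cdot> u) xs = D (\<lambda>u. g (b \<cdot> u)) u xs"
        using 2 ab xs by (intro D_translate[symmetric]) (auto simp: m_assoc)
      also have "\<dots> = D h2 u xs" using 2 xs g_b by (intro D_cong) auto
      finally show ?thesis using 2 xs h2 by simp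
    qed
    then show ?thesis
      using module_diff_lin[of M eps0 1 g1 1 g v xs] by (simp add: f1_def)
  qed
  then show ?thesis by (rule that)
qed

lemma cocycle_coboundary:
  fixes f :: "'a list set list \<Rightarrow> 'r::comm_ring_1"
  assumes f: "f \<in> plactic_cocycles {p, q} (Suc (Suc (Suc n)))"
    and obst: "n = 0 \<Longrightarrow> f [b, P [q, p], a] = f [b, P [p, q], a]"
  shows "f \<in> plactic_coboundaries {p, q} (Suc (Suc (Suc n)))"
proof -
  have d: "eps0 v * f xs = D (\<lambda>u zs. f (u # zs)) v xs"
    if v: "v \<in> C" "xs \<in> tuples C (Suc (Suc (Suc n)))" for v xs
  proof -
    obtain y ys where xs: "xs = y # ys" using v by (cases xs) (auto simp: tuples_def)
    have "hoch_diff M eps0 (Suc (Suc (Suc n))) f (v # xs) = 0" using f by (simp add: cocycles_def)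
    then show ?thesis
      using v hoch_diff_Cons[of v y ys M "Suc (Suc (Suc n))" eps0 f] by (simp add: xs mem_tuples_Cons del: module_diff.simps)
  qed
  obtain g where g: "\<And>v xs. v \<in> C \<Longrightarrow> v \<noteq> \<one>\<^bsub>M\<^esub> \<Longrightarrow> xs \<in> tuples C (Suc (Suc n)) \<Longrightarrow> f (v # xs) = D g v xs"
  proof (rule augmentation_exact[of n "\<lambda>u zs. f (u # zs)"])
    show "D (\<lambda>u zs. f (u # zs)) v xs = 0" if "v \<in> C" "v \<noteq> \<one>\<^bsub>M\<^esub>" "xs \<in> tuples C (Suc (Suc (Suc n)))" for v xs
      using d[OF that(1,3)] by (simp add: eps0_nonunit[OF that(1,2)])
  qed (use obst in auto)
  have one: "f (\<one>\<^bsub>M\<^esub> # y # ys) = D (\<lambda>u zs. f (\<one>\<^bsub>M\<^esub> # \<one>\<^bsub>M\<^esub> # u # zs)) y ys"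
    if y: "y \<in> C" and ys: "ys \<in> tuples C (Suc n)" for y ys
  proof -
    have "D (\<lambda>u zs. f (\<one>\<^bsub>M\<^esub> # u # zs)) \<one>\<^bsub>M\<^esub> (y # ys) = 0"
      using d[of "\<one>\<^bsub>M\<^esub>" "\<one>\<^bsub>M\<^esub> # y # ys"] y ys
      by (simp add: D_Cons[where f = "\<lambda>u zs. f (u # zs)" and n = "Suc n"] mem_tuples_Cons eps0_one)
    then have "f (\<one>\<^bsub>M\<^esub> # (\<one>\<^bsub>M\<^esub> \<cdot> y) # ys) = D (\<lambda>u zs. f (\<one>\<^bsub>M\<^esub> # \<one>\<^bsub>M\<^esub> # u # zs)) y ys"
      using ys by (simp add: D_Cons)
    then show ?thesis unfolding l_one[OF y] .
  qed
  define g' where "g' xs = (if xs \<in> tuples C (Suc (Suc n))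
      then if hd xs = \<one>\<^bsub>M\<^esub> then f (\<one>\<^bsub>M\<^esub> # xs) else - g (hd xs) (tl xs) else 0)" for xs
  have "hoch_diff M eps0 (Suc (Suc n)) g' xs = f xs" for xs
  proof (cases "xs \<in> tuples C (Suc (Suc (Suc n)))")
    case True
    then obtain v y ys where xs: "xs = v # y # ys"
      by (cases xs; cases "tl xs") (auto simp: tuples_def)
    have t: "v \<in> C" "y \<in> C" "ys \<in> tuples C (Suc n)" "y # ys \<in> tuples C (Suc (Suc n))"
      using True by (auto simp: xs mem_tuples_Cons)
    have h: "hoch_diff M eps0 (Suc (Suc n)) g' xs
        = eps0 v * g' (y # ys) - D (\<lambda>u zs. g' (u # zs)) v (y # ys)"
      using True hoch_diff_Cons[of v y ys M "Suc (Suc n)" eps0 g'] by (simp add: xs del: module_diff.simps)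
    show ?thesis
    proof (cases "v = \<one>\<^bsub>M\<^esub>")
      case True
      have "D (\<lambda>u zs. g' (u # zs)) v (y # ys) = g' (y # ys) - D (\<lambda>u zs. g' (\<one>\<^bsub>M\<^esub> # u # zs)) y ys"
        using True t(3) by (simp add: D_Cons l_one[OF t(2)])
      also have "D (\<lambda>u zs. g' (\<one>\<^bsub>M\<^esub> # u # zs)) y ys = D (\<lambda>u zs. f (\<one>\<^bsub>M\<^esub> # \<one>\<^bsub>M\<^esub> # u # zs)) y ys"
        using t by (intro D_cong[where n = n]) (auto simp: g'_def mem_tuples_Cons)
      finally show ?thesis using h one[OF t(2,3)] True by (simp add: xs eps0_one)
    next
      case False
      have ideal: "u \<cdot> x \<noteq> \<one>\<^bsub>M\<^esub>" if "u \<in> C" "u \<noteq> \<one>\<^bsub>M\<^esub>" "x \<in> C" for u x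
        using that C_cases[of u] C_cases[of x]
        by (auto simp: one_plactic mult_plactic lists_eq_set plactic_class_Nil_iff)
      have "D (\<lambda>u zs. g' (u # zs)) v (y # ys) = D (\<lambda>u zs. - 1 * g u zs + 0 * g u zs) v (y # ys)"
        by (rule module_diff_cong[where N = "C - {\<one>\<^bsub>M\<^esub>}" and n = "Suc n"])
          (use False t ideal in \<open>auto simp: g'_def mem_tuples_Cons\<close>)
      also have "\<dots> = - f (v # y # ys)"
        using g[OF t(1) False t(4)] by (subst module_diff_lin) simp
      finally show ?thesis using h False t by (simp add: xs eps0_nonunit)
    qed
  next
    case False
    then show ?thesis using f by (simp add: cocycles_def hoch_cochains_def hoch_diff_outside)
  qed
  then have "f = hoch_diff M eps0 (Suc (Suc n)) g'" by auto
  moreover have "g' \<in> hoch_cochains M (Suc (Suc n))" by (simp add: hoch_cochains_def g'_def)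
  ultimately show ?thesis by (simp add: coboundaries_def)
qed

end


section \<open>The quantum symmetrizer for two letters\<close>

definition indicator_cochain :: "'x list \<Rightarrow> 'x list \<Rightarrow> 'r::comm_ring_1" where
  "indicator_cochain cs xs = (if xs = cs then 1 else 0)"

lemma braided_cochain_complex: "cochain_complex (crit_cochains X \<sigma> e) (braided_diff X \<sigma> chi)"
proof
  show "braided_diff X \<sigma> chi k (\<lambda>x. r * f x + s * g x)
      = (\<lambda>x. r * braided_diff X \<sigma> chi k f x + s * braided_diff X \<sigma> chi k g x)" for k r f s g
    unfolding braided_diff_def Let_def
    by (auto simp: fun_eq_iff sum_distrib_left sum.distrib[symmetric] algebra_simps
        simp del: sum.lessThan_Suc intro!: sum.cong)
qed (auto simp: crit_cochains_def)

interpretation columns: cochain_complex "column_cochains A" "column_diff A" for A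
  unfolding column_cochains_def column_diff_def by (rule braided_cochain_complex)

locale symmetrizer_basis =
  cohomology_basis "hoch_cochains (plactic A)" "hoch_diff (plactic A) eps0" k n \<Lambda> G
  for A :: "'a::linorder set" and k n and \<Lambda> :: "nat \<Rightarrow> ('a list set list \<Rightarrow> 'r::comm_ring_1) \<Rightarrow> 'r" and G +
  fixes cs :: "nat \<Rightarrow> 'a list list"
  assumes G_normalized: "\<And>i. i < n \<Longrightarrow> G i \<in> normalized_cochains (plactic A) k"
    and cs_length: "\<And>i. i < n \<Longrightarrow> length (cs i) = k"
    and cs_inj: "\<And>i j. i < n \<Longrightarrow> j < n \<Longrightarrow> cs i = cs j \<Longrightarrow> i = j"
    and cs_cocycle: "\<And>i. i < n \<Longrightarrow>
      (indicator_cochain (cs i) :: _ \<Rightarrow> 'r) \<in> cocycles (column_cochains A) (column_diff A) k"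
    and cs_coboundary: "\<And>i h. i < n \<Longrightarrow> h \<in> coboundaries (column_cochains A) (column_diff A) k \<Longrightarrow> h (cs i) = (0 :: 'r)"
    and symmetrizer: "\<And>f. f \<in> plactic_cocycles A k \<Longrightarrow> f \<in> normalized_cochains (plactic A) k \<Longrightarrow>
      \<exists>t. t \<in> cocycles (column_cochains A) (column_diff A) k \<and> t \<in> coboundaries (column_cochains A) (column_diff A) k
        \<and> quantum_symmetrizer (Col A) sigma_C (plactic_class A) k f
          = (\<lambda>xs. (\<Sum>i<n. \<Lambda> i f * indicator_cochain (cs i) xs) + t xs)"
begin

abbreviation "cocycle_of f \<equiv> (\<lambda>xs. \<Sum>i<n. \<Lambda> i f * indicator_cochain (cs i) xs)"

lemma cocycle_of_cocycle: "cocycle_of f \<in> cocycles (column_cochains A) (column_diff A) k"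
  by (rule columns.Z_sum) (simp add: cs_cocycle)

lemma cocycle_of_at: "j < n \<Longrightarrow> cocycle_of f (cs j) = \<Lambda> j f"
proof -
  assume j: "j < n"
  have "cocycle_of f (cs j) = (\<Sum>i<n. if i = j then \<Lambda> i f else 0)"
    using j cs_inj by (intro sum.cong) (auto simp: indicator_cochain_def)
  then show ?thesis using j by simp
qed

lemma column_symmetrizer_class:
  assumes f: "f \<in> plactic_cocycles A k"
  shows "column_symmetrizer A k (hoch_class A k f)
    = cohomologous (column_cochains A) (column_diff A) k `` {cocycle_of f}"
  unfolding column_symmetrizer_def
proof (rule columns.UN_cls_eq)
  let ?g = "\<lambda>xs. \<Sum>i<n. \<Lambda> i f * G i xs"
  have "?g \<in> hoch_class A k f"
    using f combination_cocycle cls_eq_iff_\<Lambda>[of f ?g] self_mem_cls[of ?g k] \<Lambda>_combination by auto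
  moreover have "?g \<in> normalized_cochains (plactic A) k"
    using combination_cocycle[of "\<lambda>i. \<Lambda> i f"] G_normalized by (simp add: normalized_cochains_def cocycles_def)
  ultimately show "hoch_class A k f \<inter> normalized_cochains (plactic A) k \<noteq> {}" by blast
  show "cocycle_of f \<in> cocycles (column_cochains A) (column_diff A) k" by (rule cocycle_of_cocycle)
  fix f' assume f': "f' \<in> hoch_class A k f \<inter> normalized_cochains (plactic A) k"
  then have "f' \<in> plactic_cocycles A k" by (auto simp: plactic.mem_cls)
  then obtain t where t: "t \<in> cocycles (column_cochains A) (column_diff A) k"
      "t \<in> coboundaries (column_cochains A) (column_diff A) k"
    and qs: "quantum_symmetrizer (Col A) sigma_C (plactic_class A) k f' = (\<lambda>xs. cocycle_of f' xs + t xs)"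
    using symmetrizer f' by blast
  have "\<Lambda> i f' = \<Lambda> i f" if "i < n" for i using that f' \<Lambda>_cong_cls[of f' f i] by simp
  then have qs': "quantum_symmetrizer (Col A) sigma_C (plactic_class A) k f' = (\<lambda>xs. cocycle_of f xs + t xs)"
    using qs by simp
  show "quantum_symmetrizer (Col A) sigma_C (plactic_class A) k f' \<in> cocycles (column_cochains A) (column_diff A) k"
    unfolding qs' by (intro columns.Z_add cocycle_of_cocycle t)
  show "(\<lambda>xs. quantum_symmetrizer (Col A) sigma_C (plactic_class A) k f' xs - cocycle_of f xs)
      \<in> coboundaries (column_cochains A) (column_diff A) k"
    unfolding qs' using t by simp
qed

lemma column_class_eq:
  assumes "j < n"
  shows "column_class A (cs j) = hoch_class A k (G j)"
proof -
  have "inj_on (column_symmetrizer A k) (carrier (plactic_cohomology A k :: ('r, _) module))"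
  proof (rule inj_onI)
    fix X Y :: "('a list set list \<Rightarrow> 'r) set"
    assume "X \<in> carrier (plactic_cohomology A k)" "Y \<in> carrier (plactic_cohomology A k)"
      and eq: "column_symmetrizer A k X = column_symmetrizer A k Y"
    then obtain f g where f: "f \<in> plactic_cocycles A k" "X = hoch_class A k f"
      and g: "g \<in> plactic_cocycles A k" "Y = hoch_class A k g"
      by (auto simp: plactic_cohomology_eq carrier_H)
    then have "(\<lambda>xs. cocycle_of f xs - cocycle_of g xs) \<in> coboundaries (column_cochains A) (column_diff A) k"
      using eq columns.cls_eq_iff[OF cocycle_of_cocycle cocycle_of_cocycle]
      by (simp add: column_symmetrizer_class)
    then have "\<Lambda> i f = \<Lambda> i g" if "i < n" for i
      using that cs_coboundary[OF that] cocycle_of_at[OF that] by fastforce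
    then show "X = Y" using f g by (simp add: cls_eq_iff_\<Lambda>)
  qed
  moreover have "column_symmetrizer A k (hoch_class A k (G j))
      = cohomologous (column_cochains A) (column_diff A) k `` {indicator_cochain (cs j)}"
  proof -
    have "cocycle_of (G j) = indicator_cochain (cs j)"
      using assms by (auto simp: \<Lambda>_G fun_eq_iff if_distrib[of "\<lambda>c. c * _"] cong: if_cong)
    then show ?thesis using assms by (simp add: column_symmetrizer_class G_cocycle)
  qed
  moreover have "hoch_class A k (G j) \<in> carrier (plactic_cohomology A k)"
    using assms by (simp add: plactic_cohomology_eq cls_in_carrier G_cocycle)
  ultimately have "the_inv_into (carrier (plactic_cohomology A k)) (column_symmetrizer A k)
      (cohomologous (column_cochains A) (column_diff A) k `` {indicator_cochain (cs j)}) = hoch_class A k (G j)"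
    by (rule the_inv_into_f_eq)
  moreover have "(\<lambda>xs. if xs = cs j then 1 else 0 :: 'r) = indicator_cochain (cs j)"
    by (simp add: indicator_cochain_def fun_eq_iff)
  ultimately show ?thesis
    using assms by (simp add: column_class_def hoch_class_of_def cs_length)
qed

lemma is_basis_column_class:
  "is_basis (plactic_cohomology A k :: ('r, _) module) (map (\<lambda>i. column_class A (cs i)) [0..<n])"
proof -
  have "map (\<lambda>i. column_class A (cs i)) [0..<n] = map (\<lambda>i. hoch_class A k (G i)) [0..<n]"
    by (simp add: column_class_eq)
  then show ?thesis unfolding plactic_cohomology_eq by (simp only: is_basis_cls)
qed

end

abbreviation "B2 \<equiv> {1, 2 :: nat}"

interpretation two: two_letters "1 :: nat" 2
  by unfold_locales simp

lemma Col_B2: "Col B2 = {[], [1], [2], [2, 1]}"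
proof
  show "Col B2 \<subseteq> {[], [1], [2], [2, 1]}"
  proof
    fix c assume "c \<in> Col B2"
    then have c: "set c \<subseteq> {1, 2}" "sorted_wrt (>) c" by (auto simp: Col_def)
    then show "c \<in> {[], [1], [2], [2, 1]}"
      by (cases c; cases "tl c"; cases "tl (tl c)") auto
  qed
qed (auto simp: Col_def)

lemma sigma_C_B2:
  "sigma_C ([], []) = ([] :: nat list, [])"
  "sigma_C ([], [1]) = ([1 :: nat], [])" "sigma_C ([1], []) = ([1 :: nat], [])"
  "sigma_C ([], [2]) = ([2 :: nat], [])" "sigma_C ([2], []) = ([2 :: nat], [])"
  "sigma_C ([], [2, 1]) = ([2 :: nat, 1], [])" "sigma_C ([2, 1], []) = ([2 :: nat, 1], [])"
  "sigma_C ([1], [1]) = ([1 :: nat], [1])" "sigma_C ([2], [2]) = ([2 :: nat], [2])"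
  "sigma_C ([1], [2]) = ([1 :: nat], [2])" "sigma_C ([2], [1]) = ([2 :: nat, 1], [])"
  "sigma_C ([1], [2, 1]) = ([2 :: nat, 1], [1])" "sigma_C ([2, 1], [1]) = ([2 :: nat, 1], [1])"
  "sigma_C ([2], [2, 1]) = ([2 :: nat, 1], [2])" "sigma_C ([2, 1], [2]) = ([2 :: nat, 1], [2])"
  "sigma_C ([2, 1], [2, 1]) = ([2 :: nat, 1], [2, 1])"
  by (simp_all add: sigma_C_def schensted_product_def column_tableau_def tableau_columns_def)

definition braid_product :: "nat list \<Rightarrow> nat \<Rightarrow> nat" where
  "braid_product w = foldr (\<lambda>i p. Transposition.transpose i (Suc i) \<circ> p) w id"

lemma reduced_word_properties:
  assumes "\<forall>i\<in>set w. Suc i < k" "braid_product w = s"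
  shows "\<forall>i\<in>set (reduced_word k s). Suc i < k" "braid_product (reduced_word k s) = s"
    "length (reduced_word k s) \<le> length w"
proof -
  let ?Q = "\<lambda>w. (\<forall>i\<in>set w. Suc i < k) \<and> braid_product w = s"
  have r: "reduced_word k s = (ARG_MIN length w. ?Q w)"
    by (simp add: reduced_word_def braid_product_def)
  have "?Q (reduced_word k s)" unfolding r by (rule arg_min_natI[of ?Q w]) (use assms in simp)
  then show "\<forall>i\<in>set (reduced_word k s). Suc i < k" "braid_product (reduced_word k s) = s" by auto
  show "length (reduced_word k s) \<le> length w"
    unfolding r by (rule arg_min_nat_le[of ?Q w]) (use assms in simp)
qed

lemma reduced_word_3_cases:
  assumes "length (w :: nat list) \<le> 3" "\<forall>i\<in>set w. Suc i < 3"
  shows "reduced_word 3 (braid_product w) \<in> set (filter (\<lambda>r. length r \<le> length w \<and>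
        map (braid_product r) [0, 1, 2] = map (braid_product w) [0, 1, 2])
      (concat (map (\<lambda>n. List.n_lists n [0, 1]) [0, 1, 2, 3])))"
proof -
  note r = reduced_word_properties[OF assms(2) refl]
  have "set (reduced_word 3 (braid_product w)) \<subseteq> {0, 1}" using r(1) by auto
  moreover have "length (reduced_word 3 (braid_product w)) \<in> {0, 1, 2, 3}" proof -
    have "m \<in> {0, 1, 2, 3}" if "m \<le> 3" for m :: nat using that by (simp add: numeral_eq_Suc le_Suc_eq)
    then show ?thesis using le_trans[OF r(3) assms(1)] by blast
  qed
  moreover have "v \<in> set (concat (map (\<lambda>n. List.n_lists n [0, 1]) [0, 1, 2, 3]))"
    if "set v \<subseteq> {0, 1}" "length v \<in> {0, 1, 2, 3}" for v :: "nat list"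
    using that by (auto simp: set_n_lists length_Suc_conv)
  ultimately have "reduced_word 3 (braid_product w) \<in> set (concat (map (\<lambda>n. List.n_lists n [0, 1]) [0, 1, 2, 3]))"
    by blast
  then show ?thesis unfolding set_filter using r(2,3) by (simp only: mem_Collect_eq simp_thms)
qed

lemma reduced_words:
  "reduced_word 3 (braid_product []) \<in> {[]}"
  "reduced_word 3 (braid_product [0]) \<in> {[0]}"
  "reduced_word 3 (braid_product [1]) \<in> {[1]}"
  "reduced_word 3 (braid_product [0, 1]) \<in> {[0, 1]}"
  "reduced_word 3 (braid_product [1, 0]) \<in> {[1, 0]}"
  "reduced_word 3 (braid_product [0, 1, 0]) \<in> {[0, 1, 0], [1, 0, 1]}"
proof -
  have *: "reduced_word 3 (braid_product w) \<in> set R"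
    if "length w \<le> 3" "\<forall>i\<in>set w. Suc i < 3"
      "filter (\<lambda>r. length r \<le> length w \<and> map (braid_product r) [0, 1, 2] = map (braid_product w) [0, 1, 2])
        (concat (map (\<lambda>n. List.n_lists n [0, 1]) [0, 1, 2, 3])) = R" for w R
    using reduced_word_3_cases[OF that(1,2)] that(3) by simp
  note ev = braid_product_def Transposition.transpose_def numeral_3_eq_3 numeral_2_eq_2
  show "reduced_word 3 (braid_product []) \<in> {[]}" using *[of "[]" "[[]]"] by (simp add: ev)
  show "reduced_word 3 (braid_product [0]) \<in> {[0]}" using *[of "[0]" "[[0]]"] by (simp add: ev)
  show "reduced_word 3 (braid_product [1]) \<in> {[1]}" using *[of "[1]" "[[1]]"] by (simp add: ev)
  show "reduced_word 3 (braid_product [0, 1]) \<in> {[0, 1]}" using *[of "[0, 1]" "[[0, 1]]"] by (simp add: ev)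
  show "reduced_word 3 (braid_product [1, 0]) \<in> {[1, 0]}" using *[of "[1, 0]" "[[1, 0]]"] by (simp add: ev)
  show "reduced_word 3 (braid_product [0, 1, 0]) \<in> {[0, 1, 0], [1, 0, 1]}"
    using *[of "[0, 1, 0]" "[[0, 1, 0], [1, 0, 1]]"] by (simp add: ev)
qed


lemma lessThan_2: "{..<2 :: nat} = insert 0 {1}"
  by auto

lemma lessThan_3: "{..<3 :: nat} = insert 0 (insert 1 {2})"
  by auto

lemma quantum_symmetrizer_1:
  assumes "xs \<in> tuples X 1"
  shows "quantum_symmetrizer X \<sigma> \<iota> 1 f xs = f (map \<iota> xs)"
proof -
  have "reduced_word 1 id = []"
    using reduced_word_properties(3)[of "[]" 1 id] by (simp add: braid_product_def)
  moreover have "{..<1 :: nat} = {0}" by auto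
  ultimately show ?thesis using assms by (simp add: quantum_symmetrizer_def braid_word_def)
qed

lemma quantum_symmetrizer_2:
  assumes "xs \<in> tuples X 2"
  shows "quantum_symmetrizer X \<sigma> \<iota> 2 f xs = f (map \<iota> xs) - f (map \<iota> (braid_at \<sigma> 0 xs))"
proof -
  have r0: "reduced_word 2 id = []"
    using reduced_word_properties(3)[of "[]" 2 id] by (simp add: braid_product_def)
  have r1: "reduced_word 2 (Transposition.transpose 0 1) = [0]"
  proof -
    let ?r = "reduced_word 2 (Transposition.transpose 0 1)"
    have r: "\<forall>i\<in>set ?r. Suc i < 2" "braid_product ?r = Transposition.transpose 0 1" "length ?r \<le> 1"
      using reduced_word_properties[of "[0]" 2 "Transposition.transpose 0 1"]
      by (simp_all add: braid_product_def)
    have "?r \<noteq> []"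
    proof
      assume "?r = []"
      then have "Transposition.transpose 0 1 (0 :: nat) = 0" using r(2) by (simp add: braid_product_def)
      then show False by simp
    qed
    then show ?thesis using r(1,3) by (cases ?r) auto
  qed
  have "(\<Sum>s | s permutes {..<2}. of_int (sign s) * f (map \<iota> (braid_word \<sigma> (reduced_word 2 s) xs)))
      = f (map \<iota> (braid_word \<sigma> (reduced_word 2 id) xs))
        - f (map \<iota> (braid_word \<sigma> (reduced_word 2 (Transposition.transpose 0 1)) xs))"
    unfolding lessThan_2 by (subst sum_over_permutations_insert) (simp_all add: sign_swap_id)
  then show ?thesis using assms by (simp add: quantum_symmetrizer_def r0 r1[simplified] braid_word_def)
qed

lemma quantum_symmetrizer_3:
  "\<exists>w\<in>{[0, 1, 0], [1, 0, 1]}. \<forall>xs\<in>tuples X 3. quantum_symmetrizer X \<sigma> \<iota> 3 f xs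
    = f (map \<iota> xs) - f (map \<iota> (braid_word \<sigma> [0] xs)) - f (map \<iota> (braid_word \<sigma> [1] xs))
      + f (map \<iota> (braid_word \<sigma> [0, 1] xs)) + f (map \<iota> (braid_word \<sigma> [1, 0] xs))
      - f (map \<iota> (braid_word \<sigma> w xs))"
proof (intro bexI ballI)
  fix xs assume xs: "xs \<in> tuples X 3"
  let ?F = "\<lambda>s. of_int (sign s) * f (map \<iota> (braid_word \<sigma> (reduced_word 3 s) xs))"
  let ?t = "Transposition.transpose :: nat \<Rightarrow> nat \<Rightarrow> nat \<Rightarrow> nat"
  have p: "permutation (?t i j)" for i j by (rule permutation_swap_id)
  have e: "id = braid_product []" "?t 0 1 = braid_product [0]" "?t 1 2 = braid_product [1]"
    "?t 0 1 \<circ> ?t 1 2 = braid_product [0, 1]" "?t 0 2 \<circ> ?t 1 2 = braid_product [1, 0]"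
    "?t 0 2 = braid_product [0, 1, 0]"
    by (auto simp: braid_product_def fun_eq_iff Transposition.transpose_def numeral_2_eq_2)
  have "(\<Sum>s | s permutes {..<3}. ?F s)
      = ?F id + ?F (?t 1 2) + (?F (?t 0 1) + ?F (?t 0 1 \<circ> ?t 1 2)) + (?F (?t 0 2) + ?F (?t 0 2 \<circ> ?t 1 2))"
    unfolding lessThan_3 by (simp add: sum_over_permutations_insert add.assoc)
  also have "\<dots> = f (map \<iota> xs) - f (map \<iota> (braid_word \<sigma> [0] xs)) - f (map \<iota> (braid_word \<sigma> [1] xs))
      + f (map \<iota> (braid_word \<sigma> [0, 1] xs)) + f (map \<iota> (braid_word \<sigma> [1, 0] xs))
      - f (map \<iota> (braid_word \<sigma> (reduced_word 3 (braid_product [0, 1, 0])) xs))"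
  proof -
    have s: "sign (?t 0 1 \<circ> ?t 1 2) = 1" "sign (?t 0 2 \<circ> ?t 1 2) = 1"
      by (simp_all only: sign_compose[OF p p] sign_swap_id, simp_all)
    have r: "reduced_word 3 (braid_product []) = []" "reduced_word 3 (braid_product [0]) = [0]"
      "reduced_word 3 (braid_product [1]) = [1]" "reduced_word 3 (braid_product [0, 1]) = [0, 1]"
      "reduced_word 3 (braid_product [1, 0]) = [1, 0]"
      using reduced_words by blast+
    have i: "f (map \<iota> (braid_word \<sigma> [] xs)) = f (map \<iota> xs)" by (simp add: braid_word_def)
    have F: "?F id = f (map \<iota> xs)" "?F (?t 1 2) = - f (map \<iota> (braid_word \<sigma> [1] xs))"
      "?F (?t 0 1) = - f (map \<iota> (braid_word \<sigma> [0] xs))"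
      "?F (?t 0 1 \<circ> ?t 1 2) = f (map \<iota> (braid_word \<sigma> [0, 1] xs))"
      "?F (?t 0 2 \<circ> ?t 1 2) = f (map \<iota> (braid_word \<sigma> [1, 0] xs))"
      "?F (?t 0 2) = - f (map \<iota> (braid_word \<sigma> (reduced_word 3 (braid_product [0, 1, 0])) xs))"
      unfolding s sign_id sign_swap_id unfolding e(4,5) unfolding e(1-3,6) r i by simp_all
    show ?thesis unfolding F by (simp add: algebra_simps)
  qed
  finally show "quantum_symmetrizer X \<sigma> \<iota> 3 f xs
    = f (map \<iota> xs) - f (map \<iota> (braid_word \<sigma> [0] xs)) - f (map \<iota> (braid_word \<sigma> [1] xs))
      + f (map \<iota> (braid_word \<sigma> [0, 1] xs)) + f (map \<iota> (braid_word \<sigma> [1, 0] xs))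
      - f (map \<iota> (braid_word \<sigma> (reduced_word 3 (braid_product [0, 1, 0])) xs))"
    using xs by (simp add: quantum_symmetrizer_def)
qed (rule reduced_words)

lemma chi_B2:
  "eps0 (two.P []) = 1" "eps0 (two.P [1]) = 0" "eps0 (two.P [2]) = 0" "eps0 (two.P [2, 1]) = 0"
  by (simp_all add: eps0_plactic_class)

lemma tuples_4: "xs \<in> tuples X (Suc 3) \<longleftrightarrow> (\<exists>x\<in>X. \<exists>y\<in>X. \<exists>z\<in>X. \<exists>w\<in>X. xs = [x, y, z, w])"
  by (auto simp: tuples_def length_Suc_conv numeral_3_eq_3)

lemma column_diff_0: "column_diff A 0 f = (\<lambda>_. 0)"
  by (auto simp: column_diff_def braided_diff_def braid_word_def fun_eq_iff tuples_1 mult.commute)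

lemma column_diff_1:
  assumes "x \<in> Col A" "y \<in> Col A"
  shows "column_diff A 1 f [x, y]
    = (let chi = (\<lambda>c. eps0 (plactic_class A c)); r = braid_at sigma_C 0 [x, y] in
       chi x * f [y] - f (butlast r) * chi (last r) - (chi (hd r) * f (tl r) - f [x] * chi y))"
  using assms by (simp add: column_diff_def braided_diff_def braid_word_def tuples_def Let_def)

lemma column_diff_2:
  assumes "x \<in> Col A" "y \<in> Col A" "z \<in> Col A"
  shows "column_diff A 2 f [x, y, z]
    = (let chi = (\<lambda>c. eps0 (plactic_class A c)); w = (\<lambda>is. braid_word sigma_C is [x, y, z]) in
       chi x * f [y, z] - f (butlast (w [1, 0])) * chi (last (w [1, 0]))
       - (chi (hd (w [0])) * f (tl (w [0])) - f (butlast (w [1])) * chi (last (w [1])))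
       + (chi (hd (w [0, 1])) * f (tl (w [0, 1])) - f [x, y] * chi z))"
  using assms by (simp add: column_diff_def braided_diff_def tuples_def Let_def numeral_2_eq_2 upt_rec)
    (simp add: braid_word_def)

lemma column_diff_3:
  assumes "x \<in> Col A" "y \<in> Col A" "z \<in> Col A" "u \<in> Col A"
  shows "column_diff A 3 f [x, y, z, u]
    = (let chi = (\<lambda>c. eps0 (plactic_class A c)); w = (\<lambda>is. braid_word sigma_C is [x, y, z, u]) in
       chi x * f [y, z, u] - f (butlast (w [2, 1, 0])) * chi (last (w [2, 1, 0]))
       - (chi (hd (w [0])) * f (tl (w [0])) - f (butlast (w [2, 1])) * chi (last (w [2, 1])))
       + (chi (hd (w [0, 1])) * f (tl (w [0, 1])) - f (butlast (w [2])) * chi (last (w [2])))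
       - (chi (hd (w [0, 1, 2])) * f (tl (w [0, 1, 2])) - f [x, y, z] * chi u))"
  using assms by (simp add: column_diff_def braided_diff_def tuples_def Let_def eval_nat_numeral upt_rec)
    (simp add: braid_word_def)

lemmas evaluate_columns = Let_def braid_word_def braid_at_def indicator_cochain_def
  sigma_C_B2[unfolded One_nat_def] chi_B2[unfolded One_nat_def] Col_B2[unfolded One_nat_def]

lemma indicator_column_cochain:
  assumes "cs \<in> critical_tuples (Col A) sigma_C [] k"
  shows "indicator_cochain cs \<in> column_cochains A k"
  using assms by (auto simp: column_cochains_def crit_cochains_def indicator_cochain_def)

lemma critical_tuples_B2:
  "[[1]] \<in> critical_tuples (Col B2) sigma_C [] 1"
  "[[2]] \<in> critical_tuples (Col B2) sigma_C [] 1"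
  "[[2, 1]] \<in> critical_tuples (Col B2) sigma_C [] 1"
  "[[2], [1]] \<in> critical_tuples (Col B2) sigma_C [] 2"
  "[[1], [2, 1]] \<in> critical_tuples (Col B2) sigma_C [] 2"
  "[[2], [2, 1]] \<in> critical_tuples (Col B2) sigma_C [] 2"
  "[[2], [1], [2, 1]] \<in> critical_tuples (Col B2) sigma_C [] 3"
proof -
  have i: "Suc i < 2 \<longleftrightarrow> i = 0" "i < 2 \<longleftrightarrow> i = 0 \<or> i = 1" for i by auto
  show "[[1]] \<in> critical_tuples (Col B2) sigma_C [] 1" "[[2]] \<in> critical_tuples (Col B2) sigma_C [] 1"
    "[[2, 1]] \<in> critical_tuples (Col B2) sigma_C [] 1" "[[2], [1]] \<in> critical_tuples (Col B2) sigma_C [] 2"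
    "[[1], [2, 1]] \<in> critical_tuples (Col B2) sigma_C [] 2"
    "[[2], [2, 1]] \<in> critical_tuples (Col B2) sigma_C [] 2"
    "[[2], [1], [2, 1]] \<in> critical_tuples (Col B2) sigma_C [] 3"
    by (auto simp: critical_tuples_def tuples_def i evaluate_columns)
qed

lemma column_diff_outside: "xs \<notin> tuples (Col A) (Suc k) \<Longrightarrow> column_diff A k f xs = 0"
  by (simp add: column_diff_def braided_diff_def)

lemma column_cocycle_1:
  assumes "cs = [[1]] \<or> cs = [[2]]"
  shows "indicator_cochain cs \<in> cocycles (column_cochains B2) (column_diff B2) 1"
proof -
  have ev: "\<forall>x\<in>{[], [1], [2], [2, 1]}. \<forall>y\<in>{[], [1], [2], [2, 1]}. column_diff B2 1 (indicator_cochain cs) [x, y] = 0"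
    using assms by (elim disjE; hypsubst; simp add: column_diff_1[unfolded One_nat_def] evaluate_columns)
  have "column_diff B2 1 (indicator_cochain cs) xs = 0" for xs
  proof (cases "xs \<in> tuples (Col B2) (Suc 1)")
    case True
    then show ?thesis using ev unfolding Col_B2 by (auto simp: tuples_2 simp flip: numeral_2_eq_2)
  qed (rule column_diff_outside)
  then show ?thesis
    using assms indicator_column_cochain critical_tuples_B2 by (auto simp: cocycles_def fun_eq_iff)
qed

lemma column_cocycle_2:
  assumes "cs = [[1], [2, 1]] \<or> cs = [[2], [2, 1]] \<or> cs = [[2], [1]]"
  shows "indicator_cochain cs \<in> cocycles (column_cochains B2) (column_diff B2) 2"
proof -
  have ev: "\<forall>x\<in>{[], [1], [2], [2, 1]}. \<forall>y\<in>{[], [1], [2], [2, 1]}. \<forall>z\<in>{[], [1], [2], [2, 1]}.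
      column_diff B2 2 (indicator_cochain cs) [x, y, z] = 0"
    using assms by (elim disjE; hypsubst; simp add: column_diff_2 evaluate_columns)
  have "column_diff B2 2 (indicator_cochain cs) xs = 0" for xs
  proof (cases "xs \<in> tuples (Col B2) (Suc 2)")
    case True
    then obtain x y z where "x \<in> Col B2" "y \<in> Col B2" "z \<in> Col B2" "xs = [x, y, z]"
      by (auto simp: tuples_3)
    then show ?thesis using ev unfolding Col_B2 by blast
  qed (rule column_diff_outside)
  then show ?thesis
    using assms indicator_column_cochain critical_tuples_B2 by (auto simp: cocycles_def fun_eq_iff)
qed

lemma column_cocycle_3:
  "indicator_cochain [[2], [1], [2, 1]] \<in> cocycles (column_cochains B2) (column_diff B2) 3"
proof -
  let ?d = "column_diff B2 3 (indicator_cochain [[2], [1], [2, 1]])"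
  have ev: "\<forall>y\<in>{[], [1], [2], [2, 1]}. \<forall>z\<in>{[], [1], [2], [2, 1]}. \<forall>u\<in>{[], [1], [2], [2, 1]}. ?d [x, y, z, u] = 0"
    if "x \<in> {[], [1], [2], [2, 1]}" for x
    using that by (elim insertE emptyE; hypsubst; simp add: column_diff_3 evaluate_columns)
  have "?d xs = 0" for xs
  proof (cases "xs \<in> tuples (Col B2) (Suc 3)")
    case True
    then obtain x y z u where "x \<in> Col B2" "y \<in> Col B2" "z \<in> Col B2" "u \<in> Col B2" "xs = [x, y, z, u]"
      unfolding tuples_4 by blast
    then show ?thesis using ev unfolding Col_B2 by blast
  qed (rule column_diff_outside)
  then show ?thesis
    using indicator_column_cochain critical_tuples_B2 by (auto simp: cocycles_def fun_eq_iff)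
qed


lemma column_coboundary_21:
  "(indicator_cochain [[2], [1]] :: _ \<Rightarrow> 'r::comm_ring_1) \<in> coboundaries (column_cochains B2) (column_diff B2) 2"
proof -
  have ev: "\<forall>x\<in>{[], [1], [2], [2, 1]}. \<forall>y\<in>{[], [1], [2], [2, 1]}.
      column_diff B2 1 (indicator_cochain [[2, 1]]) [x, y] = (- indicator_cochain [[2], [1]] [x, y] :: 'r)"
    by (simp add: column_diff_1[unfolded One_nat_def] evaluate_columns)
  have "column_diff B2 1 (indicator_cochain [[2, 1]]) xs = (- indicator_cochain [[2], [1]] xs :: 'r)" for xs
  proof (cases "xs \<in> tuples (Col B2) (Suc 1)")
    case True
    then show ?thesis using ev unfolding Col_B2 by (auto simp: tuples_2 simp flip: numeral_2_eq_2)
  next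
    case False
    moreover have "[[2], [1]] \<in> tuples (Col B2) (Suc 1)"
      using critical_tuples_B2(4) by (simp add: critical_tuples_def numeral_2_eq_2)
    ultimately show ?thesis by (auto simp: column_diff_outside indicator_cochain_def)
  qed
  then have "(\<lambda>xs. - indicator_cochain [[2], [1]] xs :: 'r) = column_diff B2 1 (indicator_cochain [[2, 1]])"
    by auto
  then have "(\<lambda>xs. - indicator_cochain [[2], [1]] xs :: 'r) \<in> coboundaries (column_cochains B2) (column_diff B2) 2"
    using indicator_column_cochain[OF critical_tuples_B2(3)] by (auto simp: coboundaries_def numeral_2_eq_2)
  then show ?thesis using columns.B_minus by fastforce
qed

definition dual_cochain_1 :: "nat \<Rightarrow> nat list set list \<Rightarrow> 'r::comm_ring_1" where
  "dual_cochain_1 i = indicator_cochain [two.P [Suc i]]"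

definition dual_cochain_2 :: "nat \<Rightarrow> nat list set list \<Rightarrow> 'r::comm_ring_1" where
  "dual_cochain_2 i = word_cochain B2 (\<lambda>w. if w = [Suc i, 2, 1] then 1 else 0)"

definition dual_cochain_3 :: "nat list set list \<Rightarrow> 'r::comm_ring_1" where
  "dual_cochain_3 = cup_cochain 1 (dual_cochain_1 1) (dual_cochain_2 0)"

definition functional_3 :: "(nat list set list \<Rightarrow> 'r::comm_ring_1) \<Rightarrow> 'r" where
  "functional_3 f = f [two.P [2], two.P [1, 2], two.P [1]] - f [two.P [2], two.P [2, 1], two.P [1]]"

lemma in_lists_subset: "w \<in> lists A \<longleftrightarrow> set w \<subseteq> A"
  by (auto simp: lists_eq_set)

lemma less_2: "(i :: nat) < 2 \<longleftrightarrow> i = 0 \<or> i = 1"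
  by auto

lemma dual_cochain_1_apply:
  "i < 2 \<Longrightarrow> set w \<subseteq> B2 \<Longrightarrow> dual_cochain_1 i [two.P w] = (if w = [Suc i] then 1 else 0)"
  using plactic_class_letter_eq_iff[of "Suc i" B2 w]
  by (auto simp: dual_cochain_1_def indicator_cochain_def in_lists_subset less_2)

lemma dual_cochain_2_apply:
  assumes "set u \<subseteq> B2" "set v \<subseteq> B2"
  shows "dual_cochain_2 i [two.P u, two.P v] = (if u \<noteq> [] \<and> v \<noteq> [] \<and> u @ v = [Suc i, 2, 1] then 1 else 0)"
proof (cases "u = [] \<or> v = []")
  case True
  then show ?thesis
    using assms word_cochain_unit[of u v B2] by (auto simp: dual_cochain_2_def in_lists_subset)
next
  case False
  have "word_cochain B2 (\<lambda>w. if w = [Suc i, 2, 1] then 1 else 0) [two.P u, two.P v]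
      = (if u @ v = [Suc i, 2, 1] then 1 else 0)"
    using assms False by (intro word_cochain_apply) (auto simp: in_lists_subset dest: knuth_cong_length)
  then show ?thesis using False by (simp add: dual_cochain_2_def)
qed

lemma dual_cochain_1_cocycle: "i < 2 \<Longrightarrow> dual_cochain_1 i \<in> plactic_cocycles B2 1"
  unfolding cocycle_1_iff
proof (intro conjI ballI)
  assume i: "i < 2"
  then show "dual_cochain_1 i \<in> hoch_cochains (plactic B2) 1"
    by (auto simp: dual_cochain_1_def indicator_cochain_def hoch_cochains_def tuples_1 less_2
        plactic_class_in_carrier in_lists_subset)
  fix u v assume "u \<in> lists B2" "v \<in> lists B2"
  then show "dual_cochain_1 i [two.P (u @ v)]
      = eps0 (two.P u) * dual_cochain_1 i [two.P v] + eps0 (two.P v) * dual_cochain_1 i [two.P u]"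
    using i by (cases "u = []"; cases "v = []")
      (auto simp: in_lists_subset dual_cochain_1_apply[unfolded One_nat_def] eps0_plactic_class append_eq_Cons_conv)
qed

lemma dual_cochain_2_cocycle: "dual_cochain_2 i \<in> plactic_cocycles B2 2"
  unfolding dual_cochain_2_def by (rule word_cochain_cocycle) (auto dest: knuth_cong_length)

lemma dual_cochain_3_cocycle: "dual_cochain_3 \<in> plactic_cocycles B2 3"
  using cup_cochain_cocycle[OF dual_cochain_1_cocycle[of 1] dual_cochain_2_cocycle[of 0]]
  by (simp add: dual_cochain_3_def numeral_3_eq_3 numeral_2_eq_2)

lemma dual_cochain_normalized:
  "i < 2 \<Longrightarrow> (dual_cochain_1 i :: _ \<Rightarrow> 'r::comm_ring_1) \<in> normalized_cochains (plactic B2) 1"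
  "(dual_cochain_2 i :: _ \<Rightarrow> 'r) \<in> normalized_cochains (plactic B2) 2"
  "(dual_cochain_3 :: _ \<Rightarrow> 'r) \<in> normalized_cochains (plactic B2) 3"
proof -
  have z1: "dual_cochain_1 i xs = (0 :: 'r)" if "i < 2" "two.P [] \<in> set xs" for i xs
    using that plactic_class_Nil_iff[of "[Suc i]" B2]
    by (auto simp: dual_cochain_1_def indicator_cochain_def in_lists_subset less_2)
  have z2: "dual_cochain_2 i xs = (0 :: 'r)" if "two.P [] \<in> set xs" for i xs
    using that plactic_class_Nil_iff[of _ B2] by (fastforce simp: dual_cochain_2_def word_cochain_def)
  have "dual_cochain_3 xs = (0 :: 'r)" if "two.P [] \<in> set xs" for xs
  proof -
    have "two.P [] \<in> set (take 1 xs) \<or> two.P [] \<in> set (drop 1 xs)"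
      using that set_append[of "take 1 xs" "drop 1 xs"] by simp
    then show ?thesis
      using z1[of 1 "take 1 xs"] z2[of "drop 1 xs" 0] unfolding dual_cochain_3_def cup_cochain_def by force
  qed
  then show "(dual_cochain_3 :: _ \<Rightarrow> 'r) \<in> normalized_cochains (plactic B2) 3"
    using dual_cochain_3_cocycle unfolding normalized_cochains_def cocycles_def one_plactic by blast
  show "i < 2 \<Longrightarrow> (dual_cochain_1 i :: _ \<Rightarrow> 'r) \<in> normalized_cochains (plactic B2) 1"
    using dual_cochain_1_cocycle z1 unfolding normalized_cochains_def cocycles_def one_plactic by blast
  show "(dual_cochain_2 i :: _ \<Rightarrow> 'r) \<in> normalized_cochains (plactic B2) 2"
    using dual_cochain_2_cocycle z2 unfolding normalized_cochains_def cocycles_def one_plactic by blast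
qed

lemma normalized_zero:
  "f \<in> normalized_cochains (plactic B2) k \<Longrightarrow> two.P [] \<in> set xs \<Longrightarrow> f xs = 0"
  by (simp add: normalized_cochains_def one_plactic)

lemma quantum_symmetrizer_outside: "xs \<notin> tuples X k \<Longrightarrow> quantum_symmetrizer X \<sigma> \<iota> k f xs = 0"
  by (simp add: quantum_symmetrizer_def)

lemma indicator_outside: "cs \<in> critical_tuples X \<sigma> e k \<Longrightarrow> xs \<notin> tuples X k \<Longrightarrow> indicator_cochain cs xs = 0"
  by (auto simp: indicator_cochain_def critical_tuples_def)

lemma quantum_symmetrizer_B2_1:
  fixes f :: "nat list set list \<Rightarrow> 'r::comm_ring_1"
  assumes f: "f \<in> plactic_cocycles B2 1" and n: "f \<in> normalized_cochains (plactic B2) 1"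
  shows "quantum_symmetrizer (Col B2) sigma_C two.P 1 f
    = (\<lambda>xs. \<Sum>i<2. f [two.P [Suc i]] * indicator_cochain [[Suc i]] xs)"
proof
  fix xs
  have "f [two.P (u @ v)] = eps0 (two.P u) * f [two.P v] + eps0 (two.P v) * f [two.P u]"
    if "u \<in> lists B2" "v \<in> lists B2" for u v
    using f that unfolding cocycle_1_iff by blast
  from this[of "[2]" "[1]"] have z: "f [two.P [2, 1]] = 0" "f [two.P []] = 0"
    using normalized_zero[OF n, of "[two.P []]"] by (simp_all add: eps0_plactic_class)
  let ?r = "\<lambda>xs. \<Sum>i<2. f [two.P [Suc i]] * indicator_cochain [[Suc i]] xs"
  have ev: "\<forall>x\<in>{[], [1], [2], [2, 1]}. f (map two.P [x]) = ?r [x]"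
    by (simp add: lessThan_2 evaluate_columns z[unfolded One_nat_def] flip: numeral_2_eq_2)
  show "quantum_symmetrizer (Col B2) sigma_C two.P 1 f xs = ?r xs"
  proof (cases "xs \<in> tuples (Col B2) 1")
    case True
    then show ?thesis
      using ev quantum_symmetrizer_1[OF True, of sigma_C two.P f] unfolding Col_B2 by (auto simp: tuples_1)
  next
    case False
    then show ?thesis
      using critical_tuples_B2(1,2) by (simp add: quantum_symmetrizer_outside indicator_outside lessThan_2 numeral_2_eq_2[symmetric])
  qed
qed

lemma quantum_symmetrizer_B2_2:
  fixes f :: "nat list set list \<Rightarrow> 'r::comm_ring_1"
  assumes f: "f \<in> plactic_cocycles B2 2" and n: "f \<in> normalized_cochains (plactic B2) 2"
  shows "quantum_symmetrizer (Col B2) sigma_C two.P 2 f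
    = (\<lambda>xs. (\<Sum>i<2. knuth_functional B2 ([Suc i], [2, 1]) f * indicator_cochain [[Suc i], [2, 1]] xs)
        + f [two.P [2], two.P [1]] * indicator_cochain [[2], [1]] xs)"
proof
  fix xs
  let ?r = "\<lambda>xs. (\<Sum>i<2. knuth_functional B2 ([Suc i], [2, 1]) f * indicator_cochain [[Suc i], [2, 1]] xs)
        + f [two.P [2], two.P [1]] * indicator_cochain [[2], [1]] xs"
  show "quantum_symmetrizer (Col B2) sigma_C two.P 2 f xs = ?r xs"
  proof (cases "xs \<in> tuples (Col B2) 2")
    case True
    have z: "f [two.P [], u] = 0" "f [u, two.P []] = 0" for u using normalized_zero[OF n] by simp_all
    have k: "knuth_functional B2 ([1], [2, 1]) f = f [two.P [1], two.P [2, 1]] - f [two.P [2, 1], two.P [1]]"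
      "knuth_functional B2 ([2], [2, 1]) f = f [two.P [2], two.P [2, 1]] - f [two.P [2, 1], two.P [2]]"
      using cocycle_2_shift[OF f, of "[2, 1]" "[1]"] cocycle_2_shift[OF f, of "[2, 1]" "[2]"]
      by (simp_all add: knuth_functional_apply in_lists_subset)
    have "\<forall>x\<in>{[], [1], [2], [2, 1]}. \<forall>y\<in>{[], [1], [2], [2, 1]}.
        f (map two.P [x, y]) - f (map two.P (braid_at sigma_C 0 [x, y])) = ?r [x, y]"
      by (simp add: lessThan_2 k[unfolded One_nat_def] evaluate_columns z[unfolded One_nat_def] flip: numeral_2_eq_2)
    then show ?thesis
      using True quantum_symmetrizer_2[OF True, of sigma_C two.P f] unfolding Col_B2 by (auto simp: tuples_2)
  next
    case False
    then show ?thesis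
      using critical_tuples_B2(4-6) by (simp add: quantum_symmetrizer_outside indicator_outside lessThan_2 numeral_2_eq_2[symmetric])
  qed
qed

lemma quantum_symmetrizer_B2_3:
  fixes f :: "nat list set list \<Rightarrow> 'r::comm_ring_1"
  assumes f: "f \<in> plactic_cocycles B2 3" and n: "f \<in> normalized_cochains (plactic B2) 3"
  shows "quantum_symmetrizer (Col B2) sigma_C two.P 3 f
    = (\<lambda>xs. functional_3 f * indicator_cochain [[2], [1], [2, 1]] xs)"
proof
  fix xs
  obtain w where w: "w = [0, 1, 0] \<or> w = [1, 0, 1]"
    and qs: "\<forall>xs\<in>tuples (Col B2) 3. quantum_symmetrizer (Col B2) sigma_C two.P 3 f xs
    = f (map two.P xs) - f (map two.P (braid_word sigma_C [0] xs)) - f (map two.P (braid_word sigma_C [1] xs))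
      + f (map two.P (braid_word sigma_C [0, 1] xs)) + f (map two.P (braid_word sigma_C [1, 0] xs))
      - f (map two.P (braid_word sigma_C w xs))"
    using quantum_symmetrizer_3[of "Col B2" sigma_C two.P f] by blast
  show "quantum_symmetrizer (Col B2) sigma_C two.P 3 f xs = functional_3 f * indicator_cochain [[2], [1], [2, 1]] xs"
  proof (cases "xs \<in> tuples (Col B2) 3")
    case True
    have z: "f [two.P [], u, v] = 0" "f [u, two.P [], v] = 0" "f [u, v, two.P []] = 0" for u v
      using normalized_zero[OF n] by simp_all
    have "hoch_diff (plactic B2) eps0 3 f [two.P [2], two.P [1], two.P [2], two.P [1]] = 0"
      using f by (simp add: cocycles_def)
    then have "- f [two.P [2, 1], two.P [2], two.P [1]] + f [two.P [2], two.P [1, 2], two.P [1]]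
        - f [two.P [2], two.P [1], two.P [2, 1]] = 0"
      using hoch_diff_Cons[of "two.P [2]" "two.P [1]" "[two.P [2], two.P [1]]" "plactic B2" 3 eps0 f]
      by (simp add: tuples_def mult_plactic in_lists_subset eps0_plactic_class plactic_class_in_carrier algebra_simps)
    then have k: "functional_3 f = f [two.P [2], two.P [1], two.P [2, 1]]
        - f [two.P [2], two.P [2, 1], two.P [1]] + f [two.P [2, 1], two.P [2], two.P [1]]"
      by (simp add: functional_3_def algebra_simps)
    have ev: "\<forall>x\<in>{[], [1], [2], [2, 1]}. \<forall>y\<in>{[], [1], [2], [2, 1]}. \<forall>u\<in>{[], [1], [2], [2, 1]}.
        f (map two.P [x, y, u]) - f (map two.P (braid_word sigma_C [0] [x, y, u]))
        - f (map two.P (braid_word sigma_C [1] [x, y, u]))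
        + f (map two.P (braid_word sigma_C [0, 1] [x, y, u])) + f (map two.P (braid_word sigma_C [1, 0] [x, y, u]))
        - f (map two.P (braid_word sigma_C w [x, y, u])) = functional_3 f * indicator_cochain [[2], [1], [2, 1]] [x, y, u]"
      using w by (elim disjE; hypsubst; simp add: k[unfolded One_nat_def] evaluate_columns z[unfolded One_nat_def])
    obtain x y u where xs: "xs = [x, y, u]" "x \<in> Col B2" "y \<in> Col B2" "u \<in> Col B2"
      using True by (auto simp: tuples_3)
    show ?thesis
      using bspec[OF qs True] ev[folded Col_B2, THEN bspec, OF xs(2), THEN bspec, OF xs(3), THEN bspec, OF xs(4)]
      unfolding xs(1) by (rule trans)
  next
    case False
    then show ?thesis
      using critical_tuples_B2(7) by (simp add: quantum_symmetrizer_outside indicator_outside)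
  qed
qed

lemma ball_less_2: "(\<forall>i\<in>{..<2}. Q (Suc i)) \<longleftrightarrow> Q 1 \<and> Q 2"
  unfolding lessThan_2 by (simp add: numeral_2_eq_2)

lemma symmetrizer_basis_1:
  "symmetrizer_basis B2 1 2 (\<lambda>i f. f [two.P [Suc i]]) dual_cochain_1 (\<lambda>i. [[Suc i]])"
proof (unfold_locales, goal_cases)
  case (2 f)
  have "f \<in> plactic_coboundaries B2 1 \<longleftrightarrow> (\<forall>a\<in>B2. f [two.P [a]] = 0)"
    using cohomology_coordinates.\<Lambda>_kernel[OF plactic_coordinates_1 2] .
  then show ?case using ball_less_2[of "\<lambda>a. f [two.P [a]] = 0"] by simp
next
  case (3 i)
  then show ?case by (simp add: dual_cochain_1_cocycle[unfolded One_nat_def])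
next
  case (4 i j)
  then show ?case by (auto simp: dual_cochain_1_apply[unfolded One_nat_def] less_2)
next
  case (5 i)
  then show ?case by (simp add: dual_cochain_normalized(1)[unfolded One_nat_def])
next
  case (8 i)
  then have "[[Suc i]] = [[1]] \<or> [[Suc i]] = [[2]]" by auto
  then show ?case by (rule column_cocycle_1)
next
  case (9 i h)
  then show ?case by (auto simp: coboundaries_def column_diff_0)
next
  case (10 f)
  then show ?case
    using quantum_symmetrizer_B2_1[of f] columns.Z_zero columns.B_zero by (intro exI[of _ "\<lambda>_. 0"]) auto
qed (auto simp: algebra_simps)

lemma symmetrizer_basis_2:
  "symmetrizer_basis B2 2 2 (\<lambda>i. knuth_functional B2 ([Suc i], [2, 1])) dual_cochain_2 (\<lambda>i. [[Suc i], [2, 1]])"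
proof (unfold_locales, goal_cases)
  case (1 i f g r s)
  then show ?case by (simp add: knuth_functional_apply algebra_simps)
next
  case (2 f)
  have "C_wedge B2 = {([1], [2, 1]), ([2], [2, 1])}" by (auto simp: C_wedge_iff)
  moreover have "f \<in> plactic_coboundaries B2 2 \<longleftrightarrow> (\<forall>s\<in>C_wedge B2. knuth_functional B2 s f = 0)"
    using cohomology_coordinates.\<Lambda>_kernel[OF plactic_coordinates_2 2] .
  ultimately show ?case using ball_less_2[of "\<lambda>a. knuth_functional B2 ([a], [2, 1]) f = 0"] by simp
next
  case (3 i)
  show ?case by (rule dual_cochain_2_cocycle)
next
  case (4 i j)
  then show ?case by (auto simp: knuth_functional_apply dual_cochain_2_apply[unfolded One_nat_def] less_2)
next
  case (5 i)
  show ?case by (rule dual_cochain_normalized(2))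
next
  case (8 i)
  then have "[[Suc i], [2, 1]] = [[1], [2, 1]] \<or> [[Suc i], [2, 1]] = [[2], [2, 1]] \<or> [[Suc i], [2, 1]] = [[2], [1]]"
    by auto
  then show ?case by (rule column_cocycle_2)
next
  case (9 i h)
  then obtain g where "h = column_diff B2 1 g" by (auto simp: coboundaries_def numeral_2_eq_2)
  moreover have "column_diff B2 1 g [[1], [2, 1]] = 0" "column_diff B2 1 g [[2], [2, 1]] = 0"
    by (simp_all add: column_diff_1[unfolded One_nat_def] evaluate_columns)
  ultimately show ?case using 9(1) by (auto simp: less_2 simp flip: numeral_2_eq_2)
next
  case (10 f)
  let ?t = "\<lambda>xs. f [two.P [2], two.P [1]] * indicator_cochain [[2], [1]] xs"
  have "?t \<in> cocycles (column_cochains B2) (column_diff B2) 2"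
    by (intro columns.Z_smult column_cocycle_2) simp
  moreover have "?t \<in> coboundaries (column_cochains B2) (column_diff B2) 2"
    by (intro columns.B_smult column_coboundary_21)
  ultimately show ?case
    using quantum_symmetrizer_B2_2[OF 10] by blast
qed auto

lemma functional_3_kernel:
  assumes f: "f \<in> plactic_cocycles B2 3"
  shows "f \<in> plactic_coboundaries B2 3 \<longleftrightarrow> functional_3 f = 0"
proof
  assume "functional_3 f = 0"
  then show "f \<in> plactic_coboundaries B2 3"
    using two.cocycle_coboundary[of f 0] f by (simp add: functional_3_def numeral_3_eq_3)
next
  assume "f \<in> plactic_coboundaries B2 3"
  then obtain g where g: "f = hoch_diff (plactic B2) eps0 2 g"
    by (auto simp: coboundaries_def numeral_3_eq_3 numeral_2_eq_2)
  have "two.P [2, 1, 2] = two.P [2, 2, 1]" "two.P [1, 2, 1] = two.P [2, 1, 1]"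
    using knuth_cong_pqp[of 1 2 B2] knuth_cong_qpq[of 1 2 B2] by (simp_all add: plactic_class_eq_iff in_lists_subset)
  then show "functional_3 f = 0"
    by (simp add: functional_3_def g hoch_diff_2 plactic_class_in_carrier in_lists_subset mult_plactic eps0_plactic_class)
qed

lemma functional_3_dual: "functional_3 dual_cochain_3 = 1"
  by (simp add: functional_3_def dual_cochain_3_def cup_cochain_def dual_cochain_1_apply[unfolded One_nat_def]
      dual_cochain_2_apply[unfolded One_nat_def])

lemma symmetrizer_basis_3:
  "symmetrizer_basis B2 3 1 (\<lambda>_. functional_3) (\<lambda>_. dual_cochain_3) (\<lambda>_. [[2], [1], [2, 1]])"
proof (unfold_locales, goal_cases)
  case (1 i f g r s)
  then show ?case by (simp add: functional_3_def algebra_simps)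
next
  case (2 f)
  then show ?case using functional_3_kernel[OF 2] by auto
next
  case (8 i)
  show ?case by (rule column_cocycle_3)
next
  case (9 i h)
  then obtain g where g: "g \<in> column_cochains B2 2" "h = column_diff B2 2 g"
    by (auto simp: coboundaries_def numeral_3_eq_3 numeral_2_eq_2)
  have "[[2, 1], [2, 1]] \<notin> critical_tuples (Col B2) sigma_C [] 2"
    by (auto simp: critical_tuples_def evaluate_columns)
  then have "g [[2, 1], [2, 1]] = 0" using g(1) by (simp add: column_cochains_def crit_cochains_def)
  then show ?case by (simp add: g(2) column_diff_2 evaluate_columns)
next
  case (10 f)
  then show ?case
    using quantum_symmetrizer_B2_3[OF 10] columns.Z_zero columns.B_zero by (intro exI[of _ "\<lambda>_. 0"]) auto
qed (rule dual_cochain_3_cocycle dual_cochain_normalized(3) | simp add: functional_3_dual)+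

lemma two_letter_vanishing:
  assumes "f \<in> plactic_cocycles B2 k" "4 \<le> k"
  shows "f \<in> plactic_coboundaries B2 k"
proof -
  obtain n where "k = Suc (Suc (Suc (Suc n)))"
    using assms(2) by (auto simp: numeral_eq_Suc dest!: le_Suc_ex)
  then show ?thesis using two.cocycle_coboundary[of f "Suc n"] assms(1) by simp
qed


lemma column_classes:
  "column_class B2 [[1]] = hoch_class B2 1 (dual_cochain_1 0)"
  "column_class B2 [[2]] = hoch_class B2 1 (dual_cochain_1 1)"
  "column_class B2 [[1], [2, 1]] = hoch_class B2 2 (dual_cochain_2 0)"
  "column_class B2 [[2], [2, 1]] = hoch_class B2 2 (dual_cochain_2 1)"
  "column_class B2 [[2], [1], [2, 1]] = hoch_class B2 3 dual_cochain_3"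
  using symmetrizer_basis.column_class_eq[OF symmetrizer_basis_1, of 0]
    symmetrizer_basis.column_class_eq[OF symmetrizer_basis_1, of 1]
    symmetrizer_basis.column_class_eq[OF symmetrizer_basis_2, of 0]
    symmetrizer_basis.column_class_eq[OF symmetrizer_basis_2, of 1]
    symmetrizer_basis.column_class_eq[OF symmetrizer_basis_3, of 0]
  by (simp_all add: numeral_2_eq_2)

lemma column_class_bases:
  "is_basis (plactic_cohomology B2 1 :: ('r::comm_ring_1, _) module) [column_class B2 [[1]], column_class B2 [[2]]]"
  "is_basis (plactic_cohomology B2 2 :: ('r, _) module)
     [column_class B2 [[1], [2, 1]], column_class B2 [[2], [2, 1]]]"
  "is_basis (plactic_cohomology B2 3 :: ('r, _) module) [column_class B2 [[2], [1], [2, 1]]]"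
proof -
  have m: "map f [0..<2] = [f 0, f 1]" "map f [0..<1] = [f 0]" for f :: "nat \<Rightarrow> 'b"
    by (simp_all add: upt_rec)
  have s: "Suc 0 = 1" "Suc 1 = 2" by simp_all
  show "is_basis (plactic_cohomology B2 1 :: ('r, _) module) [column_class B2 [[1]], column_class B2 [[2]]]"
    using symmetrizer_basis.is_basis_column_class[OF symmetrizer_basis_1] unfolding m s .
  show "is_basis (plactic_cohomology B2 2 :: ('r, _) module)
     [column_class B2 [[1], [2, 1]], column_class B2 [[2], [2, 1]]]"
    using symmetrizer_basis.is_basis_column_class[OF symmetrizer_basis_2] unfolding m s .
  show "is_basis (plactic_cohomology B2 3 :: ('r, _) module) [column_class B2 [[2], [1], [2, 1]]]"
    using symmetrizer_basis.is_basis_column_class[OF symmetrizer_basis_3] unfolding m .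
qed

lemma functional_3_cup:
  assumes "i < 2"
  shows "functional_3 (cup_cochain 1 (dual_cochain_1 i) (dual_cochain_2 j))
      = (if i = 1 \<and> j = 0 then 1 else 0 :: 'r::comm_ring_1)"
    "functional_3 (cup_cochain 2 (dual_cochain_2 j) (dual_cochain_1 i))
      = (if i = 0 \<and> j = 1 then - 1 else 0 :: 'r)"
  using assms
  by (auto simp: functional_3_def cup_cochain_def dual_cochain_1_apply[unfolded One_nat_def]
      dual_cochain_2_apply[unfolded One_nat_def] less_2)

lemma two_letter_cup_products:
  fixes F :: "nat list list \<Rightarrow> (nat list set list \<Rightarrow> 'r::comm_ring_1) set"
  defines "F \<equiv> column_class B2"
  defines "cup \<equiv> (\<lambda>cs ds. plactic_cup B2 (length cs) (length ds) (F cs) (F ds))"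
  defines "H \<equiv> (plactic_cohomology B2 :: nat \<Rightarrow> ('r, _) module)"
  shows "cup [[2]] [[1], [2, 1]] = F [[2], [1], [2, 1]]"
    and "\<ominus>\<^bsub>H 3\<^esub> (cup [[2], [2, 1]] [[1]]) = F [[2], [1], [2, 1]]"
    and "\<forall>cs\<in>{[[1]], [[2]], [[1], [2, 1]], [[2], [2, 1]], [[2], [1], [2, 1]]}.
      \<forall>ds\<in>{[[1]], [[2]], [[1], [2, 1]], [[2], [2, 1]], [[2], [1], [2, 1]]}.
        (cs, ds) \<notin> {([[2]], [[1], [2, 1]]), ([[2], [2, 1]], [[1]])} \<longrightarrow>
        cup cs ds = \<zero>\<^bsub>H (length cs + length ds)\<^esub>"
proof -
  interpret s3: symmetrizer_basis B2 3 1 "\<lambda>_. functional_3 :: _ \<Rightarrow> 'r" "\<lambda>_. dual_cochain_3" "\<lambda>_. [[2], [1], [2, 1]]"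
    by (rule symmetrizer_basis_3)
  define g where "g cs = (if cs = [[1]] then dual_cochain_1 0 else if cs = [[2]] then dual_cochain_1 1
    else if cs = [[1], [2, 1]] then dual_cochain_2 0 else if cs = [[2], [2, 1]] then dual_cochain_2 1
    else dual_cochain_3 :: _ \<Rightarrow> 'r)" for cs :: "nat list list"
  let ?G = "{[[1]], [[2]], [[1], [2, 1]], [[2], [2, 1]], [[2], [1], [2, 1]]} :: nat list list set"
  have g: "g [[1]] = dual_cochain_1 0" "g [[2]] = dual_cochain_1 1" "g [[1], [2, 1]] = dual_cochain_2 0"
    "g [[2], [2, 1]] = dual_cochain_2 1" "g [[2], [1], [2, 1]] = dual_cochain_3"
    by (simp_all add: g_def)
  have len: "length [x] = 1" "length [x, y] = 2" "length [x, y, z] = 3" for x y z :: "nat list"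
    by simp_all
  have gZ: "g cs \<in> plactic_cocycles B2 (length cs)" if "cs \<in> ?G" for cs
  proof -
    have d1: "dual_cochain_1 0 \<in> (plactic_cocycles B2 1 :: (_ \<Rightarrow> 'r) set)"
      "dual_cochain_1 1 \<in> (plactic_cocycles B2 1 :: (_ \<Rightarrow> 'r) set)"
      by (rule dual_cochain_1_cocycle, simp)+
    show ?thesis
      using that by (elim insertE emptyE; hypsubst)
        (simp_all only: g len dual_cochain_2_cocycle dual_cochain_3_cocycle d1)
  qed
  have F: "F cs = hoch_class B2 (length cs) (g cs)" if "cs \<in> ?G" for cs
    using that unfolding F_def by (elim insertE emptyE; hypsubst) (simp_all only: g len column_classes)
  have cup: "cup cs ds = hoch_class B2 (length cs + length ds) (cup_cochain (length cs) (g cs) (g ds))"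
    if "cs \<in> ?G" "ds \<in> ?G" for cs ds
    using that by (simp only: cup_def F plactic_cup_hoch_class gZ)
  have cupZ: "cup_cochain (length cs) (g cs) (g ds) \<in> plactic_cocycles B2 (length cs + length ds)"
    if "cs \<in> ?G" "ds \<in> ?G" for cs ds
    using that by (intro cup_cochain_cocycle gZ)
  have zero: "cup cs ds = \<zero>\<^bsub>H (length cs + length ds)\<^esub>"
    if "cs \<in> ?G" "ds \<in> ?G" "cup_cochain (length cs) (g cs) (g ds) \<in> plactic_coboundaries B2 (length cs + length ds)" for cs ds
    using that cup[OF that(1,2)] cupZ[OF that(1,2)]
    by (simp only: H_def plactic_cohomology_eq plactic.cls_eq_zero_iff)
  have l3: "1 + 2 = (3 :: nat)" "2 + 1 = (3 :: nat)" by simp_all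
  have "cup [[2]] [[1], [2, 1]] = hoch_class B2 3 dual_cochain_3"
    using cup[of "[[2]]" "[[1], [2, 1]]"] by (simp only: g len l3 dual_cochain_3_def) simp
  then show "cup [[2]] [[1], [2, 1]] = F [[2], [1], [2, 1]]"
    by (simp only: F_def column_classes)
  have c: "cup [[2], [2, 1]] [[1]] = hoch_class B2 3 (cup_cochain 2 (dual_cochain_2 1) (dual_cochain_1 0))"
    using cup[of "[[2], [2, 1]]" "[[1]]"] by (simp only: g len l3) simp
  have cZ: "cup_cochain 2 (dual_cochain_2 1) (dual_cochain_1 0) \<in> (plactic_cocycles B2 3 :: (_ \<Rightarrow> 'r) set)"
    using cupZ[of "[[2], [2, 1]]" "[[1]]"] by (simp only: g len l3) simp
  let ?c = "cup_cochain 2 (dual_cochain_2 1) (dual_cochain_1 0) :: _ \<Rightarrow> 'r"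
  have "\<ominus>\<^bsub>H 3\<^esub> (cup [[2], [2, 1]] [[1]]) = hoch_class B2 3 (\<lambda>x. - ?c x)"
    using plactic.a_inv_H[OF cZ] by (simp only: c H_def plactic_cohomology_eq)
  also have "\<dots> = hoch_class B2 3 dual_cochain_3"
  proof (rule s3.cls_eq_iff_\<Lambda>[THEN iffD2])
    show "(\<lambda>x. - ?c x) \<in> plactic_cocycles B2 3" using plactic.Z_smult[OF cZ, of "- 1"] by simp
    show "\<forall>s\<in>{..<1}. functional_3 (\<lambda>x. - ?c x) = functional_3 dual_cochain_3"
      using s3.\<Lambda>_smult[of 0 "- 1" ?c] functional_3_cup(2)[of 0 1, where 'r = 'r] by (simp add: functional_3_dual)
  qed (rule dual_cochain_3_cocycle)
  finally show "\<ominus>\<^bsub>H 3\<^esub> (cup [[2], [2, 1]] [[1]]) = F [[2], [1], [2, 1]]"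
    by (simp only: F_def column_classes)
  show "\<forall>cs\<in>?G. \<forall>ds\<in>?G. (cs, ds) \<notin> {([[2]], [[1], [2, 1]]), ([[2], [2, 1]], [[1]])} \<longrightarrow>
        cup cs ds = \<zero>\<^bsub>H (length cs + length ds)\<^esub>"
  proof (intro ballI impI)
    fix cs ds assume cs: "cs \<in> ?G" and ds: "ds \<in> ?G"
      and ne: "(cs, ds) \<notin> {([[2]], [[1], [2, 1]]), ([[2], [2, 1]], [[1]])}"
    consider "4 \<le> length cs + length ds" | "length cs = 1" "length ds = 1"
      | "length cs + length ds = 3" "cs \<in> {[[1]], [[2]]}" "ds \<in> {[[1], [2, 1]], [[2], [2, 1]]}"
      | "length cs + length ds = 3" "cs \<in> {[[1], [2, 1]], [[2], [2, 1]]}" "ds \<in> {[[1]], [[2]]}"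
      using cs ds by auto
    then show "cup cs ds = \<zero>\<^bsub>H (length cs + length ds)\<^esub>"
    proof cases
      case 1
      then show ?thesis using cs ds two_letter_vanishing[OF cupZ[OF cs ds]] zero by blast
    next
      case 2
      have "F es \<in> carrier (H 1)" if "es \<in> ?G" "length es = 1" for es
        using F[OF that(1)] gZ[OF that(1)] that(2)
        by (simp only: H_def plactic_cohomology_eq plactic.cls_in_carrier)
      then have "plactic_cup B2 1 1 (F cs) (F ds) = \<zero>\<^bsub>H 2\<^esub>"
        using cs ds 2 unfolding H_def by (intro cup_1_1) auto
      then show ?thesis using 2 by (simp add: cup_def numeral_2_eq_2)
    next
      case 3
      have "functional_3 (cup_cochain (length cs) (g cs) (g ds)) = 0"
        using 3(2,3) ne functional_3_cup(1)[where 'r = 'r]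
        by (auto simp: g[unfolded One_nat_def])
      then show ?thesis
        using zero[OF cs ds] functional_3_kernel[OF cupZ[OF cs ds, unfolded 3(1)]] unfolding 3(1) by blast
    next
      case 4
      have "functional_3 (cup_cochain (length cs) (g cs) (g ds)) = 0"
        using 4(2,3) ne functional_3_cup(2)[where 'r = 'r]
        by (auto simp: g[unfolded One_nat_def] numeral_2_eq_2[symmetric])
      then show ?thesis
        using zero[OF cs ds] functional_3_kernel[OF cupZ[OF cs ds, unfolded 4(1)]] unfolding 4(1) by blast
    qed
  qed
qed

lemma two_letter_high_degree:
  assumes "4 \<le> k"
  shows "carrier (plactic_cohomology B2 k :: ('r::comm_ring_1, _) module) = {\<zero>\<^bsub>plactic_cohomology B2 k\<^esub>}"
proof -
  have "X = \<zero>\<^bsub>plactic_cohomology B2 k\<^esub>" if X: "X \<in> carrier (plactic_cohomology B2 k :: ('r, _) module)" for X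
  proof -
    obtain f where f: "f \<in> plactic_cocycles B2 k" "X = hoch_class B2 k f"
      using X unfolding plactic_cohomology_eq plactic.carrier_H by blast
    then show ?thesis
      using plactic.cls_eq_zero_iff[OF f(1)] two_letter_vanishing[OF f(1) assms]
      by (simp only: plactic_cohomology_eq)
  qed
  moreover have "\<zero>\<^bsub>plactic_cohomology B2 k\<^esub> \<in> carrier (plactic_cohomology B2 k :: ('r, _) module)"
    by (simp only: plactic_cohomology_eq plactic.zero_H plactic.cls_in_carrier plactic.Z_zero)
  ultimately show ?thesis by blast
qed


theorem theorem7p4:
  fixes A :: "'a::linorder set"
  shows
    "(\<not> (finite A \<and> card A \<le> 2) \<longrightarrow>
        (\<forall>k. let H = (plactic_cohomology A k :: ('r::comm_ring_1, _) module)
             in carrier H \<noteq> {\<zero>\<^bsub>H\<^esub>}))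
     \<and> linearly_isomorphic (plactic_cohomology A 1) (map_module A :: ('r, _) module)
     \<and> linearly_isomorphic (plactic_cohomology A 2) (map_module (C_wedge A) :: ('r, _) module)
     \<and> (\<forall>x \<in> carrier (plactic_cohomology A 1 :: ('r, _) module).
        \<forall>y \<in> carrier (plactic_cohomology A 1 :: ('r, _) module).
          plactic_cup A 1 1 x y = \<zero>\<^bsub>plactic_cohomology A 2\<^esub>)
     \<and> (let B = {1, 2 :: nat};
            H = (plactic_cohomology B :: nat \<Rightarrow> ('r, _) module);
            F = column_class B;
            cup = (\<lambda>cs ds. plactic_cup B (length cs) (length ds) (F cs) (F ds))
        in is_basis (H 1) [F [[1]], F [[2]]]
         \<and> is_basis (H 2) [F [[1], [2, 1]], F [[2], [2, 1]]]
         \<and> is_basis (H 3) [F [[2], [1], [2, 1]]]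
         \<and> (\<forall>k\<ge>4. carrier (H k) = {\<zero>\<^bsub>H k\<^esub>})
         \<and> cup [[2]] [[1], [2, 1]] = F [[2], [1], [2, 1]]
         \<and> \<ominus>\<^bsub>H 3\<^esub> (cup [[2], [2, 1]] [[1]]) = F [[2], [1], [2, 1]]
         \<and> (let G = {[[1]], [[2]], [[1], [2, 1]], [[2], [2, 1]], [[2], [1], [2, 1]]}
            in \<forall>cs\<in>G. \<forall>ds\<in>G.
                 (cs, ds) \<notin> {([[2]], [[1], [2, 1]]), ([[2], [2, 1]], [[1]])} \<longrightarrow>
                 cup cs ds = \<zero>\<^bsub>H (length cs + length ds)\<^esub>))"
proof (intro conjI, goal_cases)
  case 1
  show ?case unfolding Let_def by (intro impI allI plactic_cohomology_nonzero)
next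
  case 2
  show ?case by (rule plactic_cohomology_1)
next
  case 3
  show ?case by (rule plactic_cohomology_2)
next
  case 4
  show ?case by (intro ballI cup_1_1)
next
  case 5
  have "\<forall>k\<ge>4. carrier (plactic_cohomology B2 k :: ('r, _) module) = {\<zero>\<^bsub>plactic_cohomology B2 k\<^esub>}"
    by (intro allI impI two_letter_high_degree)
  then show ?case
    unfolding Let_def by (intro conjI column_class_bases two_letter_cup_products)
qed

end
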